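(* Let $S\subset\mathbb{I}^3$ be a bounded zero mean curvature graph over a simply connected Jordan domain $\Omega\subset\mathbb{C}$. Suppose that $\partial S$ has an isotropic line segment $L$ on a boundary point $z_0\in\partial\Omega$ connecting two horizontal curves on $\partial S$ whose projections to the $xy$-plane form a regular (simple) analytic arc $\Gamma$ near $z_0$. Then the following hold. (i) $S$ can be extended real analytically across $L$ via the transformation $\sigma(z,t)=(R_\Gamma(z),2m-t)$, i.e. via the reflection $R_\Gamma$ with respect to $\Gamma$ in the $xy$-direction and the reflection with respect to the height $m$ of the midpoint of $L$ in the $t$-direction. (ii) If $X=(h,t):\mathbb{H}\to S$ is a conformal parametrization and $w_0\in\partial\mathbb{H}=\mathbb{R}$ satisfies $h(w_0)=z_0$, then $L$ coincides with the cluster point set $C(X,w_0)$ of $X$ at $w_0$.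
   Context: $\mathbb{I}^3$ is $\mathbb{R}^3\simeq\mathbb{C}\times\mathbb{R}$ with coordinates $(x,y,t)$, $z=x+iy$, and the degenerate metric $dx^2+dy^2$. A zero mean curvature graph over $\Omega$ is the graph $S=\{(z,\varphi(z)) : z\in\Omega\}$ of a harmonic function $\varphi:\Omega\to\mathbb{R}$; it is bounded if it is a bounded subset of $\mathbb{R}^3$. A Jordan domain is the interior of a Jordan curve. $\partial S=\overline{S}\setminus S$ in $\mathbb{R}^3$. An isotropic line segment is a (non-degenerate, closed) vertical segment, i.e. parallel to the $t$-axis. A horizontal curve is a curve contained in a plane $t=\mathrm{const}$. Boundary hypothesis: "$L$ is an isotropic line segment of $\partial S$ on $z_0$ connecting two horizontal curves $\gamma_1,\gamma_2$ of $\partial S$ whose projections form a regular simple analytic arc $\Gamma$ near $z_0$" means: there are an open neighbourhood $U$ of $z_0$ in $\mathbb{C}$ and reals $a\neq b$ such that $\Gamma:=\partial\Omega\cap U$ is a regular simple analytic arc containing $z_0$, $\Gamma\setminus\{z_0\}$ is the disjoint union of the two open subarcs $\Gamma_1,\Gamma_2$ on either side of $z_0$, and $\partial S\cap(U\times\mathbb{R})=\gamma_1\cup L\cup\gamma_2$, where $\gamma_1=\Gamma_1\times\{a\}$, $\gamma_2=\Gamma_2\times\{b\}$ and $L=\{z_0\}\times[\min(a,b),\max(a,b)]$. Regular simple analytic arc: a set $\Gamma=\gamma(I)\subset\mathbb{C}$ with $I\subset\mathbb{R}$ an open interval and $\gamma:I\to\mathbb{C}$ injective, real analytic, $\gamma'\neq0$.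 Writing $\gamma$ also for its holomorphic continuation to a neighbourhood of $I$ (conformal there), the reflection with respect to $\Gamma$ is $R_\Gamma:=\gamma\circ R\circ\gamma^{-1}$, defined near $\Gamma$, with $R$ complex conjugation; it does not depend on $\gamma$. Conformal parametrization: $X=(h,t):\mathbb{H}\to S$, where $\mathbb{H}$ is the upper half-plane, $h:\mathbb{H}\to\Omega$ is biholomorphic and $t=\varphi\circ h$. By Carathéodory's theorem $h$ extends to a homeomorphism of the closures ($\mathbb{H}$ closed up in the Riemann sphere), still denoted $h$. Let $\Pi(r,\theta)=re^{i\theta}$ on $\mathbb{R}\times(0,\pi)$. The cluster point set $C(X,w_0)$ consists of all points $p\in\mathbb{R}^3$ such that $p=\lim_{n\to\infty}X(w_n)$ for some sequence $w_n\in\mathbb{H}$ with $w_n\to w_0$. "$S$ can be extended real analytically across $L$ via $\sigma$" means: for a conformal parametrization $X$ with $h(0)=z_0$, there are an open set $V\subset\mathbb{R}\times(0,\pi)$ containing $\{0\}\times(0,\pi)$ and invariant under $\iota(r,\theta)=(-r,\pi-\theta)$, and a real analytic map $Y:V\to\mathbb{R}^3$, such that $Y=X\circ\Pi$ on $V\cap\{r>0\}$, $Y$ maps $\{0\}\times(0,\pi)$ onto $L$ minus its endpoints, and $Y(\iota(r,\theta))=\sigma(Y(r,\theta))$ for all $(r,\theta)\in V$ (in particular $\sigma$ is defined on $Y(V)$). *)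

theory Defs
  imports "HOL-Analysis.Analysis"
begin

text \<open>The isotropic space \<open>\<real>\<^sup>3\<close> is modelled as \<^typ>\<open>complex \<times> real\<close>, a point being \<open>(z, t)\<close>
  with \<open>z = x + i y\<close>.\<close>

section \<open>Harmonic functions and zero mean curvature graphs\<close>

text \<open>\<open>C\<^sup>2\<close> functions of \<open>z = x + i y\<close> with vanishing Laplacian; \<open>\<phi>xy\<close> is the \<open>y\<close>-derivative
  of \<open>\<phi>x\<close>, and so on.\<close>

definition harmonic_on :: "(complex \<Rightarrow> real) \<Rightarrow> complex set \<Rightarrow> bool" where
  "harmonic_on \<phi> \<Omega> \<longleftrightarrow> open \<Omega> \<and>
    (\<exists>\<phi>x \<phi>y \<phi>xx \<phi>xy \<phi>yx \<phi>yy :: complex \<Rightarrow> real.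
      (\<forall>z\<in>\<Omega>.
        (\<phi> has_derivative (\<lambda>v. \<phi>x z * Re v + \<phi>y z * Im v)) (at z) \<and>
        (\<phi>x has_derivative (\<lambda>v. \<phi>xx z * Re v + \<phi>xy z * Im v)) (at z) \<and>
        (\<phi>y has_derivative (\<lambda>v. \<phi>yx z * Re v + \<phi>yy z * Im v)) (at z) \<and>
        \<phi>xx z + \<phi>yy z = 0) \<and>
      continuous_on \<Omega> \<phi>xx \<and> continuous_on \<Omega> \<phi>xy \<and>
      continuous_on \<Omega> \<phi>yx \<and> continuous_on \<Omega> \<phi>yy)"

definition zmc_graph :: "complex set \<Rightarrow> (complex \<Rightarrow> real) \<Rightarrow> (complex \<times> real) set \<Rightarrow> bool" where
  "zmc_graph \<Omega> \<phi> S \<longleftrightarrow> harmonic_on \<phi> \<Omega> \<and> S = (\<lambda>z. (z, \<phi> z)) ` \<Omega>"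

definition jordan_domain :: "complex set \<Rightarrow> bool" where
  "jordan_domain \<Omega> \<longleftrightarrow>
    (\<exists>c. simple_path c \<and> pathfinish c = pathstart c \<and> \<Omega> = inside (path_image c))"

text \<open>Not the topological frontier in \<open>\<real>\<^sup>3\<close>, which would contain the surface itself.\<close>

definition surface_boundary :: "(complex \<times> real) set \<Rightarrow> (complex \<times> real) set" where
  "surface_boundary S = closure S - S"


section \<open>Real analytic maps, analytic arcs, and reflections\<close>

definition real_analytic_curve_on :: "(real \<Rightarrow> 'a::real_normed_vector) \<Rightarrow> real set \<Rightarrow> bool" where
  "real_analytic_curve_on f I \<longleftrightarrow>
    (\<forall>s0\<in>I. \<exists>c. \<exists>\<epsilon>>0. \<forall>s. \<bar>s - s0\<bar> < \<epsilon> \<longrightarrow>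
      (\<lambda>n. (s - s0) ^ n *\<^sub>R c n) sums f s)"

text \<open>Convergence of the double series is unconditional.\<close>

definition real_analytic_map_on :: "(real \<times> real \<Rightarrow> 'a::real_normed_vector) \<Rightarrow> (real \<times> real) set \<Rightarrow> bool" where
  "real_analytic_map_on f V \<longleftrightarrow>
    (\<forall>(x0, y0)\<in>V. \<exists>c. \<exists>\<epsilon>>0. \<forall>x y. \<bar>x - x0\<bar> < \<epsilon> \<and> \<bar>y - y0\<bar> < \<epsilon> \<longrightarrow>
      ((\<lambda>(i, j). ((x - x0) ^ i * (y - y0) ^ j) *\<^sub>R c i j) has_sum f (x, y)) (UNIV :: (nat \<times> nat) set))"

definition regular_analytic_parametrization ::
    "(real \<Rightarrow> complex) \<Rightarrow> real set \<Rightarrow> complex set \<Rightarrow> bool" where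
  "regular_analytic_parametrization \<gamma> I \<Gamma> \<longleftrightarrow>
    open I \<and> is_interval I \<and> I \<noteq> {} \<and>
    inj_on \<gamma> I \<and> real_analytic_curve_on \<gamma> I \<and>
    (\<forall>s\<in>I. vector_derivative \<gamma> (at s) \<noteq> 0) \<and>
    \<Gamma> = \<gamma> ` I"

text \<open>\<open>\<Gamma>\<close> is a regular simple analytic arc through \<open>z0\<close>, cut by \<open>z0\<close> into the two open
  subarcs \<open>\<Gamma>1\<close> and \<open>\<Gamma>2\<close>.\<close>

definition analytic_arc_split_at ::
    "complex set \<Rightarrow> complex \<Rightarrow> complex set \<Rightarrow> complex set \<Rightarrow> bool" where
  "analytic_arc_split_at \<Gamma> z0 \<Gamma>1 \<Gamma>2 \<longleftrightarrow>
    (\<exists>\<gamma> I s0. regular_analytic_parametrization \<gamma> I \<Gamma> \<and> s0 \<in> I \<and> \<gamma> s0 = z0 \<and>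
      \<Gamma>1 = \<gamma> ` (I \<inter> {..<s0}) \<and> \<Gamma>2 = \<gamma> ` (I \<inter> {s0<..}))"

text \<open>\<open>R\<close> is the reflection \<open>\<gamma> \<circ> cnj \<circ> \<gamma>\<^sup>-\<^sup>1\<close> on the neighbourhood \<open>N\<close> of \<open>\<Gamma>\<close>, where \<open>G\<close> is the
  conformal continuation of \<open>\<gamma>\<close>. As a germ along \<open>\<Gamma>\<close> the reflection is unique, but it has no
  canonical domain, hence the relational form. Values of \<open>R\<close> outside \<open>N\<close> are irrelevant.\<close>

definition arc_reflection :: "complex set \<Rightarrow> complex set \<Rightarrow> (complex \<Rightarrow> complex) \<Rightarrow> bool" where
  "arc_reflection \<Gamma> N R \<longleftrightarrow>
    (\<exists>\<gamma> I G D. regular_analytic_parametrization \<gamma> I \<Gamma> \<and>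
      open D \<and> complex_of_real ` I \<subseteq> D \<and> cnj ` D = D \<and>
      G holomorphic_on D \<and> inj_on G D \<and> (\<forall>s\<in>I. G (complex_of_real s) = \<gamma> s) \<and>
      N = G ` D \<and> (\<forall>z\<in>N. R z = G (cnj (inv_into D G z))))"


section \<open>Isotropic boundary segments\<close>

definition isotropic_segment :: "complex \<Rightarrow> real \<Rightarrow> real \<Rightarrow> (complex \<times> real) set" where
  "isotropic_segment z0 a b = {z0} \<times> {min a b..max a b}"

definition segment_connects_horizontal_curves ::
    "complex set \<Rightarrow> (complex \<times> real) set \<Rightarrow> complex \<Rightarrow> complex set \<Rightarrow> complex set \<Rightarrow> real \<Rightarrow> real \<Rightarrow> bool" where
  "segment_connects_horizontal_curves \<Omega> S z0 U \<Gamma> a b \<longleftrightarrow>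
    open U \<and> z0 \<in> U \<and> a \<noteq> b \<and> \<Gamma> = frontier \<Omega> \<inter> U \<and>
    (\<exists>\<Gamma>1 \<Gamma>2. analytic_arc_split_at \<Gamma> z0 \<Gamma>1 \<Gamma>2 \<and>
      surface_boundary S \<inter> (U \<times> UNIV) =
        \<Gamma>1 \<times> {a} \<union> isotropic_segment z0 a b \<union> \<Gamma>2 \<times> {b})"


section \<open>Conformal parametrizations, cluster sets, and extension across a segment\<close>

definition upper_half_plane :: "complex set" where
  "upper_half_plane = {w. Im w > 0}"

definition biholomorphic_between :: "(complex \<Rightarrow> complex) \<Rightarrow> complex set \<Rightarrow> complex set \<Rightarrow> bool" where
  "biholomorphic_between h A B \<longleftrightarrow>
    bij_betw h A B \<and> h holomorphic_on A \<and> inv_into A h holomorphic_on B"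

definition conformal_parametrization ::
    "complex set \<Rightarrow> (complex \<Rightarrow> real) \<Rightarrow> (complex \<Rightarrow> complex \<times> real) \<Rightarrow> bool" where
  "conformal_parametrization \<Omega> \<phi> X \<longleftrightarrow>
    biholomorphic_between (fst \<circ> X) upper_half_plane \<Omega> \<and>
    (\<forall>w\<in>upper_half_plane. snd (X w) = \<phi> (fst (X w)))"

text \<open>\<open>h w0 = z0\<close> at a real point \<open>w0\<close>, where \<open>h = fst \<circ> X\<close> is extended continuously to the boundary
  of the half-plane: the value of the extension at \<open>w0\<close> is the limit of \<open>h\<close> from inside.\<close>

definition boundary_value_at :: "(complex \<Rightarrow> complex \<times> real) \<Rightarrow> real \<Rightarrow> complex \<Rightarrow> bool" where
  "boundary_value_at X w0 z0 \<longleftrightarrow>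
    ((fst \<circ> X) \<longlongrightarrow> z0) (at (complex_of_real w0) within upper_half_plane)"

definition cluster_set :: "(complex \<Rightarrow> complex \<times> real) \<Rightarrow> real \<Rightarrow> (complex \<times> real) set" where
  "cluster_set X w0 =
    {p. \<exists>w :: nat \<Rightarrow> complex. (\<forall>n. w n \<in> upper_half_plane) \<and>
        w \<longlonglongrightarrow> complex_of_real w0 \<and> (\<lambda>n. X (w n)) \<longlonglongrightarrow> p}"

text \<open>The map \<open>\<Pi>(r, \<theta>) = r e\<^sup>i\<^sup>\<theta>\<close> of polar coordinates is \<^const>\<open>rcis\<close>; the map
  \<open>(r, \<theta>) \<mapsto> (-r, \<pi> - \<theta>)\<close> covers complex conjugation under it.\<close>

definition polar_flip :: "real \<times> real \<Rightarrow> real \<times> real" where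
  "polar_flip = (\<lambda>(r, \<theta>). (- r, pi - \<theta>))"

text \<open>Analytic extension across \<open>isotropic_segment z0 a b\<close> via a map \<open>\<sigma>\<close> defined on \<open>A\<close>.
  A conformal parametrization with \<open>h 0 = z0\<close> is determined only up to automorphisms of the half-plane
  fixing \<open>0\<close>; the extension is required for every choice, and a choice has to exist.\<close>

definition extends_analytically_across ::
    "complex set \<Rightarrow> (complex \<Rightarrow> real) \<Rightarrow> complex \<Rightarrow> real \<Rightarrow> real \<Rightarrow>
     (complex \<times> real) set \<Rightarrow> (complex \<times> real \<Rightarrow> complex \<times> real) \<Rightarrow> bool" where
  "extends_analytically_across \<Omega> \<phi> z0 a b A \<sigma> \<longleftrightarrow>
    (\<exists>X. conformal_parametrization \<Omega> \<phi> X \<and> boundary_value_at X 0 z0) \<and>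
    (\<forall>X. conformal_parametrization \<Omega> \<phi> X \<and> boundary_value_at X 0 z0 \<longrightarrow>
      (\<exists>V Y. open V \<and> V \<subseteq> UNIV \<times> {0<..<pi} \<and> {0} \<times> {0<..<pi} \<subseteq> V \<and>
        polar_flip ` V = V \<and>
        real_analytic_map_on Y V \<and>
        (\<forall>(r, \<theta>)\<in>V. r > 0 \<longrightarrow> Y (r, \<theta>) = X (rcis r \<theta>)) \<and>
        Y ` ({0} \<times> {0<..<pi}) = isotropic_segment z0 a b - {(z0, a), (z0, b)} \<and>
        Y ` V \<subseteq> A \<and>
        (\<forall>p\<in>V. Y (polar_flip p) = \<sigma> (Y p))))"

definition segment_reflection :: "(complex \<Rightarrow> complex) \<Rightarrow> real \<Rightarrow> complex \<times> real \<Rightarrow> complex \<times> real" where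
  "segment_reflection R m = (\<lambda>(z, t). (R z, 2 * m - t))"

end

theory Submission
  imports Defs "HOL-Complex_Analysis.Complex_Analysis"
begin

text \<open>Everything rests on a reflection principle: if \<open>f\<close> is holomorphic on a half disc with bounded
  imaginary part that tends to \<open>0\<close> at the diameter, except possibly at its centre, then \<open>f\<close> extends
  holomorphically. Let \<open>G\<close> be the conformal continuation of a parametrization of \<open>\<Gamma>\<close>, oriented so that
  it maps small upper half discs into \<open>\<Omega>\<close>. The principle applies to \<open>G\<^sup>-\<^sup>1 \<circ> h\<close>, since \<open>h\<close> is proper, and
  yields \<open>h = G \<circ> \<kappa>\<close> near \<open>w0\<close> with \<open>\<kappa>\<close> holomorphic, commuting with conjugation and \<open>\<kappa>' > 0\<close> at \<open>w0\<close>.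
  The height \<open>t\<close> is the imaginary part of a holomorphic function and has boundary values \<open>a\<close> and \<open>b\<close> on
  the two sides of \<open>w0\<close>; after subtracting \<open>b + (a - b) arg (w - w0) / \<pi>\<close> the principle applies again, so
  \<open>t = b + (a - b) arg (w - w0) / \<pi> + Im E\<close> with \<open>E\<close> holomorphic and commuting with conjugation. In polar
  coordinates both formulas extend analytically to negative radii, and the cluster set can be read off.\<close>

section \<open>Reflection of holomorphic functions with bounded imaginary part\<close>

text \<open>Near \<open>w0\<close> nothing is known about the boundary function except a bound, so
  continuity up to the axis has to be an outcome of the proof; the remedy is to integrate once. One
  exceptional point is harmless because the boundary value of the primitive is continuous there. The
  sign of the derivative of \<kappa> matters: it makes \<kappa> increasing on the axis and thereby
  decides on which side of \<open>w0\<close> the height tends to \<open>a\<close> and on which to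
  \<open>b\<close>. Orienting the chart may interchange the two heights; neither the segment nor its
  midpoint notices. The argument is the only term without a limit at \<open>w0\<close>. It sweeps
  out the segment in the cluster set, and in polar coordinates it is the coordinate \<theta> itself,
  which makes sense for r \<le> 0. Passing from \<theta> to pi - \<theta> turns b + (a - b) \<theta>
  / pi into a + b minus that value: this is 2m - t. Two existence claims need work of their own. A
  parametrization with h(0) = z0 comes from applying the reflection principle to the logarithm of a
  Riemann map read in the chart. A continuation G injective on a whole neighbourhood of \<Gamma>
  exists because \<Gamma> lies in a Jordan curve and so cannot accumulate on itself.\<close>

definition half_ball :: "real \<Rightarrow> real \<Rightarrow> complex set" where
  "half_ball x r = ball (complex_of_real x) r \<inter> {w. 0 < Im w}"

lemma half_ball_iff: "w \<in> half_ball x r \<longleftrightarrow> cmod (w - complex_of_real x) < r \<and> 0 < Im w"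
  by (simp add: half_ball_def dist_norm norm_minus_commute)

lemma open_half_ball [simp]: "open (half_ball x r)"
  unfolding half_ball_def by (intro open_Int open_ball open_halfspace_Im_gt)

lemma convex_half_ball [simp]: "convex (half_ball x r)"
  unfolding half_ball_def by (intro convex_Int convex_ball convex_halfspace_Im_gt)

lemma half_ball_mono: "r \<le> s \<Longrightarrow> half_ball x r \<subseteq> half_ball x s"
  by (auto simp: half_ball_iff)

text \<open>The modulus of exp(i (f - f w)) sees only the imaginary part of f, so it is at most
  exp(2M), and its derivative at w is i f'(w). Cauchy's estimate on the circle of radius r/2 then
  gives the bound.\<close>

lemma deriv_bound_of_bounded_Im:
  assumes hol: "f holomorphic_on ball w r" and r: "0 < r"
    and bd: "\<And>z. z \<in> ball w r \<Longrightarrow> \<bar>Im (f z)\<bar> \<le> M"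
  shows "norm (deriv f w) \<le> 2 * exp (2 * M) / r"
proof -
  define k where "k = (\<lambda>z. exp (\<i> * (f z - f w)))"
  have kh: "k holomorphic_on ball w r"
    unfolding k_def by (intro holomorphic_intros hol)
  have sub: "cball w (r/2) \<subseteq> ball w r" using r by auto
  have "norm ((deriv ^^ 1) k w) \<le> fact 1 * exp (2 * M) / (r/2) ^ 1"
  proof (rule Cauchy_inequality)
    show "k holomorphic_on ball w (r/2)"
      by (rule holomorphic_on_subset [OF kh]) (use r in auto)
    show "continuous_on (cball w (r/2)) k"
      by (rule continuous_on_subset [OF holomorphic_on_imp_continuous_on [OF kh] sub])
    show "0 < r/2" using r by simp
    fix x assume "norm (w - x) = r/2"
    then have "x \<in> ball w r" using r by (simp add: dist_norm)
    then have "- Im (f x) + Im (f w) \<le> 2 * M"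
      using bd [of x] bd [of w] r by auto
    then show "norm (k x) \<le> exp (2 * M)"
      by (simp add: k_def norm_exp_eq_Re)
  qed
  moreover have "(k has_field_derivative \<i> * deriv f w) (at w)"
  proof -
    have "(f has_field_derivative deriv f w) (at w)"
      using hol r by (intro holomorphic_derivI [of f "ball w r"]) auto
    then show ?thesis
      unfolding k_def by (auto intro!: derivative_eq_intros)
  qed
  then have "deriv k w = \<i> * deriv f w" by (rule DERIV_imp_deriv)
  ultimately show ?thesis by (simp add: norm_mult mult.commute)
qed

text \<open>Trades the logarithm that arises from integrating C / y for a power of y with an
  explicit primitive; any exponent strictly between 0 and 1 would keep that primitive continuous at
  0. The core is ln u \<le> u - 1 at u = 1 / sqrt y.\<close>

lemma inverse_sqrt_bound:
  fixes B C y :: real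
  assumes "0 \<le> B" "0 \<le> C" "0 < y" "y \<le> 1"
  shows "B - C * ln y \<le> (B + 2 * C) / sqrt y"
proof -
  have sq: "0 < sqrt y" "sqrt y \<le> 1" using assms by auto
  have "ln (1 / sqrt y) \<le> 1 / sqrt y - 1"
    using ln_le_minus_one [of "1 / sqrt y"] sq by simp
  then have l: "- ln y \<le> 2 / sqrt y"
    using assms by (simp add: ln_div ln_sqrt)
  have "B \<le> B / sqrt y"
    using assms(1) sq by (simp add: pos_le_divide_eq mult_left_le)
  moreover have "C * (- ln y) \<le> C * (2 / sqrt y)"
    using l assms(2) by (rule mult_left_mono)
  ultimately show ?thesis by (simp add: add_divide_distrib mult.commute)
qed

text \<open>A holomorphic function with bounded imaginary part has derivative \<open>O(1/y)\<close>, hence is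
  itself \<open>O(1/\<surd>y)\<close> near the real axis, which makes its primitive Hoelder continuous up to the axis.\<close>

lemma holomorphic_bounded_Im_growth:
  fixes x0 r M :: real
  assumes hol: "f holomorphic_on half_ball x0 r" and r: "0 < r"
    and bd: "\<And>w. w \<in> half_ball x0 r \<Longrightarrow> \<bar>Im (f w)\<bar> \<le> M"
  shows "\<exists>s K. 0 < s \<and> s \<le> 1 \<and> 8 * s \<le> r \<and> 0 < K \<and>
    (\<forall>w. \<bar>Re w - x0\<bar> \<le> s \<longrightarrow> 0 < Im w \<longrightarrow> Im w \<le> s \<longrightarrow> norm (f w) \<le> K / sqrt (Im w))"
proof -
  \<comment> \<open>Points of the box of half-width and height \<open>s\<close> lie within 2s of
    \<open>x0\<close>, so the disc of radius Im w about such a point w stays in the half disc; r/8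
    leaves room to spare. The bound s \<le> 1 makes ln s nonpositive.\<close>
  define s where "s = min (r/8) 1"
  have s: "0 < s" "s \<le> 1" "8 * s \<le> r" using r by (auto simp: s_def)
  define C where "C = 2 * exp (2 * M)"
  have C: "0 < C" by (simp add: C_def)
  have near: "cmod (w - of_real x0) \<le> 2 * s" if "\<bar>Re w - x0\<bar> \<le> s" "0 \<le> Im w" "Im w \<le> s" for w
    using cmod_le [of "w - of_real x0"] that by simp
  have sub: "w \<in> half_ball x0 r" if "\<bar>Re w - x0\<bar> \<le> s" "0 < Im w" "Im w \<le> s" for w
    using near [of w] that s by (simp add: half_ball_iff)
  have df: "norm (deriv f w) \<le> C / Im w" if w: "\<bar>Re w - x0\<bar> \<le> s" "0 < Im w" "Im w \<le> s" for w
  proof -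
    have "ball w (Im w) \<subseteq> half_ball x0 r"
    proof
      fix z assume z: "z \<in> ball w (Im w)"
      then have n: "cmod (z - w) < Im w" by (simp add: dist_norm norm_minus_commute)
      have "cmod (z - of_real x0) \<le> cmod (z - w) + cmod (w - of_real x0)"
        using norm_triangle_ineq [of "z - w" "w - of_real x0"] by simp
      then have "cmod (z - of_real x0) < r" using n near [of w] w s by linarith
      moreover have "\<bar>Im (z - w)\<bar> < Im w" using n abs_Im_le_cmod [of "z - w"] by linarith
      ultimately show "z \<in> half_ball x0 r" by (auto simp: half_ball_iff)
    qed
    then show ?thesis unfolding C_def
      using w by (intro deriv_bound_of_bounded_Im holomorphic_on_subset [OF hol] bd) auto
  qed
  \<comment> \<open>\<open>B\<close> bounds f on the top edge of the box. Integrating |f'| \<le> C /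
    y down a vertical line from that edge to w costs at most C times ln s - ln (Im w).\<close>
  have "compact ((\<lambda>x. Complex x s) ` {x0 - s..x0 + s})"
    by (intro compact_continuous_image continuous_intros compact_Icc)
  moreover have "continuous_on ((\<lambda>x. Complex x s) ` {x0 - s..x0 + s}) f"
    using s by (intro continuous_on_subset [OF holomorphic_on_imp_continuous_on [OF hol]])
      (auto intro!: sub)
  ultimately have "bounded (f ` (\<lambda>x. Complex x s) ` {x0 - s..x0 + s})"
    by (blast intro: compact_imp_bounded compact_continuous_image)
  then obtain B where B: "0 < B" "\<And>x. x \<in> {x0 - s..x0 + s} \<Longrightarrow> norm (f (Complex x s)) \<le> B"
    unfolding bounded_pos by blast
  have "norm (f w) \<le> (B + 2 * C) / sqrt (Im w)"
    if w: "\<bar>Re w - x0\<bar> \<le> s" "0 < Im w" "Im w \<le> s" for w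
  proof -
    have up: "norm (f (Complex (Re w) s)) \<le> B" using w B(2) by (auto simp: abs_le_iff)
    have "norm (f w) \<le> B - C * ln (Im w)"
    proof (cases "Im w = s")
      case True
      then have "w = Complex (Re w) s" by (simp add: complex_eq_iff)
      moreover have "C * ln (Im w) \<le> 0"
        using w s C by (simp add: mult_nonneg_nonpos)
      ultimately show ?thesis using up by simp
    next
      case False
      have "norm (f (Complex (Re w) s) - f (Complex (Re w) (Im w))) \<le> C * ln s - C * ln (Im w)"
      proof (rule differentiable_bound_general
          [of "Im w" s "\<lambda>y. f (Complex (Re w) y)" "\<lambda>y. C * ln y" "\<lambda>y. \<i> * deriv f (Complex (Re w) y)" "\<lambda>y. C / y"])
        show "Im w < s" using False w by simp
        have "continuous_on ((\<lambda>y. Complex (Re w) y) ` {Im w..s}) f"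
          using w by (intro continuous_on_subset [OF holomorphic_on_imp_continuous_on [OF hol]])
            (auto intro!: sub)
        then have "continuous_on {Im w..s} (f \<circ> (\<lambda>y. Complex (Re w) y))"
          by (intro continuous_on_compose continuous_intros)
        then show "continuous_on {Im w..s} (\<lambda>y. f (Complex (Re w) y))" by (simp add: o_def)
        show "continuous_on {Im w..s} (\<lambda>y. C * ln y)"
          using w by (intro continuous_intros) auto
      next
        fix y assume y: "Im w < y" "y < s"
        have "(f has_field_derivative deriv f (Complex (Re w) y)) (at (Complex (Re w) y))"
          using hol y w by (intro holomorphic_derivI [of f "half_ball x0 r"] sub) auto
        moreover have "((\<lambda>y. Complex (Re w) y) has_vector_derivative \<i>) (at y)"
          unfolding Complex_eq by (auto intro!: derivative_eq_intros)
        ultimately show "((\<lambda>y. f (Complex (Re w) y)) has_vector_derivative \<i> * deriv f (Complex (Re w) y)) (at y)"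
          using field_vector_diff_chain_at [of "\<lambda>y. Complex (Re w) y" \<i> y f] by (simp add: o_def)
        show "((\<lambda>y. C * ln y) has_vector_derivative C / y) (at y)"
          using y w by (auto intro!: derivative_eq_intros simp: has_real_derivative_iff_has_vector_derivative [symmetric])
        show "norm (\<i> * deriv f (Complex (Re w) y)) \<le> C / y"
          using df [of "Complex (Re w) y"] y w by (simp add: norm_mult)
      qed
      then have "norm (f (Complex (Re w) s) - f w) \<le> C * ln s - C * ln (Im w)" by simp
      moreover have "C * ln s \<le> 0" using s C by (simp add: mult_nonneg_nonpos)
      ultimately show ?thesis using up norm_triangle_ineq2 [of "f w" "f (Complex (Re w) s)"]
        by (simp add: norm_minus_commute)
    qed
    also have "\<dots> \<le> (B + 2 * C) / sqrt (Im w)"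
      using B C w s by (intro inverse_sqrt_bound) auto
    finally show ?thesis .
  qed
  moreover have "0 < B + 2 * C" using B C by simp
  ultimately show ?thesis using s by blast
qed

text \<open>Both points are lifted vertically by their distance \<eta>. Each lift costs the integral
  of K / sqrt y over an interval of length \<eta>, at most 2K sqrt \<eta>. Between the lifted points
  Im \<ge> \<eta>, so |f| \<le> K / sqrt \<eta> and the step costs K sqrt \<eta>: five units in all.
  The limits s/2 keep the lifted points in the box.\<close>

lemma primitive_Hoelder:
  fixes x0 s K :: real
  assumes s: "0 < s"
    and der: "\<And>w. \<bar>Re w - x0\<bar> \<le> s \<Longrightarrow> 0 < Im w \<Longrightarrow> Im w \<le> s \<Longrightarrow> (g has_field_derivative f w) (at w)"
    and bd: "\<And>w. \<bar>Re w - x0\<bar> \<le> s \<Longrightarrow> 0 < Im w \<Longrightarrow> Im w \<le> s \<Longrightarrow> norm (f w) \<le> K / sqrt (Im w)"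
    and K: "0 < K"
    and w: "\<bar>Re w - x0\<bar> \<le> s" "0 < Im w" "Im w \<le> s/2"
    and z: "\<bar>Re z - x0\<bar> \<le> s" "0 < Im z" "Im z \<le> s/2"
    and d: "norm (w - z) \<le> s/2"
  shows "norm (g w - g z) \<le> 5 * K * sqrt (norm (w - z))"
proof (cases "w = z")
  case False
  define \<eta> where "\<eta> = norm (w - z)"
  have \<eta>: "0 < \<eta>" "\<eta> \<le> s/2" using False d by (auto simp: \<eta>_def)
  have up: "norm (g (Complex (Re w) (Im w + \<eta>)) - g w) \<le> 2 * K * sqrt \<eta>"
    if w: "\<bar>Re w - x0\<bar> \<le> s" "0 < Im w" "Im w \<le> s/2" for w
  proof -
    have "norm (g (Complex (Re w) (Im w + \<eta>)) - g (Complex (Re w) (Im w)))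
        \<le> 2 * K * sqrt (Im w + \<eta>) - 2 * K * sqrt (Im w)"
    proof (rule differentiable_bound_general [of "Im w" "Im w + \<eta>" "\<lambda>y. g (Complex (Re w) y)"
          "\<lambda>y. 2 * K * sqrt y" "\<lambda>y. \<i> * f (Complex (Re w) y)" "\<lambda>y. K / sqrt y"])
      have D: "((\<lambda>y. g (Complex (Re w) y)) has_vector_derivative \<i> * f (Complex (Re w) y)) (at y)"
        if "0 < y" "y \<le> s" for y
      proof -
        have "((\<lambda>y. Complex (Re w) y) has_vector_derivative \<i>) (at y)"
          unfolding Complex_eq by (auto intro!: derivative_eq_intros)
        then show ?thesis
          using der [of "Complex (Re w) y"] that w
            field_vector_diff_chain_at [of "\<lambda>y. Complex (Re w) y" \<i> y g] by (simp add: o_def)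
      qed
      show "continuous_on {Im w..Im w + \<eta>} (\<lambda>y. g (Complex (Re w) y))"
        using w \<eta> by (intro continuous_at_imp_continuous_on ballI has_vector_derivative_continuous [OF D]) auto
      show "continuous_on {Im w..Im w + \<eta>} (\<lambda>y. 2 * K * sqrt y)" by (intro continuous_intros)
      fix y assume y: "Im w < y" "y < Im w + \<eta>"
      then show "((\<lambda>y. g (Complex (Re w) y)) has_vector_derivative \<i> * f (Complex (Re w) y)) (at y)"
        using w \<eta> by (intro D) auto
      show "((\<lambda>y. 2 * K * sqrt y) has_vector_derivative K / sqrt y) (at y)"
        using y w by (auto intro!: derivative_eq_intros
            simp: has_real_derivative_iff_has_vector_derivative [symmetric] field_simps)
      show "norm (\<i> * f (Complex (Re w) y)) \<le> K / sqrt y"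
        using bd [of "Complex (Re w) y"] y w \<eta> by (simp add: norm_mult)
    qed (use \<eta> in auto)
    also have "\<dots> \<le> 2 * K * sqrt \<eta>"
    proof -
      have "2 * K * sqrt (Im w + \<eta>) \<le> 2 * K * (sqrt (Im w) + sqrt \<eta>)"
        using K w \<eta> by (intro mult_left_mono sqrt_add_le_add_sqrt) auto
      then show ?thesis by (simp add: distrib_left)
    qed
    finally show ?thesis by simp
  qed
  define T where "T = {v. Re v \<in> {x0 - s..x0 + s} \<and> Im v \<in> {\<eta>..s}}"
  have T: "v \<in> T \<longleftrightarrow> \<bar>Re v - x0\<bar> \<le> s \<and> \<eta> \<le> Im v \<and> Im v \<le> s" for v
    by (auto simp: T_def)
  have "T = {v. x0 - s \<le> Re v} \<inter> {v. Re v \<le> x0 + s} \<inter> {v. \<eta> \<le> Im v} \<inter> {v. Im v \<le> s}"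
    by (auto simp: T_def)
  then have "convex T"
    by (simp add: convex_Int convex_halfspace_Re_le convex_halfspace_Re_ge convex_halfspace_Im_le convex_halfspace_Im_ge)
  then have "norm (g (Complex (Re w) (Im w + \<eta>)) - g (Complex (Re z) (Im z + \<eta>)))
      \<le> K / sqrt \<eta> * norm (Complex (Re w) (Im w + \<eta>) - Complex (Re z) (Im z + \<eta>))"
  proof (rule field_differentiable_bound)
    fix v assume v: "v \<in> T"
    then show "(g has_field_derivative f v) (at v within T)"
      using \<eta> by (auto simp: T intro: has_field_derivative_at_within [OF der])
    have "norm (f v) \<le> K / sqrt (Im v)" using v \<eta> by (intro bd) (auto simp: T)
    also have "\<dots> \<le> K / sqrt \<eta>" using v \<eta> K by (intro divide_left_mono) (auto simp: T)
    finally show "norm (f v) \<le> K / sqrt \<eta>" .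
  qed (use w z \<eta> in \<open>auto simp: T\<close>)
  also have "Complex (Re w) (Im w + \<eta>) - Complex (Re z) (Im z + \<eta>) = w - z"
    by (simp add: complex_eq_iff)
  also have "K / sqrt \<eta> * norm (w - z) = K * sqrt \<eta>"
    using \<eta> real_div_sqrt [of \<eta>] by (simp add: \<eta>_def [symmetric]) (metis times_divide_eq_right)
  finally have "norm (g (Complex (Re w) (Im w + \<eta>)) - g (Complex (Re z) (Im z + \<eta>))) \<le> K * sqrt \<eta>" .
  moreover note up [OF w] up [OF z]
  moreover have "g w - g z = (g (Complex (Re w) (Im w + \<eta>)) - g (Complex (Re z) (Im z + \<eta>)))
      - (g (Complex (Re w) (Im w + \<eta>)) - g w) + (g (Complex (Re z) (Im z + \<eta>)) - g z)" by simp
  ultimately have "norm (g w - g z) \<le> K * sqrt \<eta> + 2 * K * sqrt \<eta> + 2 * K * sqrt \<eta>"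
    by (smt (verit) norm_triangle_ineq norm_triangle_ineq4)
  then show ?thesis by (simp add: \<eta>_def)
qed simp

text \<open>The symmetry of F under conjugation is recorded along with the extension, since it later
  becomes the symmetry of the extended surface.\<close>

lemma Schwarz_reflection_ball:
  assumes hol: "f holomorphic_on half_ball x0 r"
    and cont: "continuous_on (ball (of_real x0) r \<inter> {w. 0 \<le> Im w}) f"
    and real: "\<And>x. \<bar>x - x0\<bar> < r \<Longrightarrow> Im (f (of_real x)) = 0"
  obtains F where "F holomorphic_on ball (of_real x0) r"
    "\<And>w. w \<in> ball (of_real x0) r \<Longrightarrow> F (cnj w) = cnj (F w)"
    "\<And>w. w \<in> half_ball x0 r \<Longrightarrow> F w = f w"
proof
  let ?F = "\<lambda>z. if 0 \<le> Im z then f z else cnj (f (cnj z))"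
  have cn: "cmod (complex_of_real x0 - cnj w) = cmod (complex_of_real x0 - w)" for w
    by (metis complex_cnj_complex_of_real complex_cnj_diff complex_mod_cnj)
  have re: "Im (f z) = 0" if "z \<in> ball (of_real x0) r" "Im z = 0" for z
  proof -
    have "z = of_real (Re z)" using that by (simp add: complex_eq_iff)
    moreover have "\<bar>Re z - x0\<bar> < r"
      using that abs_Re_le_cmod [of "z - of_real x0"] by (simp add: dist_norm norm_minus_commute)
    ultimately show ?thesis using real by metis
  qed
  show "?F holomorphic_on ball (of_real x0) r"
  proof (rule Schwarz_reflection)
    show "f holomorphic_on ball (complex_of_real x0) r \<inter> {z. 0 < Im z}"
      using hol by (simp add: half_ball_def)
    fix z assume z: "z \<in> ball (complex_of_real x0) r" "z \<in> \<real>"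
    then have "Im (f z) = 0" using re complex_is_Real_iff by blast
    then show "f z \<in> \<real>" by (simp add: complex_is_Real_iff)
  qed (use cont in \<open>auto simp: dist_norm cn\<close>)
  show "?F w = f w" if "w \<in> half_ball x0 r" for w using that by (simp add: half_ball_iff)
  show "?F (cnj w) = cnj (?F w)" if "w \<in> ball (of_real x0) r" for w
  proof (cases "Im w = 0")
    case True
    then have "cnj w = w" by (simp add: complex_eq_iff)
    moreover have "cnj (f w) = f w" using re [OF that True] by (simp add: complex_eq_iff)
    ultimately show ?thesis using True by simp
  qed auto
qed

text \<open>Carries the symmetry from the reflected primitive back to the function that was
  integrated.\<close>

lemma deriv_cnj_symmetric:
  assumes "open S" "F holomorphic_on S" "\<And>w. w \<in> S \<Longrightarrow> cnj w \<in> S"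
    and sym: "\<And>w. w \<in> S \<Longrightarrow> F (cnj w) = cnj (F w)" and w: "w \<in> S"
  shows "deriv F (cnj w) = cnj (deriv F w)"
proof -
  have "(F has_field_derivative deriv F w) (at w)"
    using assms by (intro holomorphic_derivI)
  then have "((cnj \<circ> F \<circ> cnj) has_field_derivative cnj (deriv F w)) (at (cnj w))"
    by (intro has_field_derivative_cnj_cnj) simp
  moreover have "(cnj \<circ> F \<circ> cnj) z = F z" if "z \<in> S" for z
    using sym [OF that] by simp
  ultimately have "(F has_field_derivative cnj (deriv F w)) (at (cnj w))"
    using assms by (auto intro: has_field_derivative_transform_within_open [of _ _ _ S])
  then show ?thesis by (rule DERIV_imp_deriv)
qed

text \<open>The function itself need not extend continuously to the axis a priori, but its primitive
  does; the reflection principle is applied to the primitive.\<close>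

proposition reflection_of_bounded_Im:
  fixes x0 r M :: real
  assumes hol: "f holomorphic_on half_ball x0 r" and r: "0 < r"
    and bd: "\<And>w. w \<in> half_ball x0 r \<Longrightarrow> \<bar>Im (f w)\<bar> \<le> M"
    and lim: "\<And>x. \<bar>x - x0\<bar> < r \<Longrightarrow> x \<noteq> x0 \<Longrightarrow>
      ((\<lambda>w. Im (f w)) \<longlongrightarrow> 0) (at (of_real x) within half_ball x0 r)"
  obtains F \<rho> where "0 < \<rho>" "\<rho> \<le> r" "F holomorphic_on ball (of_real x0) \<rho>"
    "\<And>w. w \<in> ball (of_real x0) \<rho> \<Longrightarrow> F (cnj w) = cnj (F w)"
    "\<And>w. w \<in> half_ball x0 \<rho> \<Longrightarrow> F w = f w"
proof -
  obtain s K where s: "0 < s" "s \<le> 1" "8 * s \<le> r" and K: "0 < K"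
    and gr: "\<And>w. \<bar>Re w - x0\<bar> \<le> s \<Longrightarrow> 0 < Im w \<Longrightarrow> Im w \<le> s \<Longrightarrow> norm (f w) \<le> K / sqrt (Im w)"
    using holomorphic_bounded_Im_growth [OF hol r bd] by blast
  have sub: "w \<in> half_ball x0 r" if "\<bar>Re w - x0\<bar> \<le> s" "0 < Im w" "Im w \<le> s" for w
    using cmod_le [of "w - of_real x0"] that s by (simp add: half_ball_iff)
  have "\<exists>g. \<forall>w\<in>half_ball x0 r. (g has_field_derivative f w) (at w within half_ball x0 r)"
  proof (rule holomorphic_convex_primitive [of "half_ball x0 r" "{}" f])
    show "continuous_on (half_ball x0 r) f" using hol holomorphic_on_imp_continuous_on by blast
    fix x assume "x \<in> interior (half_ball x0 r) - {}"
    then show "f field_differentiable at x"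
      using hol by (simp add: interior_open holomorphic_on_open field_differentiable_def)
  qed auto
  then obtain g where g: "\<And>w. w \<in> half_ball x0 r \<Longrightarrow> (g has_field_derivative f w) (at w)"
    by (metis at_within_open open_half_ball)
  define Q where "Q = {w. \<bar>Re w - x0\<bar> \<le> s \<and> 0 < Im w \<and> Im w \<le> s/2}"
  have "uniformly_continuous_on Q g"
    unfolding uniformly_continuous_on_def
  proof (intro allI impI)
    fix e :: real assume e: "0 < e"
    \<comment> \<open>The 6 exceeds the constant 5 of the Hoelder estimate, which leaves a strict
      inequality; s/2 is the range of distances covered by that estimate.\<close>
    define d where "d = min (s/2) ((e / (6 * K))^2)"
    have "0 < d" using s e K by (auto simp: d_def)
    moreover have "dist (g w) (g z) < e" if "z \<in> Q" "w \<in> Q" "dist w z < d" for w z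
    proof -
      have n: "norm (w - z) < s/2" "norm (w - z) < (e / (6 * K))^2"
        using that by (auto simp: d_def dist_norm)
      have "norm (g w - g z) \<le> 5 * K * sqrt (norm (w - z))"
        by (rule primitive_Hoelder [where f = f, OF s(1) g gr K])
          (use that n s in \<open>auto simp: Q_def intro!: sub\<close>)
      also have "sqrt (norm (w - z)) \<le> e / (6 * K)"
        using n(2) e K by (intro real_le_lsqrt) auto
      then have "5 * K * sqrt (norm (w - z)) \<le> 5 * K * (e / (6 * K))"
        using K by (intro mult_left_mono) auto
      also have "\<dots> < e" using K e by (simp add: field_simps)
      finally show ?thesis by (simp add: dist_norm)
    qed
    ultimately show "\<exists>d>0. \<forall>x\<in>Q. \<forall>x'\<in>Q. dist x' x < d \<longrightarrow> dist (g x') (g x) < e" by blast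
  qed
  then obtain G where G: "continuous_on (closure Q) G" "\<And>w. w \<in> Q \<Longrightarrow> G w = g w"
    by (metis uniformly_continuous_on_extension_on_closure uniformly_continuous_imp_continuous)
  define \<epsilon> where "\<epsilon> = (\<lambda>n. s / 4 * inverse (real (Suc n)))"
  have \<epsilon>0: "\<epsilon> \<longlonglongrightarrow> 0"
  proof -
    have "\<epsilon> \<longlonglongrightarrow> s / 4 * 0"
      unfolding \<epsilon>_def by (intro tendsto_intros LIMSEQ_inverse_real_of_nat)
    then show ?thesis by simp
  qed
  have lift: "(\<lambda>n. w + of_real (\<epsilon> n) * \<i>) \<longlonglongrightarrow> w" for w
  proof -
    have "(\<lambda>n. w + of_real (\<epsilon> n) * \<i>) \<longlonglongrightarrow> w + of_real 0 * \<i>"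
      by (intro tendsto_intros \<epsilon>0)
    then show ?thesis by simp
  qed
  have small: "0 < \<epsilon> n" "\<epsilon> n \<le> s/4" for n
  proof -
    have "s / 4 * inverse (real (Suc n)) \<le> s / 4 * 1"
      using s by (intro mult_left_mono) (auto simp: inverse_le_1_iff)
    then show "0 < \<epsilon> n" "\<epsilon> n \<le> s/4" using s by (auto simp: \<epsilon>_def)
  qed
  have liftQ: "w + of_real (\<epsilon> n) * \<i> \<in> Q"
    if "\<bar>Re w - x0\<bar> \<le> s" "0 \<le> Im w" "Im w \<le> s/4" for w n
    using that small [of n] by (simp add: Q_def)
  have clQ: "w \<in> closure Q" if "\<bar>Re w - x0\<bar> \<le> s" "0 \<le> Im w" "Im w \<le> s/4" for w
    unfolding closure_sequential
    by (rule exI [of _ "\<lambda>n. w + of_real (\<epsilon> n) * \<i>"]) (simp only: liftQ [OF that] lift simp_thms)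
  \<comment> \<open>The boundary values of Im g. The horizontal derivative of Im g is Im f, which
    tends to 0 at the axis except at \<open>x0\<close>; so q has derivative 0 away from
    \<open>x0\<close>, and its continuity at \<open>x0\<close> makes it constant across the
    exceptional point.\<close>
  define q where "q = (\<lambda>x. Im (G (of_real x)))"
  have qlim: "(\<lambda>n. Im (g (of_real x + of_real (\<epsilon> n) * \<i>))) \<longlonglongrightarrow> q x"
    if "\<bar>x - x0\<bar> \<le> s" for x
  proof -
    have "(\<lambda>n. G (of_real x + of_real (\<epsilon> n) * \<i>)) \<longlonglongrightarrow> G (of_real x)"
    proof (rule continuous_on_tendsto_compose [OF G(1) lift])
      show "complex_of_real x \<in> closure Q" using that s by (intro clQ) auto
      have "of_real x + of_real (\<epsilon> n) * \<i> \<in> Q" for n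
        using that s by (intro liftQ) auto
      then show "\<forall>\<^sub>F n in sequentially. of_real x + of_real (\<epsilon> n) * \<i> \<in> closure Q"
        using closure_subset by (intro always_eventually) blast
    qed
    then have "(\<lambda>n. Im (G (of_real x + of_real (\<epsilon> n) * \<i>))) \<longlonglongrightarrow> q x"
      unfolding q_def by (rule tendsto_Im)
    moreover have "G (of_real x + of_real (\<epsilon> n) * \<i>)
        = g (of_real x + of_real (\<epsilon> n) * \<i>)" for n
      using that s by (intro G(2) liftQ) auto
    ultimately show ?thesis by simp
  qed
  have qcont: "continuous_on {x0 - s..x0 + s} q"
  proof -
    have "complex_of_real ` {x0 - s..x0 + s} \<subseteq> closure Q"
      using s by (auto intro!: clQ)
    then have "continuous_on {x0 - s..x0 + s} (G \<circ> complex_of_real)"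
      by (intro continuous_on_compose continuous_intros continuous_on_subset [OF G(1)])
    then show ?thesis unfolding q_def by (auto intro!: continuous_intros simp: o_def)
  qed
  have qder: "(q has_derivative (\<lambda>h. 0)) (at x within {x0 - s..x0 + s})"
    if x: "x \<in> {x0 - s..x0 + s} - {x0}" for x
  proof -
    have "\<exists>d>0. \<forall>y\<in>{x0 - s..x0 + s}. norm (y - x) < d \<longrightarrow> norm (q y - q x - 0) \<le> e * norm (y - x)"
      if e: "0 < e" for e
    proof -
      have "\<bar>x - x0\<bar> < r" "x \<noteq> x0" using x s by auto
      from lim [OF this] e obtain d where d: "0 < d"
        "\<And>w. w \<in> half_ball x0 r \<Longrightarrow> w \<noteq> of_real x \<Longrightarrow> dist w (of_real x) < d \<Longrightarrow> \<bar>Im (f w)\<bar> < e"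
        by (auto simp: tendsto_iff eventually_at)
      have "\<bar>q y - q x\<bar> \<le> e * \<bar>y - x\<bar>" if y: "y \<in> {x0 - s..x0 + s}" "\<bar>y - x\<bar> < d / 2" for y
      proof -
        have ev: "\<forall>\<^sub>F n in sequentially. \<epsilon> n < d / 2"
          using order_tendstoD(2) [OF \<epsilon>0, of "d / 2"] d(1) by simp
        \<comment> \<open>On the horizontal line at height t, close to x, the derivative of Im g is
          below e in absolute value. The resulting mean value bound does not depend on t, hence
          survives the limit t = \<open>\<epsilon> n\<close>, n to infinity.\<close>
        have step: "\<bar>Im (g (of_real y + of_real t * \<i>)) - Im (g (of_real x + of_real t * \<i>))\<bar> \<le> e * \<bar>y - x\<bar>"
          if t: "0 < t" "t \<le> s/4" "t < d / 2" for t
        proof -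
          have "norm (Im (g (of_real y + of_real t * \<i>)) - Im (g (of_real x + of_real t * \<i>))) \<le> e * norm (y - x)"
          proof (rule field_differentiable_bound [of "{min x y..max x y}"
                "\<lambda>u. Im (g (of_real u + of_real t * \<i>))" "\<lambda>u. Im (f (of_real u + of_real t * \<i>))"])
            fix u assume u: "u \<in> {min x y..max x y}"
            then have "\<bar>u - x\<bar> \<le> \<bar>y - x\<bar>" by (auto simp: min_def max_def split: if_splits)
            moreover have "\<bar>u - x0\<bar> \<le> s" using u x y by (auto simp: min_def max_def split: if_splits)
            ultimately have u': "\<bar>u - x0\<bar> \<le> s" "\<bar>u - x\<bar> < d/2" using y by auto
            have inb: "of_real u + of_real t * \<i> \<in> half_ball x0 r"
              using u' t s by (intro sub) auto
            have "((\<lambda>u. of_real u + of_real t * \<i>) has_vector_derivative 1) (at u)"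
              by (auto intro!: derivative_eq_intros)
            from field_vector_diff_chain_at [OF this g [OF inb]]
            have "((\<lambda>u. g (of_real u + of_real t * \<i>)) has_vector_derivative f (of_real u + of_real t * \<i>)) (at u)"
              by (simp add: o_def)
            then have "((\<lambda>u. Im (g (of_real u + of_real t * \<i>))) has_vector_derivative Im (f (of_real u + of_real t * \<i>))) (at u)"
              by (rule bounded_linear.has_vector_derivative [OF bounded_linear_Im])
            then show "((\<lambda>u. Im (g (of_real u + of_real t * \<i>))) has_field_derivative
                Im (f (of_real u + of_real t * \<i>))) (at u within {min x y..max x y})"
              by (simp add: has_real_derivative_iff_has_vector_derivative has_vector_derivative_at_within)
            have "dist (of_real u + of_real t * \<i>) (of_real x) \<le> \<bar>u - x\<bar> + \<bar>t\<bar>"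
              using cmod_le [of "of_real u + of_real t * \<i> - of_real x"] by (simp add: dist_norm)
            then have "\<bar>Im (f (of_real u + of_real t * \<i>))\<bar> < e"
              using u' t inb by (intro d) (auto simp: complex_eq_iff)
            then show "norm (Im (f (of_real u + of_real t * \<i>))) \<le> e" by simp
          qed auto
          then show ?thesis by simp
        qed
        have "\<forall>\<^sub>F n in sequentially. \<bar>Im (g (of_real y + of_real (\<epsilon> n) * \<i>))
            - Im (g (of_real x + of_real (\<epsilon> n) * \<i>))\<bar> \<le> e * \<bar>y - x\<bar>"
          using ev by eventually_elim (use small in \<open>blast intro: step\<close>)
        moreover have "(\<lambda>n. \<bar>Im (g (of_real y + of_real (\<epsilon> n) * \<i>))
            - Im (g (of_real x + of_real (\<epsilon> n) * \<i>))\<bar>) \<longlonglongrightarrow> \<bar>q y - q x\<bar>"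
          using x y by (intro tendsto_intros qlim) auto
        ultimately show ?thesis by (intro tendsto_upperbound) auto
      qed
      then show ?thesis using d(1) by (intro exI [of _ "d/2"]) auto
    qed
    then show ?thesis by (simp add: has_derivative_within_alt bounded_linear_zero)
  qed
  have qconst: "q x = q (x0 - s)" if "x \<in> {x0 - s..x0 + s}" for x
    by (rule has_derivative_zero_unique_strong_interval [where k = "{x0}", OF _ qcont refl qder that]) auto
  define \<rho> where "\<rho> = s / 4"
  have \<rho>: "0 < \<rho>" "\<rho> \<le> r" using s by (auto simp: \<rho>_def)
  have ballQ: "w \<in> closure Q" "Im w > 0 \<Longrightarrow> w \<in> Q"
    if "w \<in> ball (of_real x0) \<rho>" "0 \<le> Im w" for w
  proof -
    have b: "\<bar>Re w - x0\<bar> \<le> s/4" "\<bar>Im w\<bar> \<le> s/4"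
      using that abs_Re_le_cmod [of "w - of_real x0"] abs_Im_le_cmod [of "w - of_real x0"]
      by (auto simp: \<rho>_def dist_norm norm_minus_commute)
    show "w \<in> closure Q" by (rule clQ) (use b that s in auto)
    show "w \<in> Q" if "0 < Im w" using b that s by (simp add: Q_def)
  qed
  \<comment> \<open>As q is constant, G - c is real on the axis and can be reflected. The derivative
    of the reflected function is the required extension; c drops out.\<close>
  define c where "c = \<i> * of_real (q (x0 - s))"
  have half: "w \<in> Q" if "w \<in> half_ball x0 \<rho>" for w
    using that ballQ [of w] by (auto simp: half_ball_def)
  obtain F1 where F1: "F1 holomorphic_on ball (of_real x0) \<rho>"
    "\<And>w. w \<in> ball (of_real x0) \<rho> \<Longrightarrow> F1 (cnj w) = cnj (F1 w)"
    "\<And>w. w \<in> half_ball x0 \<rho> \<Longrightarrow> F1 w = G w - c"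
  proof (rule Schwarz_reflection_ball)
    have "g holomorphic_on half_ball x0 \<rho>"
      using g half_ball_mono [OF \<rho>(2), of x0] by (auto simp: holomorphic_on_open)
    then show "(\<lambda>w. G w - c) holomorphic_on half_ball x0 \<rho>"
      by (intro holomorphic_intros) (auto simp: G(2) half intro: holomorphic_transform [of g])
    show "continuous_on (ball (complex_of_real x0) \<rho> \<inter> {w. 0 \<le> Im w}) (\<lambda>w. G w - c)"
      by (intro continuous_intros continuous_on_subset [OF G(1)]) (use ballQ in auto)
    show "Im (G (of_real x) - c) = 0" if "\<bar>x - x0\<bar> < \<rho>" for x
    proof -
      have "x \<in> {x0 - s..x0 + s}" using that s unfolding \<rho>_def atLeastAtMost_iff by arith
      from qconst [OF this] show ?thesis by (simp add: c_def q_def)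
    qed
  qed blast
  have cb: "cnj w \<in> ball (of_real x0) \<rho>" if "w \<in> ball (of_real x0) \<rho>" for w
    using that by (metis complex_cnj_complex_of_real complex_cnj_diff complex_mod_cnj dist_norm mem_ball)
  show thesis
  proof
    show "deriv F1 holomorphic_on ball (of_real x0) \<rho>"
      by (intro holomorphic_deriv F1) auto
    show "deriv F1 (cnj w) = cnj (deriv F1 w)" if "w \<in> ball (of_real x0) \<rho>" for w
      by (rule deriv_cnj_symmetric [OF _ F1(1) cb F1(2) that]) auto
    show "deriv F1 w = f w" if w: "w \<in> half_ball x0 \<rho>" for w
    proof -
      have "((\<lambda>w. g w - c) has_field_derivative f w) (at w)"
        using g [of w] w half_ball_mono [OF \<rho>(2), of x0] by (auto intro!: derivative_eq_intros)
      then have "(F1 has_field_derivative f w) (at w)"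
        by (rule has_field_derivative_transform_within_open [of _ _ _ "half_ball x0 \<rho>"])
          (use w F1(3) G(2) half in auto)
      then show ?thesis by (rule DERIV_imp_deriv)
    qed
  qed (use \<rho> in auto)
qed

section \<open>Boundary derivatives and harmonic functions\<close>

text \<open>Near the boundary point x, F - F x behaves like q(x) (w - x)^n, so Im (q(x) u^n) \<ge> 0
  for every u in the upper half-plane. For n \<ge> 2 the powers u^n point in too many directions for
  that; for n = 1 it forces q(x) to be real and positive.\<close>

lemma deriv_pos_of_upper_half:
  assumes hol: "F holomorphic_on ball (of_real x0) r" and r: "0 < r"
    and re: "Im (F (of_real x0)) = 0"
    and pos: "\<And>w. w \<in> half_ball x0 r \<Longrightarrow> 0 < Im (F w)"
  obtains d where "0 < d" "deriv F (of_real x0) = complex_of_real d"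
proof -
  define x where "x = complex_of_real x0"
  have imr: "Im (of_real c * w) = c * Im w" for c w by simp
  have xr: "x \<in> ball x r" using r by simp
  have up: "x + of_real t * u \<in> half_ball x0 r" if "0 < t" "t * cmod u < r" "0 < Im u" for t u
    using that by (simp add: half_ball_iff x_def norm_mult)
  have nc: "\<not> (\<lambda>w. F w - F x) constant_on ball x r"
  proof
    assume "(\<lambda>w. F w - F x) constant_on ball x r"
    then obtain c where c: "\<And>w. w \<in> ball x r \<Longrightarrow> F w - F x = c" unfolding constant_on_def by blast
    have "x + of_real (r/2) * \<i> \<in> half_ball x0 r" using r by (intro up) auto
    moreover from this have "F (x + of_real (r/2) * \<i>) - F x = F x - F x"
      using c [OF xr] c [of "x + of_real (r/2) * \<i>"] by (simp add: half_ball_def x_def)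
    ultimately show False using pos [of "x + of_real (r/2) * \<i>"] re by (simp add: x_def)
  qed
  have hd: "(\<lambda>w. F w - F x) holomorphic_on ball x r"
    using hol by (auto intro!: holomorphic_intros simp: x_def)
  obtain q \<rho> n where n: "0 < n" and \<rho>: "0 < \<rho>" "ball x \<rho> \<subseteq> ball x r"
    and q: "q holomorphic_on ball x \<rho>"
    and Fq: "\<And>w. w \<in> ball x \<rho> \<Longrightarrow> F w - F x = (w - x) ^ n * q w"
    and q0: "\<And>w. w \<in> ball x \<rho> \<Longrightarrow> q w \<noteq> 0"
    by (rule holomorphic_factor_zero_nonconstant [OF hd open_ball connected_ball xr _ nc]) (simp, rule that)
  have ge: "0 \<le> Im (q x * u ^ n)" if u: "0 < Im u" for u
  proof -
    have "isCont q x"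
      using holomorphic_on_imp_continuous_on [OF q] \<rho>(1) by (simp add: continuous_on_eq_continuous_at)
    then have "isCont q (x + of_real 0 * u)" by simp
    then have "((\<lambda>t. q (x + of_real t * u)) \<longlongrightarrow> q (x + of_real 0 * u)) (at_right 0)"
      by (rule isCont_tendsto_compose) (intro tendsto_intros)
    then have "((\<lambda>t. Im (q (x + of_real t * u) * u ^ n)) \<longlongrightarrow> Im (q x * u ^ n)) (at_right 0)"
      by (intro tendsto_intros) simp
    moreover have "\<forall>\<^sub>F t in at_right 0. 0 \<le> Im (q (x + of_real t * u) * u ^ n)"
    proof -
      have cu: "0 < cmod u" using u by auto
      have "\<forall>\<^sub>F t in at_right 0. t \<in> {0<..<min r \<rho> / cmod u}"
        using r \<rho> cu by (intro eventually_at_right_real) auto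
      then show ?thesis
      proof eventually_elim
        case (elim t)
        then have t: "0 < t" "t * cmod u < r" "t * cmod u < \<rho>" using cu by (auto simp: pos_less_divide_eq)
        have "x + of_real t * u \<in> ball x \<rho>" using t by (simp add: dist_norm norm_mult)
        from Fq [OF this] have "Im (F (x + of_real t * u)) - Im (F x) = Im (of_real (t ^ n) * (q (x + of_real t * u) * u ^ n))"
          by (simp add: power_mult_distrib mult_ac flip: minus_complex.simps)
        also have "\<dots> = t ^ n * Im (q (x + of_real t * u) * u ^ n)" using imr by blast
        finally have "0 < t ^ n * Im (q (x + of_real t * u) * u ^ n)"
          using pos [OF up [OF t(1,2) u]] re by (simp add: x_def)
        then show ?case using t by (simp add: zero_less_mult_iff)
      qed
    qed
    ultimately show ?thesis by (intro tendsto_lowerbound) auto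
  qed
  have qx: "q x \<noteq> 0" using q0 \<rho> by simp
  have "n = 1"
  proof (rule ccontr)
    assume "n \<noteq> 1"
    then have n2: "2 \<le> n" using n by simp
    \<comment> \<open>The four angles pi/4 + j pi/2 are below 2 pi \<le> n pi, so each is n times an
      angle in (0, pi). The resulting numbers z, i z, -z, -i z all have nonnegative imaginary part,
      which forces z = 0 although q(x) is nonzero.\<close>
    have J: "0 \<le> Im (q x * (cis (pi/4) * \<i> ^ j))" if "j \<le> 3" for j :: nat
    proof -
      define \<theta> where "\<theta> = (pi/4 + j * (pi/2)) / n"
      have "pi/4 + j * (pi/2) \<le> 7 * pi / 4" using that by (simp add: field_simps)
      also have "\<dots> < 2 * pi" by simp
      also have "\<dots> \<le> real n * pi" using n2 by simp
      finally have "\<theta> < pi" using n by (simp add: \<theta>_def divide_less_eq mult.commute)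
      moreover have "0 < \<theta>" using n by (auto simp: \<theta>_def intro!: divide_pos_pos add_pos_nonneg)
      ultimately have "0 \<le> Im (q x * cis \<theta> ^ n)" by (intro ge) (simp add: sin_gt_zero)
      moreover have "cis \<theta> ^ n = cis (pi/4 + j * (pi/2))"
        using n by (simp add: Complex.DeMoivre \<theta>_def)
      moreover have "\<dots> = cis (pi/4) * \<i> ^ j"
        using Complex.DeMoivre [of "pi/2" j] by (simp add: cis_mult [symmetric])
      ultimately show ?thesis by (simp only:)
    qed
    define a b where "a = Re (q x * cis (pi/4))" and "b = Im (q x * cis (pi/4))"
    have z: "q x * cis (pi/4) = Complex a b" unfolding a_def b_def by (rule complex.collapse [symmetric])
    have "0 \<le> Im (Complex a b * \<i> ^ j)" if "j \<le> 3" for j :: nat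
      using J [OF that] by (simp add: z [symmetric] mult.assoc del: times_complex.simps)
    from this [of 0] this [of 1] this [of 2] this [of 3] have "a = 0" "b = 0"
      by (auto simp: power3_eq_cube power2_eq_square)
    then have "q x * cis (pi/4) = 0" by (simp only: z Complex_eq_0 simp_thms)
    then show False using qx by (simp only: mult_eq_0_iff cis_neq_zero simp_thms)
  qed
  then have "F w - F x = (w - x) * q w" if "w \<in> ball x \<rho>" for w using Fq [OF that] by simp
  then have Fw: "F x + (w - x) * q w = F w" if "w \<in> ball x \<rho>" for w
    using that by (metis add.commute diff_add_cancel)
  have "((\<lambda>w. F x + (w - x) * q w) has_field_derivative q x) (at x)"
    using holomorphic_derivI [OF q, of x] \<rho> by (auto intro!: derivative_eq_intros)
  then have "(F has_field_derivative q x) (at x)"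
    by (rule has_field_derivative_transform_within_open [of _ _ _ "ball x \<rho>"]) (use \<rho> Fw in auto)
  then have d: "deriv F x = q x" by (rule DERIV_imp_deriv)
  \<comment> \<open>The direction u = c + i with c real: an affine function of c that is nonnegative
    on the whole line has slope 0.\<close>
  have lin: "0 \<le> Re (q x) + Im (q x) * c" for c
    using ge [of "Complex c 1"] \<open>n = 1\<close> by (simp add: add.commute)
  have "Im (q x) = 0"
  proof (rule ccontr)
    assume "Im (q x) \<noteq> 0"
    then show False using lin [of "(- 1 - Re (q x)) / Im (q x)"] by simp
  qed
  moreover from this have "0 < Re (q x)"
    using lin [of 0] qx by (auto simp: complex_eq_iff less_le)
  ultimately show thesis using that [of "Re (q x)"] d by (simp add: x_def complex_eq_iff)
qed

section \<open>Harmonic functions as real parts of holomorphic functions\<close>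

lemma mixed_partials_meet:
  fixes \<phi> \<phi>x \<phi>xy :: "real \<Rightarrow> real \<Rightarrow> real"
  assumes h: "0 < h"
    and x: "\<And>s t. 0 \<le> s \<Longrightarrow> s \<le> h \<Longrightarrow> 0 \<le> t \<Longrightarrow> t \<le> h \<Longrightarrow> ((\<lambda>s. \<phi> s t) has_real_derivative \<phi>x s t) (at s)"
    and xy: "\<And>s t. 0 \<le> s \<Longrightarrow> s \<le> h \<Longrightarrow> 0 \<le> t \<Longrightarrow> t \<le> h \<Longrightarrow> ((\<lambda>t. \<phi>x s t) has_real_derivative \<phi>xy s t) (at t)"
  obtains s t where "0 < s" "s < h" "0 < t" "t < h"
    "\<phi> h h - \<phi> h 0 - \<phi> 0 h + \<phi> 0 0 = h * h * \<phi>xy s t"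
proof -
  have "((\<lambda>s. \<phi> s h - \<phi> s 0) has_real_derivative \<phi>x s h - \<phi>x s 0) (at s)" if "0 \<le> s" "s \<le> h" for s
    using x h that by (auto intro!: DERIV_diff)
  then obtain s where s: "0 < s" "s < h" "(\<phi> h h - \<phi> h 0) - (\<phi> 0 h - \<phi> 0 0) = (h - 0) * (\<phi>x s h - \<phi>x s 0)"
    using MVT2 [OF h, of "\<lambda>s. \<phi> s h - \<phi> s 0" "\<lambda>s. \<phi>x s h - \<phi>x s 0"] by blast
  moreover obtain t where "0 < t" "t < h" "\<phi>x s h - \<phi>x s 0 = (h - 0) * \<phi>xy s t"
    using MVT2 [OF h, of "\<phi>x s" "\<phi>xy s"] xy s by auto
  ultimately show thesis using that by simp
qed

lemma partial_derivatives_along_axes: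
  assumes "(f has_derivative (\<lambda>v. p * Re v + q * Im v)) (at (z + Complex s t))"
  shows "((\<lambda>s. f (z + Complex s t)) has_real_derivative p) (at s)"
    and "((\<lambda>t. f (z + Complex s t)) has_real_derivative q) (at t)"
proof -
  have "((\<lambda>s. z + Complex s t) has_derivative (\<lambda>h. of_real h)) (at s)"
    unfolding Complex_eq by (auto intro!: derivative_eq_intros)
  from has_derivative_compose [OF this assms]
  show "((\<lambda>s. f (z + Complex s t)) has_real_derivative p) (at s)"
    by (simp add: has_field_derivative_def o_def)
  have "((\<lambda>t. z + Complex s t) has_derivative (\<lambda>h. \<i> * of_real h)) (at t)"
    unfolding Complex_eq by (auto intro!: derivative_eq_intros)
  from has_derivative_compose [OF this assms]
  show "((\<lambda>t. f (z + Complex s t)) has_real_derivative q) (at t)"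
    by (simp add: has_field_derivative_def o_def)
qed

text \<open>\<open>harmonic_on\<close> introduces the two mixed derivatives separately; their
  equality is one of the Cauchy-Riemann equations needed below. The second difference of \<phi> over
  a small square is symmetric in the two variables. Expanding it in either order by two applications
  of the mean value theorem makes values of \<open>\<phi>xy\<close> and \<open>\<phi>yx\<close> at
  nearby points equal, and continuity excludes a gap at z.\<close>

lemma mixed_partials_eq:
  fixes \<phi> \<phi>x \<phi>y \<phi>xx \<phi>xy \<phi>yx \<phi>yy :: "complex \<Rightarrow> real"
  assumes "open \<Omega>"
    and d: "\<And>z. z \<in> \<Omega> \<Longrightarrow> (\<phi> has_derivative (\<lambda>v. \<phi>x z * Re v + \<phi>y z * Im v)) (at z)"
    and dx: "\<And>z. z \<in> \<Omega> \<Longrightarrow> (\<phi>x has_derivative (\<lambda>v. \<phi>xx z * Re v + \<phi>xy z * Im v)) (at z)"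
    and dy: "\<And>z. z \<in> \<Omega> \<Longrightarrow> (\<phi>y has_derivative (\<lambda>v. \<phi>yx z * Re v + \<phi>yy z * Im v)) (at z)"
    and cxy: "continuous_on \<Omega> \<phi>xy" and cyx: "continuous_on \<Omega> \<phi>yx"
    and z: "z \<in> \<Omega>"
  shows "\<phi>xy z = \<phi>yx z"
proof (rule ccontr)
  assume ne: "\<phi>xy z \<noteq> \<phi>yx z"
  define e where "e = \<bar>\<phi>xy z - \<phi>yx z\<bar> / 2"
  have e: "0 < e" using ne by (simp add: e_def)
  obtain d0 where d0: "0 < d0" "ball z d0 \<subseteq> \<Omega>" using \<open>open \<Omega>\<close> z openE by blast
  obtain d1 where d1: "0 < d1" "\<And>w. w \<in> \<Omega> \<Longrightarrow> dist w z < d1 \<Longrightarrow> dist (\<phi>xy w) (\<phi>xy z) < e"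
    using cxy z e unfolding continuous_on_iff by blast
  obtain d2 where d2: "0 < d2" "\<And>w. w \<in> \<Omega> \<Longrightarrow> dist w z < d2 \<Longrightarrow> dist (\<phi>yx w) (\<phi>yx z) < e"
    using cyx z e unfolding continuous_on_iff by blast
  define h where "h = min d0 (min d1 d2) / 3"
  have "0 < min d0 (min d1 d2)" using d0 d1 d2 by simp
  then have h: "0 < h" and m: "2 * h < min d0 (min d1 d2)" unfolding h_def by linarith+
  have near: "dist (z + Complex s t) z < min d0 (min d1 d2)" "z + Complex s t \<in> \<Omega>"
    if "0 \<le> s" "s \<le> h" "0 \<le> t" "t \<le> h" for s t
  proof -
    have "cmod (Complex s t) \<le> 2 * h" using cmod_le [of "Complex s t"] that by simp
    then show "dist (z + Complex s t) z < min d0 (min d1 d2)"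
      using m by (simp add: dist_norm)
    then show "z + Complex s t \<in> \<Omega>" using d0 by (auto simp: dist_commute)
  qed
  obtain s t where st: "0 < s" "s < h" "0 < t" "t < h"
    "\<phi> (z + Complex h h) - \<phi> (z + Complex h 0) - \<phi> (z + Complex 0 h) + \<phi> (z + Complex 0 0)
      = h * h * \<phi>xy (z + Complex s t)"
    by (rule mixed_partials_meet [OF h, of "\<lambda>s t. \<phi> (z + Complex s t)" "\<lambda>s t. \<phi>x (z + Complex s t)"
        "\<lambda>s t. \<phi>xy (z + Complex s t)"])
      (use near(2) in \<open>blast intro: partial_derivatives_along_axes d dx\<close>)+
  obtain s' t' where st': "0 < s'" "s' < h" "0 < t'" "t' < h"
    "\<phi> (z + Complex h h) - \<phi> (z + Complex 0 h) - \<phi> (z + Complex h 0) + \<phi> (z + Complex 0 0)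
      = h * h * \<phi>yx (z + Complex t' s')"
    by (rule mixed_partials_meet [OF h, of "\<lambda>s t. \<phi> (z + Complex t s)" "\<lambda>s t. \<phi>y (z + Complex t s)"
        "\<lambda>s t. \<phi>yx (z + Complex t s)"])
      (use near(2) in \<open>blast intro: partial_derivatives_along_axes d dy\<close>)+
  have "h * h * \<phi>xy (z + Complex s t) = h * h * \<phi>yx (z + Complex t' s')"
    using st(5) st'(5) by linarith
  then have "\<phi>xy (z + Complex s t) = \<phi>yx (z + Complex t' s')" using h by simp
  moreover have "dist (\<phi>xy (z + Complex s t)) (\<phi>xy z) < e"
    using st near [of s t] by (intro d1) auto
  moreover have "dist (\<phi>yx (z + Complex t' s')) (\<phi>yx z) < e"
    using st' near [of t' s'] by (intro d2) auto
  ultimately show False unfolding e_def dist_real_def by (smt (verit) field_sum_of_halves)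
qed

text \<open>The function \<open>\<phi>x\<close> - i \<open>\<phi>y\<close> satisfies the
  Cauchy-Riemann equations, one by Laplace's equation and one by symmetry of the mixed derivatives.
  Simple connectedness gives it a primitive, whose real part has the same gradient as
  \<phi>.\<close>

lemma harmonic_on_eq_Re_holomorphic:
  assumes harm: "harmonic_on \<phi> \<Omega>" and sc: "simply_connected \<Omega>"
  obtains P where "P holomorphic_on \<Omega>" "\<And>z. z \<in> \<Omega> \<Longrightarrow> \<phi> z = Re (P z)"
proof -
  from harm obtain \<phi>x \<phi>y \<phi>xx \<phi>xy \<phi>yx \<phi>yy where op: "open \<Omega>"
    and d: "\<And>z. z \<in> \<Omega> \<Longrightarrow> (\<phi> has_derivative (\<lambda>v. \<phi>x z * Re v + \<phi>y z * Im v)) (at z)"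
    and dx: "\<And>z. z \<in> \<Omega> \<Longrightarrow> (\<phi>x has_derivative (\<lambda>v. \<phi>xx z * Re v + \<phi>xy z * Im v)) (at z)"
    and dy: "\<And>z. z \<in> \<Omega> \<Longrightarrow> (\<phi>y has_derivative (\<lambda>v. \<phi>yx z * Re v + \<phi>yy z * Im v)) (at z)"
    and lap: "\<And>z. z \<in> \<Omega> \<Longrightarrow> \<phi>xx z + \<phi>yy z = 0"
    and c: "continuous_on \<Omega> \<phi>xy" "continuous_on \<Omega> \<phi>yx"
    unfolding harmonic_on_def by blast
  define G where "G = (\<lambda>z. complex_of_real (\<phi>x z) - \<i> * complex_of_real (\<phi>y z))"
  have "(G has_field_derivative (of_real (\<phi>xx z) - \<i> * of_real (\<phi>yx z))) (at z)" if z: "z \<in> \<Omega>" for z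
  proof -
    have sym: "\<phi>xy z = \<phi>yx z" by (rule mixed_partials_eq [OF op d dx dy c z])
    have yy: "\<phi>yy z = - \<phi>xx z" using lap [OF z] by simp
    have "(G has_derivative (\<lambda>v. of_real (\<phi>xx z * Re v + \<phi>xy z * Im v) - \<i> * of_real (\<phi>yx z * Re v + \<phi>yy z * Im v))) (at z)"
      unfolding G_def by (intro derivative_intros has_derivative_of_real dx dy z)
    also have "(\<lambda>v. complex_of_real (\<phi>xx z * Re v + \<phi>xy z * Im v) - \<i> * of_real (\<phi>yx z * Re v + \<phi>yy z * Im v))
        = (*) (of_real (\<phi>xx z) - \<i> * of_real (\<phi>yx z))"
      by (rule ext) (simp add: complex_eq_iff sym yy algebra_simps)
    finally show ?thesis by (simp add: has_field_derivative_def)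
  qed
  then have "G holomorphic_on \<Omega>" using op by (auto simp: holomorphic_on_open)
  then obtain P where P: "\<And>z. z \<in> \<Omega> \<Longrightarrow> (P has_field_derivative G z) (at z)"
    using sc simply_connected_eq_global_primitive [OF op] by blast
  have con: "connected \<Omega>" using sc simply_connected_imp_connected by blast
  have "((\<lambda>z. \<phi> z - Re (P z)) has_derivative (\<lambda>h. 0)) (at z)" if z: "z \<in> \<Omega>" for z
  proof -
    have "((\<lambda>z. Re (P z)) has_derivative (\<lambda>h. Re (G z * h))) (at z)"
      using P [OF z] unfolding has_field_derivative_def by (rule has_derivative_Re)
    from has_derivative_diff [OF d [OF z] this] show ?thesis by (simp add: G_def)
  qed
  then have "\<exists>k. \<forall>z\<in>\<Omega>. \<phi> z - Re (P z) = k"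
    using has_derivative_zero_unique_connected [OF op con, of "\<lambda>z. \<phi> z - Re (P z)"] by blast
  then obtain k where k: "\<And>z. z \<in> \<Omega> \<Longrightarrow> \<phi> z - Re (P z) = k" by blast
  show thesis
  proof (rule that)
    show "(\<lambda>z. P z + of_real k) holomorphic_on \<Omega>"
      using P op by (intro holomorphic_intros) (auto simp: holomorphic_on_open)
    show "\<phi> z = Re (P z + of_real k)" if "z \<in> \<Omega>" for z using k [OF that] by simp
  qed
qed

section \<open>Real analyticity in polar coordinates\<close>

text \<open>Fubini for unconditional sums. The sum of norms is carried along because it provides the
  summability over pairs, and later over triples, that is needed to sum iteratively.\<close>

lemma has_sum_product_complex:
  fixes p q :: "nat \<Rightarrow> complex"
  assumes p: "(p has_sum P) UNIV" "((\<lambda>i. norm (p i)) has_sum P') UNIV"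
    and q: "(q has_sum Q) UNIV" "((\<lambda>j. norm (q j)) has_sum Q') UNIV"
  shows "((\<lambda>(i, j). p i * q j) has_sum P * Q) UNIV"
    and "((\<lambda>(i, j). norm (p i * q j)) has_sum P' * Q') UNIV"
proof -
  have n: "((\<lambda>(i, j). norm (p i * q j)) has_sum P' * Q') (UNIV \<times> UNIV)"
  proof (rule has_sum_SigmaI)
    show "((\<lambda>j. case (i, j) of (i, j) \<Rightarrow> norm (p i * q j)) has_sum norm (p i) * Q') UNIV" for i
      using has_sum_cmult_right [OF q(2)] by (simp add: norm_mult)
    show "((\<lambda>i. norm (p i) * Q') has_sum P' * Q') UNIV"
      by (rule has_sum_cmult_left [OF p(2)])
    have "(\<lambda>i. norm (p i) * Q') summable_on UNIV"
      using has_sum_cmult_left [OF p(2)] by (auto simp: summable_on_def)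
    then show "(\<lambda>(i, j). norm (p i * q j)) summable_on UNIV \<times> UNIV"
      by (rule summable_on_SigmaI [rotated])
        (use has_sum_cmult_right [OF q(2)] in \<open>auto simp: norm_mult\<close>)
  qed
  then show "((\<lambda>(i, j). norm (p i * q j)) has_sum P' * Q') UNIV" by simp
  have "((\<lambda>(i, j). p i * q j) has_sum P * Q) (UNIV \<times> UNIV)"
  proof (rule has_sum_SigmaI)
    show "((\<lambda>j. case (i, j) of (i, j) \<Rightarrow> p i * q j) has_sum p i * Q) UNIV" for i
      using has_sum_cmult_right [OF q(1)] by simp
    show "((\<lambda>i. p i * Q) has_sum P * Q) UNIV"
      by (rule has_sum_cmult_left [OF p(1)])
    have "(\<lambda>ij. norm (case ij of (i, j) \<Rightarrow> p i * q j)) summable_on UNIV \<times> UNIV"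
      using n by (auto simp: summable_on_def case_prod_unfold)
    then show "(\<lambda>(i, j). p i * q j) summable_on UNIV \<times> UNIV"
      by (rule abs_summable_summable)
  qed
  then show "((\<lambda>(i, j). p i * q j) has_sum P * Q) UNIV" by simp
qed

text \<open>Expanding each term of the Taylor series at the origin in powers of \<open>x - x0\<close> and \<open>y - y0\<close>
  gives an absolutely convergent triple series.\<close>

lemma real_analytic_polar:
  assumes hol: "f holomorphic_on ball 0 \<delta>"
  shows "real_analytic_map_on (\<lambda>(r, \<theta>). f (rcis r \<theta>)) ({- \<delta><..<\<delta>} \<times> UNIV)"
  unfolding real_analytic_map_on_def
proof clarify
  fix x0 y0 :: real assume x0: "x0 \<in> {- \<delta><..<\<delta>}"
  define a where "a = (\<lambda>n. (deriv ^^ n) f 0 / fact n)"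
  have ser: "(\<lambda>n. a n * w ^ n) sums f w" if "w \<in> ball 0 \<delta>" for w
    using holomorphic_power_series [OF hol that] by (simp add: a_def)
  have abs: "summable (\<lambda>n. norm (a n) * t ^ n)" if t: "0 \<le> t" "t < \<delta>" for t
  proof -
    define u where "u = (t + \<delta>) / 2"
    have u: "t < u" "u < \<delta>" using t by (auto simp: u_def)
    have "summable (\<lambda>n. a n * of_real u ^ n)"
      using ser [of "of_real u"] u t by (auto simp: summable_def)
    then have "summable (\<lambda>n. norm (a n * of_real t ^ n))"
      by (rule powser_insidea) (use u t in auto)
    then show ?thesis using t by (simp add: norm_mult norm_power)
  qed
  \<comment> \<open>The norms of the triple series add up to the sum over n of |a n| times the n-th
    power of (|x0| + |X|) exp |Y|. This base must stay below \<delta> for all increments X, Y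
    smaller than \<epsilon>.\<close>
  have "((\<lambda>\<epsilon>. (\<bar>x0\<bar> + \<epsilon>) * exp \<epsilon>) \<longlongrightarrow> (\<bar>x0\<bar> + 0) * exp 0) (at_right 0)"
    by (intro tendsto_intros)
  moreover have "(\<bar>x0\<bar> + 0) * exp 0 < \<delta>" using x0 by auto
  ultimately have "\<forall>\<^sub>F \<epsilon> in at_right 0. (\<bar>x0\<bar> + \<epsilon>) * exp \<epsilon> < \<delta>"
    by (rule order_tendstoD(2))
  moreover have "\<forall>\<^sub>F \<epsilon> in at_right 0. (0::real) < \<epsilon>"
    by (simp add: eventually_at_right_less)
  ultimately obtain \<epsilon> where \<epsilon>: "0 < \<epsilon>" "(\<bar>x0\<bar> + \<epsilon>) * exp \<epsilon> < \<delta>"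
    by (metis (mono_tags, lifting) eventually_conj_iff eventually_happens' trivial_limit_at_right_real)
  \<comment> \<open>From (x0 + X)^n cis(n y0) exp(i n Y): the binomial series in X and the
    exponential series in Y. For i > n the binomial coefficient is 0, so the truncated exponent n -
    i does no harm.\<close>
  define c where "c = (\<lambda>i j. \<Sum>\<^sub>\<infinity>n. a n * (of_nat (n choose i) * of_real x0 ^ (n - i)) *
      (cis (real n * y0) * (\<i> * of_nat n) ^ j / fact j))"
  show "\<exists>c. \<exists>\<epsilon>>0. \<forall>x y. \<bar>x - x0\<bar> < \<epsilon> \<and> \<bar>y - y0\<bar> < \<epsilon> \<longrightarrow>
      ((\<lambda>(i, j). ((x - x0) ^ i * (y - y0) ^ j) *\<^sub>R c i j) has_sum
        f (rcis x y)) UNIV"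
  proof (intro exI [of _ c] exI [of _ \<epsilon>] conjI allI impI \<epsilon>(1))
    fix x y assume xy: "\<bar>x - x0\<bar> < \<epsilon> \<and> \<bar>y - y0\<bar> < \<epsilon>"
    define X Y where "X = x - x0" and "Y = y - y0"
    define p where "p = (\<lambda>n i. a n * (of_nat (n choose i) * of_real x0 ^ (n - i)) * of_real X ^ i)"
    define q where "q = (\<lambda>n j. cis (real n * y0) * (\<i> * of_nat n) ^ j / fact j * of_real Y ^ j)"
    have p: "(p n has_sum a n * of_real x ^ n) UNIV"
      and pn: "((\<lambda>i. norm (p n i)) has_sum norm (a n) * (\<bar>x0\<bar> + \<bar>X\<bar>) ^ n) UNIV" for n
    proof -
      have fin: "p n i = 0" if "i \<in> UNIV - {..n}" for i
        using that by (simp add: p_def)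
      have "a n * of_real x ^ n = a n * (of_real X + of_real x0) ^ n" by (simp add: X_def)
      also have "\<dots> = (\<Sum>i\<le>n. p n i)"
        unfolding binomial_ring by (simp add: p_def sum_distrib_left mult_ac)
      finally show "(p n has_sum a n * of_real x ^ n) UNIV"
        by (intro has_sum_finite_neutralI [of "{..n}"] fin) auto
      have "norm (a n) * (\<bar>x0\<bar> + \<bar>X\<bar>) ^ n = norm (a n) * (\<bar>X\<bar> + \<bar>x0\<bar>) ^ n" by (simp add: add.commute)
      also have "\<dots> = (\<Sum>i\<le>n. norm (p n i))"
        unfolding binomial_ring by (simp add: p_def sum_distrib_left norm_mult norm_power mult_ac)
      finally show "((\<lambda>i. norm (p n i)) has_sum norm (a n) * (\<bar>x0\<bar> + \<bar>X\<bar>) ^ n) UNIV"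
        by (intro has_sum_finite_neutralI [of "{..n}"]) (auto simp: fin)
    qed
    have q: "(q n has_sum cis (real n * y)) UNIV"
      and qn: "((\<lambda>j. norm (q n j)) has_sum exp (real n * \<bar>Y\<bar>)) UNIV" for n
    proof -
      have qnorm: "norm (q n j) = (real n * \<bar>Y\<bar>) ^ j /\<^sub>R fact j" for j
        by (simp add: q_def norm_mult norm_divide norm_power power_mult_distrib field_simps)
      show *: "((\<lambda>j. norm (q n j)) has_sum exp (real n * \<bar>Y\<bar>)) UNIV"
        unfolding qnorm by (intro sums_nonneg_imp_has_sum exp_converges) auto
      have "(\<lambda>j. cis (real n * y0) * ((\<i> * of_real (real n * Y)) ^ j /\<^sub>R fact j)) sums
          (cis (real n * y0) * exp (\<i> * of_real (real n * Y)))"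
        by (intro sums_mult exp_converges)
      also have "(\<lambda>j. cis (real n * y0) * ((\<i> * of_real (real n * Y)) ^ j /\<^sub>R fact j)) = q n"
        by (rule ext) (simp add: q_def power_mult_distrib scaleR_conv_of_real field_simps)
      also have "cis (real n * y0) * exp (\<i> * of_real (real n * Y)) = cis (real n * y)"
        unfolding cis_conv_exp [symmetric] cis_mult by (simp add: Y_def algebra_simps)
      finally show "(q n has_sum cis (real n * y)) UNIV"
        using * by (intro norm_summable_imp_has_sum) (auto dest: has_sum_imp_sums simp: summable_def)
    qed
    have x\<delta>: "\<bar>x\<bar> < \<delta>"
    proof -
      have "\<bar>x\<bar> \<le> (\<bar>x0\<bar> + \<epsilon>) * 1" using xy by auto
      also have "\<dots> \<le> (\<bar>x0\<bar> + \<epsilon>) * exp \<epsilon>" using \<epsilon> by (intro mult_left_mono) auto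
      finally show ?thesis using \<epsilon> by linarith
    qed
    have T: "((\<lambda>(n, i, j). p n i * q n j) has_sum f (rcis x y)) (UNIV \<times> UNIV)"
    proof (rule has_sum_SigmaI)
      show "((\<lambda>ij. case (n, ij) of (n, i, j) \<Rightarrow> p n i * q n j) has_sum a n * rcis x y ^ n) UNIV" for n
        using has_sum_product_complex(1) [OF p pn q qn, of n n]
        by (simp add: rcis_def power_mult_distrib Complex.DeMoivre mult_ac)
      have "rcis x y \<in> ball 0 \<delta>" using x\<delta> by simp
      from ser [OF this] show "((\<lambda>n. a n * rcis x y ^ n) has_sum f (rcis x y)) UNIV"
        using abs [of "\<bar>x\<bar>"] x\<delta> by (intro norm_summable_imp_has_sum) (auto simp: norm_mult norm_power)
      define t where "t = (\<bar>x0\<bar> + \<bar>X\<bar>) * exp \<bar>Y\<bar>"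
      have "t \<le> (\<bar>x0\<bar> + \<epsilon>) * exp \<epsilon>"
        using xy by (auto simp: t_def X_def Y_def intro!: mult_mono)
      then have "summable (\<lambda>n. norm (a n) * t ^ n)"
        using \<epsilon> by (intro abs) (auto simp: t_def)
      then have S: "(\<lambda>n. norm (a n) * t ^ n) summable_on UNIV"
        by (intro summable_nonneg_imp_summable_on) (auto simp: t_def)
      have N: "((\<lambda>ij. case (n, ij) of (n, i, j) \<Rightarrow> norm (p n i * q n j)) has_sum norm (a n) * t ^ n) UNIV" for n
        using has_sum_product_complex(2) [OF p pn q qn, of n n]
        by (simp add: t_def power_mult_distrib exp_of_nat_mult [symmetric] mult_ac)
      have "(\<lambda>(n, i, j). norm (p n i * q n j)) summable_on UNIV \<times> UNIV"
        by (rule summable_on_SigmaI [OF N S]) auto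
      then have "(\<lambda>nij. norm (case nij of (n, i, j) \<Rightarrow> p n i * q n j)) summable_on UNIV \<times> UNIV"
        by (simp add: case_prod_unfold)
      then show "(\<lambda>(n, i, j). p n i * q n j) summable_on UNIV \<times> UNIV"
        by (rule abs_summable_summable)
    qed
    \<comment> \<open>The order of summation is exchanged, so that the inner sum over n yields the
      coefficient of X^i Y^j.\<close>
    then have T': "((\<lambda>(ij, n). p n (fst ij) * q n (snd ij)) has_sum f (rcis x y)) (UNIV \<times> UNIV)"
      by (subst (asm) has_sum_swap) (simp add: case_prod_unfold)
    have "((\<lambda>ij. (X ^ fst ij * Y ^ snd ij) *\<^sub>R c (fst ij) (snd ij)) has_sum f (rcis x y)) UNIV"
    proof (rule has_sum_SigmaD [OF T'])
      fix ij :: "nat \<times> nat"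
      obtain i j where ij: "ij = (i, j)" by fastforce
      have "(\<lambda>(ij, n). p n (fst ij) * q n (snd ij)) summable_on UNIV \<times> UNIV"
        using T' by (auto simp: summable_on_def)
      then have "(\<lambda>n. p n (fst ij) * q n (snd ij)) summable_on UNIV"
        by (rule summable_on_SigmaD1) simp
      then have "(\<lambda>n. p n i * q n j) summable_on UNIV" by (simp add: ij)
      then have "((\<lambda>n. p n i * q n j) has_sum infsum (\<lambda>n. p n i * q n j) UNIV) UNIV"
        by (rule has_sum_infsum)
      also have "infsum (\<lambda>n. p n i * q n j) UNIV = infsum (\<lambda>n. of_real (X ^ i * Y ^ j) * (a n * (of_nat (n choose i) * of_real x0 ^ (n - i)) *
        (cis (real n * y0) * (\<i> * of_nat n) ^ j / fact j))) UNIV"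
        by (rule infsum_cong) (simp add: p_def q_def mult_ac)
      also have "\<dots> = (X ^ i * Y ^ j) *\<^sub>R c i j"
        unfolding infsum_cmult_right' c_def by (simp add: scaleR_conv_of_real)
      finally show "((\<lambda>n. case (ij, n) of (ij, n) \<Rightarrow> p n (fst ij) * q n (snd ij)) has_sum
          (X ^ fst ij * Y ^ snd ij) *\<^sub>R c (fst ij) (snd ij)) UNIV"
        by (simp add: ij)
    qed
    then show "((\<lambda>(i, j). ((x - x0) ^ i * (y - y0) ^ j) *\<^sub>R c i j) has_sum
        f (rcis x y)) UNIV"
      by (simp add: case_prod_unfold X_def Y_def)
  qed
qed

lemma real_analytic_map_on_subset:
  "real_analytic_map_on f V \<Longrightarrow> W \<subseteq> V \<Longrightarrow> real_analytic_map_on f W"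
  unfolding real_analytic_map_on_def by blast

lemma real_analytic_map_on_bounded_linear:
  assumes "bounded_linear T" "real_analytic_map_on f V"
  shows "real_analytic_map_on (\<lambda>p. T (f p)) V"
  unfolding real_analytic_map_on_def
proof clarify
  interpret T: bounded_linear T by fact
  fix x0 y0 assume "(x0, y0) \<in> V"
  then obtain c \<epsilon> where c: "0 < \<epsilon>" "\<And>x y. \<bar>x - x0\<bar> < \<epsilon> \<and> \<bar>y - y0\<bar> < \<epsilon> \<Longrightarrow>
      ((\<lambda>(i, j). ((x - x0) ^ i * (y - y0) ^ j) *\<^sub>R c i j) has_sum f (x, y)) UNIV"
    using assms(2) unfolding real_analytic_map_on_def by blast
  have "((\<lambda>(i, j). ((x - x0) ^ i * (y - y0) ^ j) *\<^sub>R T (c i j)) has_sum T (f (x, y))) UNIV"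
    if "\<bar>x - x0\<bar> < \<epsilon> \<and> \<bar>y - y0\<bar> < \<epsilon>" for x y
    using has_sum_bounded_linear [OF assms(1) c(2) [OF that]]
    by (simp add: case_prod_unfold T.scaleR)
  then show "\<exists>c. \<exists>\<epsilon>>0. \<forall>x y. \<bar>x - x0\<bar> < \<epsilon> \<and> \<bar>y - y0\<bar> < \<epsilon> \<longrightarrow>
      ((\<lambda>(i, j). ((x - x0) ^ i * (y - y0) ^ j) *\<^sub>R c i j) has_sum T (f (x, y))) UNIV"
    using c(1) by (intro exI [of _ "\<lambda>i j. T (c i j)"] exI [of _ \<epsilon>]) auto
qed

lemma real_analytic_map_on_add:
  assumes "real_analytic_map_on f V" "real_analytic_map_on g V"
  shows "real_analytic_map_on (\<lambda>p. f p + g p) V"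
  unfolding real_analytic_map_on_def
proof clarify
  fix x0 y0 assume V: "(x0, y0) \<in> V"
  obtain c \<epsilon> where c: "0 < \<epsilon>" "\<And>x y. \<bar>x - x0\<bar> < \<epsilon> \<and> \<bar>y - y0\<bar> < \<epsilon> \<Longrightarrow>
      ((\<lambda>(i, j). ((x - x0) ^ i * (y - y0) ^ j) *\<^sub>R c i j) has_sum f (x, y)) UNIV"
    using assms(1) V unfolding real_analytic_map_on_def by blast
  obtain d \<eta> where d: "0 < \<eta>" "\<And>x y. \<bar>x - x0\<bar> < \<eta> \<and> \<bar>y - y0\<bar> < \<eta> \<Longrightarrow>
      ((\<lambda>(i, j). ((x - x0) ^ i * (y - y0) ^ j) *\<^sub>R d i j) has_sum g (x, y)) UNIV"
    using assms(2) V unfolding real_analytic_map_on_def by blast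
  have "((\<lambda>(i, j). ((x - x0) ^ i * (y - y0) ^ j) *\<^sub>R (c i j + d i j)) has_sum f (x, y) + g (x, y)) UNIV"
    if "\<bar>x - x0\<bar> < min \<epsilon> \<eta> \<and> \<bar>y - y0\<bar> < min \<epsilon> \<eta>" for x y
    using has_sum_add [OF c(2) d(2), of x y x y] that
    by (simp add: case_prod_unfold scaleR_right_distrib)
  then show "\<exists>c. \<exists>\<epsilon>>0. \<forall>x y. \<bar>x - x0\<bar> < \<epsilon> \<and> \<bar>y - y0\<bar> < \<epsilon> \<longrightarrow>
      ((\<lambda>(i, j). ((x - x0) ^ i * (y - y0) ^ j) *\<^sub>R c i j) has_sum f (x, y) + g (x, y)) UNIV"
    using c(1) d(1) by (intro exI [of _ "\<lambda>i j. c i j + d i j"] exI [of _ "min \<epsilon> \<eta>"]) auto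
qed

lemma real_analytic_map_on_affine_snd:
  "real_analytic_map_on (\<lambda>(r, \<theta>). \<alpha> + \<beta> * \<theta> :: real) V"
  unfolding real_analytic_map_on_def
proof clarify
  fix x0 y0 :: real
  define c where "c = (\<lambda>(i::nat) (j::nat). if i = 0 \<and> j = 0 then \<alpha> + \<beta> * y0 else if i = 0 \<and> j = 1 then \<beta> else 0)"
  have "((\<lambda>(i, j). ((x - x0) ^ i * (y - y0) ^ j) *\<^sub>R c i j) has_sum \<alpha> + \<beta> * y) UNIV" for x y
    by (rule has_sum_finite_neutralI [of "{(0, 0), (0, 1)}"]) (auto simp: c_def algebra_simps split: if_splits)
  then show "\<exists>c. \<exists>\<epsilon>>0. \<forall>x y. \<bar>x - x0\<bar> < \<epsilon> \<and> \<bar>y - y0\<bar> < \<epsilon> \<longrightarrow>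
      ((\<lambda>(i, j). ((x - x0) ^ i * (y - y0) ^ j) *\<^sub>R c i j) has_sum
        \<alpha> + \<beta> * y) UNIV"
    by (intro exI [of _ c] exI [of _ 1]) auto
qed

lemma real_analytic_map_on_Pair:
  assumes "real_analytic_map_on f V" "real_analytic_map_on g V"
  shows "real_analytic_map_on (\<lambda>p. (f p, g p)) V"
proof -
  have "real_analytic_map_on (\<lambda>p. (f p, 0) + (0, g p)) V"
    by (intro real_analytic_map_on_add real_analytic_map_on_bounded_linear [where T = "\<lambda>x. (x, 0)"]
        real_analytic_map_on_bounded_linear [where T = "\<lambda>x. (0, x)"] assms
        bounded_linear_Pair bounded_linear_ident bounded_linear_zero)
  then show ?thesis by simp
qed

section \<open>Boundary behaviour of conformal parametrizations\<close>

text \<open>A conformal straightening of the boundary near G(s0). The equivalence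
  \<open>chart_mem\<close> fixes the orientation and also keeps the diameter and the lower half disc
  outside the domain.\<close>

locale boundary_chart =
  fixes \<Omega> :: "complex set" and G :: "complex \<Rightarrow> complex" and s0 \<rho> :: real
  assumes open_domain: "open \<Omega>"
    and radius: "0 < \<rho>"
    and chart_hol: "G holomorphic_on ball (of_real s0) \<rho>"
    and chart_inj: "inj_on G (ball (of_real s0) \<rho>)"
    and chart_mem: "w \<in> ball (of_real s0) \<rho> \<Longrightarrow> G w \<in> \<Omega> \<longleftrightarrow> 0 < Im w"

lemma half_ball_subset_upper: "half_ball x r \<subseteq> upper_half_plane"
  by (auto simp: half_ball_iff upper_half_plane_def)

lemma vertical_approach:
  "((\<lambda>t. of_real x + of_real t * \<i>) \<longlongrightarrow> complex_of_real x) (at_right 0)"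
  by (rule tendsto_eq_intros refl | simp)+

lemma vertical_approach_half_ball:
  assumes "0 < r" shows "\<forall>\<^sub>F t in at_right 0. of_real x + of_real t * \<i> \<in> half_ball x r"
  using eventually_at_right_real [OF assms]
  by eventually_elim (auto simp: half_ball_iff norm_mult)

lemma (in boundary_chart) parametrization_extends:
  assumes h: "biholomorphic_between h upper_half_plane \<Omega>"
    and bv: "(h \<longlongrightarrow> G (of_real s0)) (at (of_real w0) within upper_half_plane)"
  obtains \<kappa> \<delta> where "0 < \<delta>" "\<kappa> holomorphic_on ball (of_real w0) \<delta>"
    "\<And>w. w \<in> ball (of_real w0) \<delta> \<Longrightarrow> \<kappa> (cnj w) = cnj (\<kappa> w)"
    "\<And>w. w \<in> ball (of_real w0) \<delta> \<Longrightarrow> \<kappa> w \<in> ball (of_real s0) \<rho>"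
    "\<kappa> (of_real w0) = of_real s0"
    "\<And>w. w \<in> half_ball w0 \<delta> \<Longrightarrow> h w = G (\<kappa> w)"
    "\<And>x. \<bar>x - w0\<bar> < \<delta> \<Longrightarrow> x < w0 \<Longrightarrow> Re (\<kappa> (of_real x)) < s0"
    "\<And>x. \<bar>x - w0\<bar> < \<delta> \<Longrightarrow> w0 < x \<Longrightarrow> s0 < Re (\<kappa> (of_real x))"
proof -
  let ?B = "ball (complex_of_real s0) \<rho>"
  let ?H = upper_half_plane
  define hi where "hi = inv_into ?H h"
  have hb: "bij_betw h ?H \<Omega>" and hh: "h holomorphic_on ?H" and hih: "hi holomorphic_on \<Omega>"
    using h by (auto simp: biholomorphic_between_def hi_def)
  have hih_id: "hi (h w) = w" if "w \<in> ?H" for w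
    using that hb by (simp add: hi_def bij_betw_inv_into_left)
  have hi_mem: "hi z \<in> ?H" if "z \<in> \<Omega>" for z
    using that hb by (auto simp: hi_def bij_betw_def intro!: inv_into_into)
  obtain K where K: "K holomorphic_on G ` ?B" "\<And>z. z \<in> ?B \<Longrightarrow> K (G z) = z"
    using holomorphic_has_inverse [OF chart_hol open_ball chart_inj] by metis
  \<comment> \<open>The radius is halved so that the values of f stay in a closed disc on which G is
    still defined.\<close>
  define N where "N = G ` ball (of_real s0) (\<rho>/2)"
  have subB: "ball (complex_of_real s0) (\<rho>/2) \<subseteq> ?B" using radius by auto
  have N: "open N" "G (of_real s0) \<in> N"
    using radius open_mapping_thm3 [OF holomorphic_on_subset [OF chart_hol subB] open_ball inj_on_subset [OF chart_inj subB]]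
    by (auto simp: N_def)
  obtain r where r: "0 < r" "\<And>w. w \<in> half_ball w0 r \<Longrightarrow> h w \<in> N"
  proof -
    obtain d where d: "0 < d" "\<And>w. w \<in> ?H \<Longrightarrow> w \<noteq> of_real w0 \<Longrightarrow> dist w (of_real w0) < d \<Longrightarrow> h w \<in> N"
      using topological_tendstoD [OF bv N] unfolding eventually_at by blast
    have "h w \<in> N" if "w \<in> half_ball w0 d" for w
      using that by (intro d(2)) (auto simp: half_ball_iff upper_half_plane_def dist_norm)
    then show thesis using that d(1) by blast
  qed
  define f where "f = (\<lambda>w. K (h w))"
  have f: "f w \<in> ball (of_real s0) (\<rho>/2)" "G (f w) = h w" "0 < Im (f w)" if w: "w \<in> half_ball w0 r" for w
  proof -
    obtain z where z: "z \<in> ball (of_real s0) (\<rho>/2)" "h w = G z"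
      using r(2) [OF w] by (auto simp: N_def)
    then have "f w = z" using K(2) subB by (simp add: f_def subset_iff)
    then show 1: "f w \<in> ball (of_real s0) (\<rho>/2)" "G (f w) = h w" using z by auto
    have "h w \<in> \<Omega>" using w hb half_ball_subset_upper [of w0 r] by (auto simp: bij_betw_def)
    then show "0 < Im (f w)" using chart_mem [of "f w"] 1 subB by auto
  qed
  have fhol: "f holomorphic_on half_ball w0 r"
  proof -
    have "h ` half_ball w0 r \<subseteq> G ` ?B" using r(2) subB by (auto simp: N_def)
    then have "K \<circ> h holomorphic_on half_ball w0 r"
      by (rule holomorphic_on_compose_gen [OF holomorphic_on_subset [OF hh half_ball_subset_upper] K(1)])
    then show ?thesis by (simp add: f_def o_def)
  qed
  have flim: "((\<lambda>w. Im (f w)) \<longlongrightarrow> 0) (at (of_real x) within half_ball w0 r)" for x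
  proof (rule tendstoI)
    fix e :: real assume e: "0 < e"
    \<comment> \<open>Properness of h at work: Q is mapped by G to a compact part of the domain,
      whose preimage under h is compact in the open half-plane and so misses a disc about the real
      point x. Hence Im f < e near x.\<close>
    define Q where "Q = cball (complex_of_real s0) (\<rho>/2) \<inter> {z. e \<le> Im z}"
    have "compact Q" unfolding Q_def
      by (intro compact_Int_closed compact_cball closed_halfspace_Im_ge)
    have QB: "Q \<subseteq> ?B" using radius by (auto simp: Q_def)
    have GQ: "G ` Q \<subseteq> \<Omega>" using QB chart_mem e by (force simp: Q_def)
    have "compact (hi ` G ` Q)"
      using QB GQ \<open>compact Q\<close> holomorphic_on_imp_continuous_on [OF chart_hol] holomorphic_on_imp_continuous_on [OF hih]
      by (intro compact_continuous_image) (blast intro: continuous_on_subset)+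
    moreover have "of_real x \<notin> hi ` G ` Q"
    proof
      assume "of_real x \<in> hi ` G ` Q"
      then obtain z where "z \<in> \<Omega>" "of_real x = hi z" using GQ by blast
      then have "0 < Im (complex_of_real x)" using hi_mem [of z] by (simp add: upper_half_plane_def)
      then show False by simp
    qed
    ultimately obtain d where d: "0 < d" "ball (of_real x) d \<inter> hi ` G ` Q = {}"
      by (metis Compl_disjoint ComplI compact_imp_closed disjoint_eq_subset_Compl inf_commute open_Compl openE)
    have "dist (Im (f w)) 0 < e" if w: "w \<in> half_ball w0 r" "dist w (of_real x) < d" for w
    proof (rule ccontr)
      assume "\<not> dist (Im (f w)) 0 < e"
      then have "f w \<in> Q" using f(1,3) [OF w(1)] by (auto simp: Q_def)
      moreover have "hi (G (f w)) = w"
        using f(2) [OF w(1)] hih_id w(1) half_ball_subset_upper [of w0 r] by auto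
      ultimately have "w \<in> hi ` G ` Q" by (metis imageI)
      then show False using d(2) w(2) by (auto simp: dist_commute)
    qed
    then show "\<forall>\<^sub>F w in at (of_real x) within half_ball w0 r. dist (Im (f w)) 0 < e"
      unfolding eventually_at using d(1) by blast
  qed
  have fbd: "\<bar>Im (f w)\<bar> \<le> \<rho>" if "w \<in> half_ball w0 r" for w
    using f(1) [OF that] abs_Im_le_cmod [of "f w - of_real s0"]
    by (auto simp: dist_norm norm_minus_commute)
  obtain \<kappa> r1 where r1: "0 < r1" "r1 \<le> r" and \<kappa>: "\<kappa> holomorphic_on ball (of_real w0) r1"
    and sym: "\<And>w. w \<in> ball (of_real w0) r1 \<Longrightarrow> \<kappa> (cnj w) = cnj (\<kappa> w)"
    and eq: "\<And>w. w \<in> half_ball w0 r1 \<Longrightarrow> \<kappa> w = f w"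
    by (rule reflection_of_bounded_Im [OF fhol r(1) fbd flim]) (assumption | rule that)+
  have cont: "isCont \<kappa> (of_real w0)"
    using holomorphic_on_imp_continuous_on [OF \<kappa>] r1(1) by (simp add: continuous_on_eq_continuous_at)
  have \<kappa>0: "\<kappa> (of_real w0) = of_real s0"
  proof (rule tendsto_unique)
    let ?v = "\<lambda>t. complex_of_real w0 + of_real t * \<i>"
    show "((\<lambda>t. \<kappa> (?v t)) \<longlongrightarrow> \<kappa> (of_real w0)) (at_right 0)"
      by (rule isCont_tendsto_compose [OF cont vertical_approach])
    have ev: "\<forall>\<^sub>F t in at_right 0. ?v t \<in> half_ball w0 r1"
      by (rule vertical_approach_half_ball [OF r1(1)])
    have "isCont K (G (of_real s0))"
      using holomorphic_on_imp_continuous_on [OF K(1)] open_mapping_thm3 [OF chart_hol open_ball chart_inj] radius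
      by (simp add: continuous_on_eq_continuous_at)
    moreover have "((\<lambda>t. h (?v t)) \<longlongrightarrow> G (of_real s0)) (at_right 0)"
    proof (rule filterlim_compose [OF bv])
      show "filterlim ?v (at (of_real w0) within ?H) (at_right 0)"
        unfolding filterlim_at using vertical_approach ev
        by (auto elim!: eventually_mono simp: half_ball_iff upper_half_plane_def)
    qed
    ultimately have "((\<lambda>t. K (h (?v t))) \<longlongrightarrow> K (G (of_real s0))) (at_right 0)"
      by (rule isCont_tendsto_compose)
    then have "((\<lambda>t. K (h (?v t))) \<longlongrightarrow> of_real s0) (at_right 0)"
      using K(2) [of "of_real s0"] radius by simp
    moreover have "\<forall>\<^sub>F t in at_right 0. K (h (?v t)) = \<kappa> (?v t)"
      using ev by eventually_elim (simp add: eq f_def)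
    ultimately show "((\<lambda>t. \<kappa> (?v t)) \<longlongrightarrow> of_real s0) (at_right 0)"
      by (rule Lim_transform_eventually)
  qed simp
  \<comment> \<open>Since \<kappa> maps the half disc into the upper half-plane, its derivative at
    \<open>w0\<close> is positive. Real points to the left of \<open>w0\<close> therefore go to
    parameters below s0 and those to the right go above it.\<close>
  obtain d where d: "0 < d" "deriv \<kappa> (of_real w0) = of_real d"
  proof (rule deriv_pos_of_upper_half [OF \<kappa> r1(1)])
    show "Im (\<kappa> (of_real w0)) = 0" by (simp add: \<kappa>0)
    show "0 < Im (\<kappa> w)" if "w \<in> half_ball w0 r1" for w
      using f(3) [of w] that eq [OF that] half_ball_mono [OF r1(2)] by auto
  qed
  have "(\<kappa> has_field_derivative of_real d) (at (of_real w0))"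
    using holomorphic_derivI [OF \<kappa> open_ball, of "of_real w0"] r1(1) d(2) by simp
  then have "((\<lambda>x. \<kappa> (of_real x)) has_vector_derivative of_real d) (at w0)"
    by (rule has_vector_derivative_real_field)
  then have "((\<lambda>x. Re (\<kappa> (of_real x))) has_vector_derivative Re (of_real d)) (at w0)"
    by (rule bounded_linear.has_vector_derivative [OF bounded_linear_Re])
  then have der: "((\<lambda>x. Re (\<kappa> (of_real x))) has_real_derivative d) (at w0)"
    by (simp add: has_real_derivative_iff_has_vector_derivative)
  obtain dr where dr: "0 < dr" "\<And>u. 0 < u \<Longrightarrow> u < dr \<Longrightarrow> s0 < Re (\<kappa> (of_real (w0 + u)))"
    using DERIV_pos_inc_right [OF der d(1)] \<kappa>0 by auto
  obtain dl where dl: "0 < dl" "\<And>u. 0 < u \<Longrightarrow> u < dl \<Longrightarrow> Re (\<kappa> (of_real (w0 - u))) < s0"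
    using DERIV_pos_inc_left [OF der d(1)] \<kappa>0 by auto
  obtain dc where dc: "0 < dc" "\<And>w. dist w (of_real w0) < dc \<Longrightarrow> dist (\<kappa> w) (of_real s0) < \<rho>"
    using cont radius \<kappa>0 unfolding continuous_at_eps_delta by metis
  define \<delta> where "\<delta> = Min {r1, dr, dl, dc}"
  have \<delta>: "0 < \<delta>" "\<delta> \<le> r1" "\<delta> \<le> dr" "\<delta> \<le> dl" "\<delta> \<le> dc"
    using r1 dr dl dc by (auto simp: \<delta>_def)
  show thesis
  proof (rule that [of \<delta> \<kappa>])
    show "\<kappa> holomorphic_on ball (of_real w0) \<delta>"
      by (rule holomorphic_on_subset [OF \<kappa>]) (use \<delta> in auto)
    show "\<kappa> (cnj w) = cnj (\<kappa> w)" "\<kappa> w \<in> ball (of_real s0) \<rho>" if "w \<in> ball (of_real w0) \<delta>" for w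
      using that \<delta> sym [of w] dc(2) [of w] by (auto simp: dist_commute)
    show "h w = G (\<kappa> w)" if w: "w \<in> half_ball w0 \<delta>" for w
    proof -
      have "w \<in> half_ball w0 r1" "w \<in> half_ball w0 r"
        using w \<delta> r1 by (auto simp: half_ball_iff)
      then show ?thesis using eq f(2) by simp
    qed
    show "Re (\<kappa> (of_real x)) < s0" if "\<bar>x - w0\<bar> < \<delta>" "x < w0" for x
      using dl(2) [of "w0 - x"] that \<delta> by simp
    show "s0 < Re (\<kappa> (of_real x))" if "\<bar>x - w0\<bar> < \<delta>" "w0 < x" for x
      using dr(2) [of "x - w0"] that \<delta> by simp
  qed (use \<delta> \<kappa>0 in auto)
qed

text \<open>A branch of the argument that is continuous on the closed upper half-plane minus the origin.\<close>

definition upper_arg :: "complex \<Rightarrow> real" where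
  "upper_arg w = Im (Ln (- \<i> * w)) + pi / 2"

text \<open>The factor - \<i> turns the closed upper half-plane into the closed right half-plane,
  which meets the cut of the principal logarithm only at 0; adding pi/2 undoes the turn.\<close>

lemma upper_arg_rcis: "0 < r \<Longrightarrow> 0 \<le> \<theta> \<Longrightarrow> \<theta> \<le> pi \<Longrightarrow> upper_arg (rcis r \<theta>) = \<theta>"
proof -
  assume a: "0 < r" "0 \<le> \<theta>" "\<theta> \<le> pi"
  have "- \<i> * rcis r \<theta> = rcis r (\<theta> - pi/2)"
    by (simp add: complex_eq_iff cos_diff sin_diff)
  moreover have "Arg (rcis r (\<theta> - pi/2)) = \<theta> - pi/2"
    using a pi_gt_zero by (intro Arg_rcis) (simp_all only: greaterThanAtMost_iff, linarith)
  ultimately show ?thesis using a by (simp add: upper_arg_def Arg_eq_Im_Ln)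
qed

lemma upper_arg_bounds:
  assumes "0 < Im w" shows "0 < upper_arg w" "upper_arg w < pi"
  using Re_Ln_pos_lt_imp [of "- \<i> * w"] assms by (auto simp: upper_arg_def abs_less_iff)

text \<open>\<open>left\<close> and \<open>right\<close> state that the closure of the graph has at
  most one height over each boundary point beside G(s0). Together with the bound M this yields
  genuine limits: along a sequence violating the limit, the bounded heights have a convergent
  subsequence, and its limit is the height of a point of the closure.\<close>

lemma (in boundary_chart) height_extends:
  fixes \<phi> :: "complex \<Rightarrow> real"
  assumes h: "biholomorphic_between h upper_half_plane \<Omega>"
    and bv: "(h \<longlongrightarrow> G (of_real s0)) (at (of_real w0) within upper_half_plane)"
    and P: "P holomorphic_on \<Omega>" "\<And>z. z \<in> \<Omega> \<Longrightarrow> \<phi> z = Re (P z)"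
    and M: "\<And>z. z \<in> \<Omega> \<Longrightarrow> \<bar>\<phi> z\<bar> \<le> M"
    and left: "\<And>x \<tau>. \<bar>x - s0\<bar> < \<rho> \<Longrightarrow> x < s0 \<Longrightarrow>
      (G (of_real x), \<tau>) \<in> closure ((\<lambda>z. (z, \<phi> z)) ` \<Omega>) \<Longrightarrow> \<tau> = a"
    and right: "\<And>x \<tau>. \<bar>x - s0\<bar> < \<rho> \<Longrightarrow> s0 < x \<Longrightarrow>
      (G (of_real x), \<tau>) \<in> closure ((\<lambda>z. (z, \<phi> z)) ` \<Omega>) \<Longrightarrow> \<tau> = b"
  obtains \<kappa> E \<delta> where "0 < \<delta>" "\<kappa> holomorphic_on ball (of_real w0) \<delta>"
    "\<And>w. w \<in> ball (of_real w0) \<delta> \<Longrightarrow> \<kappa> (cnj w) = cnj (\<kappa> w)"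
    "\<And>w. w \<in> ball (of_real w0) \<delta> \<Longrightarrow> \<kappa> w \<in> ball (of_real s0) \<rho>"
    "\<kappa> (of_real w0) = of_real s0"
    "E holomorphic_on ball (of_real w0) \<delta>"
    "\<And>w. w \<in> ball (of_real w0) \<delta> \<Longrightarrow> E (cnj w) = cnj (E w)"
    "\<And>w. w \<in> half_ball w0 \<delta> \<Longrightarrow> h w = G (\<kappa> w)"
    "\<And>w. w \<in> half_ball w0 \<delta> \<Longrightarrow> \<phi> (h w) = b + (a - b) / pi * upper_arg (w - of_real w0) + Im (E w)"
proof -
  obtain \<kappa> r where r: "0 < r" and \<kappa>: "\<kappa> holomorphic_on ball (of_real w0) r"
    "\<And>w. w \<in> ball (of_real w0) r \<Longrightarrow> \<kappa> (cnj w) = cnj (\<kappa> w)"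
    "\<And>w. w \<in> ball (of_real w0) r \<Longrightarrow> \<kappa> w \<in> ball (of_real s0) \<rho>"
    "\<kappa> (of_real w0) = of_real s0"
    "\<And>w. w \<in> half_ball w0 r \<Longrightarrow> h w = G (\<kappa> w)"
    and lt: "\<And>x. \<bar>x - w0\<bar> < r \<Longrightarrow> x < w0 \<Longrightarrow> Re (\<kappa> (of_real x)) < s0"
    and gt: "\<And>x. \<bar>x - w0\<bar> < r \<Longrightarrow> w0 < x \<Longrightarrow> s0 < Re (\<kappa> (of_real x))"
    by (rule parametrization_extends [OF h bv]) (rule that)
  let ?H = upper_half_plane
  have hb: "bij_betw h ?H \<Omega>" and hh: "h holomorphic_on ?H"
    using h by (auto simp: biholomorphic_between_def)
  have h\<Omega>: "h w \<in> \<Omega>" if "w \<in> half_ball w0 r" for w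
    using that hb half_ball_subset_upper [of w0 r] by (auto simp: bij_betw_def)
  have tlim: "((\<lambda>w. \<phi> (h w)) \<longlongrightarrow> (if x < w0 then a else b)) (at (of_real x) within half_ball w0 r)"
    if x: "\<bar>x - w0\<bar> < r" "x \<noteq> w0" for x
  proof (rule ccontr)
    let ?\<tau> = "if x < w0 then a else b"
    assume "\<not> ((\<lambda>w. \<phi> (h w)) \<longlongrightarrow> ?\<tau>) (at (of_real x) within half_ball w0 r)"
    then obtain e where e: "0 < e"
      "\<And>d. 0 < d \<Longrightarrow> \<exists>w\<in>half_ball w0 r. dist w (of_real x) < d \<and> e \<le> \<bar>\<phi> (h w) - ?\<tau>\<bar>"
      unfolding tendsto_iff eventually_at dist_real_def not_less [symmetric] by metis
    have "\<forall>n. \<exists>w. w \<in> half_ball w0 r \<and> dist w (of_real x) < inverse (real (Suc n)) \<and> e \<le> \<bar>\<phi> (h w) - ?\<tau>\<bar>"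
      using e(2) by (meson inverse_positive_iff_positive of_nat_0_less_iff zero_less_Suc)
    then obtain W where W: "\<And>n. W n \<in> half_ball w0 r"
        "\<And>n. dist (W n) (of_real x) < inverse (real (Suc n))"
        "\<And>n. e \<le> \<bar>\<phi> (h (W n)) - ?\<tau>\<bar>"
      by metis
    have Wx: "W \<longlonglongrightarrow> of_real x"
    proof (rule metric_LIMSEQ_I)
      fix d :: real assume "0 < d"
      then obtain n where n: "inverse (real (Suc n)) < d" using reals_Archimedean by blast
      have "dist (W k) (of_real x) < d" if "n \<le> k" for k
      proof -
        have "inverse (real (Suc k)) \<le> inverse (real (Suc n))" using that by (simp add: field_simps)
        then show ?thesis using W(2) [of k] n by linarith
      qed
      then show "\<exists>no. \<forall>n\<ge>no. dist (W n) (of_real x) < d" by blast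
    qed
    have "bounded (range (\<lambda>n. \<phi> (h (W n))))"
      using M h\<Omega> W(1) by (auto simp: bounded_iff)
    then obtain l k where k: "strict_mono (k :: nat \<Rightarrow> nat)" "((\<lambda>n. \<phi> (h (W n))) \<circ> k) \<longlonglongrightarrow> l"
      using bounded_imp_convergent_subsequence by blast
    have xb: "of_real x \<in> ball (complex_of_real w0) r"
      using x(1) by (simp add: dist_real_def abs_minus_commute flip: of_real_diff)
    have \<kappa>x: "\<kappa> (of_real x) = of_real (Re (\<kappa> (of_real x)))"
      using \<kappa>(2) [OF xb] by (simp add: complex_eq_iff)
    have \<kappa>s: "\<bar>Re (\<kappa> (of_real x)) - s0\<bar> < \<rho>"
      using \<kappa>(3) [OF xb] abs_Re_le_cmod [of "\<kappa> (of_real x) - of_real s0"]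
      by (simp add: dist_norm norm_minus_commute)
    have Wk: "(\<lambda>n. W (k n)) \<longlonglongrightarrow> of_real x"
      using LIMSEQ_subseq_LIMSEQ [OF Wx k(1)] by (simp add: o_def)
    have "(\<lambda>n. G (\<kappa> (W (k n)))) \<longlonglongrightarrow> G (\<kappa> (of_real x))"
    proof -
      have c: "isCont \<kappa> (of_real x)"
        using holomorphic_on_imp_continuous_on [OF \<kappa>(1)] xb
        by (simp add: continuous_on_eq_continuous_at)
      have "isCont G (\<kappa> (of_real x))"
        using holomorphic_on_imp_continuous_on [OF chart_hol] \<kappa>(3) [OF xb]
        by (simp add: continuous_on_eq_continuous_at)
      then show ?thesis by (rule isCont_tendsto_compose) (rule isCont_tendsto_compose [OF c Wk])
    qed
    then have "(\<lambda>n. (h (W (k n)), \<phi> (h (W (k n))))) \<longlonglongrightarrow> (G (\<kappa> (of_real x)), l)"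
      using k(2) W(1) by (intro tendsto_Pair) (auto simp: \<kappa>(5) o_def)
    then have "(G (of_real (Re (\<kappa> (of_real x)))), l) \<in> closure ((\<lambda>z. (z, \<phi> z)) ` \<Omega>)"
      using h\<Omega> W(1) \<kappa>x unfolding closure_sequential
      by (intro exI [of _ "\<lambda>n. (h (W (k n)), \<phi> (h (W (k n))))"]) auto
    then have l: "l = ?\<tau>"
      using left [OF \<kappa>s] right [OF \<kappa>s] lt [OF x(1)] gt [OF x(1)] x(2) by (cases "x < w0") auto
    have "(\<lambda>n. \<bar>\<phi> (h (W (k n))) - ?\<tau>\<bar>) \<longlonglongrightarrow> \<bar>l - ?\<tau>\<bar>"
      using k(2) by (intro tendsto_intros) (simp add: o_def)
    then have "e \<le> \<bar>l - ?\<tau>\<bar>" using W(3) by (intro LIMSEQ_le_const) auto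
    then show False using e(1) l by simp
  qed
  \<comment> \<open>\<phi> is the real part of P, hence the imaginary part of i P. The logarithm
    contributes (a - b) / pi times an argument that is pi to the left of \<open>w0\<close> and 0 to
    the right, so exactly the boundary values a and b are removed and the remainder tends to 0 on
    both sides.\<close>
  define f where "f = (\<lambda>w. \<i> * P (h w) - \<i> * of_real b
      - of_real ((a - b) / pi) * (Ln (- \<i> * (w - of_real w0)) + \<i> * of_real (pi / 2)))"
  have Imf: "Im (f w) = \<phi> (h w) - b - (a - b) / pi * upper_arg (w - of_real w0)" if "w \<in> half_ball w0 r" for w
    using P(2) [OF h\<Omega> [OF that]] by (simp add: f_def upper_arg_def del: times_divide_eq_left)
  have "f holomorphic_on half_ball w0 r"
  proof -
    have "P \<circ> h holomorphic_on half_ball w0 r"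
      using h\<Omega> half_ball_subset_upper
      by (intro holomorphic_on_compose_gen [OF _ P(1)] holomorphic_on_subset [OF hh]) auto
    moreover have "- \<i> * (w - of_real w0) \<notin> \<real>\<^sub>\<le>\<^sub>0" if "w \<in> half_ball w0 r" for w
      using that by (auto simp: complex_nonpos_Reals_iff half_ball_iff)
    ultimately show ?thesis unfolding f_def by (intro holomorphic_intros) (auto simp: o_def)
  qed
  moreover have "\<bar>Im (f w)\<bar> \<le> M + \<bar>b\<bar> + \<bar>a - b\<bar>" if "w \<in> half_ball w0 r" for w
  proof -
    have ua: "0 < upper_arg (w - of_real w0)" "upper_arg (w - of_real w0) < pi"
      using that by (auto intro!: upper_arg_bounds simp: half_ball_iff)
    have "\<bar>(a - b) / pi * upper_arg (w - of_real w0)\<bar> = \<bar>a - b\<bar> * (upper_arg (w - of_real w0) / pi)"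
      using ua by (simp add: abs_mult)
    also have "\<dots> \<le> \<bar>a - b\<bar> * 1" using ua by (intro mult_left_mono) auto
    finally have "\<bar>(a - b) / pi * upper_arg (w - of_real w0)\<bar> \<le> \<bar>a - b\<bar>" by simp
    moreover have "\<bar>u - b - v\<bar> \<le> M + \<bar>b\<bar> + c" if "\<bar>u\<bar> \<le> M" "\<bar>v\<bar> \<le> c" for u v c :: real
      using that by linarith
    ultimately show ?thesis using M [OF h\<Omega> [OF that]] unfolding Imf [OF that] by blast
  qed
  moreover have "((\<lambda>w. Im (f w)) \<longlongrightarrow> 0) (at (of_real x) within half_ball w0 r)"
    if x: "\<bar>x - w0\<bar> < r" "x \<noteq> w0" for x
  proof -
    have "- \<i> * (of_real x - of_real w0) \<notin> \<real>\<^sub>\<le>\<^sub>0"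
      using x(2) by (auto simp: complex_nonpos_Reals_iff)
    then have "((\<lambda>w. upper_arg (w - of_real w0)) \<longlongrightarrow> upper_arg (of_real x - of_real w0)) (at (of_real x) within half_ball w0 r)"
      unfolding upper_arg_def by (intro tendsto_intros)
    moreover have "upper_arg (of_real x - of_real w0) = (if x < w0 then pi else 0)"
    proof (cases "x < w0")
      case True
      then have "of_real x - complex_of_real w0 = rcis (w0 - x) pi" by (simp add: complex_eq_iff)
      then show ?thesis using True upper_arg_rcis [of "w0 - x" pi] by simp
    next
      case False
      then have "of_real x - complex_of_real w0 = rcis (x - w0) 0" by (simp add: complex_eq_iff)
      then show ?thesis using False x(2) upper_arg_rcis [of "x - w0" 0] by simp
    qed
    ultimately have "((\<lambda>w. \<phi> (h w) - b - (a - b) / pi * upper_arg (w - of_real w0)) \<longlongrightarrow>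
        (if x < w0 then a else b) - b - (a - b) / pi * (if x < w0 then pi else 0))
        (at (of_real x) within half_ball w0 r)"
      by (intro tendsto_intros tlim x) simp
    then have "((\<lambda>w. \<phi> (h w) - b - (a - b) / pi * upper_arg (w - of_real w0)) \<longlongrightarrow> 0)
        (at (of_real x) within half_ball w0 r)"
      by (simp split: if_splits)
    then show ?thesis
      by (rule Lim_transform_within [where d = 1]) (use Imf in auto)
  qed
  ultimately obtain E r1 where r1: "0 < r1" "r1 \<le> r" and E: "E holomorphic_on ball (of_real w0) r1"
    "\<And>w. w \<in> ball (of_real w0) r1 \<Longrightarrow> E (cnj w) = cnj (E w)"
    and Ef: "\<And>w. w \<in> half_ball w0 r1 \<Longrightarrow> E w = f w"
    by (rule reflection_of_bounded_Im [OF _ r]) (assumption | rule that)+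
  have sub: "ball (complex_of_real w0) r1 \<subseteq> ball (of_real w0) r" using r1 by auto
  show thesis
  proof (rule that [of r1 \<kappa> E])
    show "\<kappa> holomorphic_on ball (of_real w0) r1" by (rule holomorphic_on_subset [OF \<kappa>(1) sub])
    show "h w = G (\<kappa> w)" "\<phi> (h w) = b + (a - b) / pi * upper_arg (w - of_real w0) + Im (E w)"
      if w: "w \<in> half_ball w0 r1" for w
    proof -
      have "w \<in> half_ball w0 r" using w half_ball_mono [OF r1(2)] by blast
      then show "h w = G (\<kappa> w)" "\<phi> (h w) = b + (a - b) / pi * upper_arg (w - of_real w0) + Im (E w)"
        using Imf [of w] Ef [OF w] \<kappa>(5) by auto
    qed
  qed (use r1 E \<kappa> sub in blast)+
qed

section \<open>The jump of the height function\<close>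

lemma affine_heights:
  fixes a b :: real assumes "a \<noteq> b"
  shows "(\<lambda>\<theta>. b + (a - b) / pi * \<theta>) ` {0..pi} = {min a b..max a b}"
    and "(\<lambda>\<theta>. b + (a - b) / pi * \<theta>) ` {0<..<pi} = {min a b<..<max a b}"
proof -
  have form: "(\<lambda>\<theta>. b + (a - b) / pi * \<theta>) \<circ> (\<lambda>u. u * pi) = (\<lambda>u. (1 - u) *\<^sub>R b + u *\<^sub>R a)"
  proof
    fix u
    have "b + (a - b) / pi * (u * pi) = b + (a - b) * u" by simp
    then show "((\<lambda>\<theta>. b + (a - b) / pi * \<theta>) \<circ> (\<lambda>u. u * pi)) u = (1 - u) *\<^sub>R b + u *\<^sub>R a"
      unfolding o_def by (simp only:) (simp add: algebra_simps)
  qed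
  have "{0..pi} = (\<lambda>u. u * pi) ` {0..1}"
  proof safe
    fix \<theta> assume "\<theta> \<in> {0..pi}"
    then show "\<theta> \<in> (\<lambda>u. u * pi) ` {0..1}" by (intro image_eqI [of _ _ "\<theta> / pi"]) auto
  qed (auto intro: mult_left_le_one_le)
  then have "(\<lambda>\<theta>. b + (a - b) / pi * \<theta>) ` {0..pi} = closed_segment b a"
    by (simp only: image_comp form closed_segment_image_interval)
  then show "(\<lambda>\<theta>. b + (a - b) / pi * \<theta>) ` {0..pi} = {min a b..max a b}"
    by (auto simp: closed_segment_eq_real_ivl min_def max_def)
  have "{0<..<pi} = (\<lambda>u. u * pi) ` {0<..<1}"
  proof safe
    fix \<theta> assume "\<theta> \<in> {0<..<pi}"
    then show "\<theta> \<in> (\<lambda>u. u * pi) ` {0<..<1}" by (intro image_eqI [of _ _ "\<theta> / pi"]) auto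
  qed auto
  then have "(\<lambda>\<theta>. b + (a - b) / pi * \<theta>) ` {0<..<pi} = open_segment b a"
    using assms by (simp only: image_comp form open_segment_image_interval) simp
  then show "(\<lambda>\<theta>. b + (a - b) / pi * \<theta>) ` {0<..<pi} = {min a b<..<max a b}"
    by (auto simp: open_segment_eq_real_ivl min_def max_def)
qed

lemma isotropic_segment_eq:
  "a \<noteq> b \<Longrightarrow> isotropic_segment z0 a b = (\<lambda>\<theta>. (z0, b + (a - b) / pi * \<theta>)) ` {0..pi}"
  unfolding isotropic_segment_def affine_heights(1) [symmetric] by auto

lemma open_isotropic_segment_eq:
  "a \<noteq> b \<Longrightarrow> isotropic_segment z0 a b - {(z0, a), (z0, b)} = (\<lambda>\<theta>. (z0, b + (a - b) / pi * \<theta>)) ` {0<..<pi}"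
proof -
  assume ab: "a \<noteq> b"
  have "isotropic_segment z0 a b - {(z0, a), (z0, b)} = {z0} \<times> {min a b<..<max a b}"
    using ab by (auto simp: isotropic_segment_def min_def max_def split: if_splits)
  then show ?thesis unfolding affine_heights(2) [OF ab, symmetric] by auto
qed

lemma rcis_polar_flip: "rcis (- r) (pi - \<theta>) = cnj (rcis r \<theta>)"
  by (simp add: complex_eq_iff)

text \<open>The heights are attached to the sides of s0 in the chart, not to the two named subarcs
  of \<Gamma>, because the orientation required of the chart may reverse the arc. They are
  conditions on the closure of the graph, the form in which the boundary hypothesis can be applied
  to limits of sequences.\<close>

locale jump_chart = boundary_chart +
  fixes \<phi> :: "complex \<Rightarrow> real" and P :: "complex \<Rightarrow> complex" and M a b :: real
  assumes P: "P holomorphic_on \<Omega>" "z \<in> \<Omega> \<Longrightarrow> \<phi> z = Re (P z)"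
    and bounded_height: "z \<in> \<Omega> \<Longrightarrow> \<bar>\<phi> z\<bar> \<le> M"
    and jump: "a \<noteq> b"
    and left_height: "\<bar>x - s0\<bar> < \<rho> \<Longrightarrow> x < s0 \<Longrightarrow>
      (G (of_real x), \<tau>) \<in> closure ((\<lambda>z. (z, \<phi> z)) ` \<Omega>) \<Longrightarrow> \<tau> = a"
    and right_height: "\<bar>x - s0\<bar> < \<rho> \<Longrightarrow> s0 < x \<Longrightarrow>
      (G (of_real x), \<tau>) \<in> closure ((\<lambda>z. (z, \<phi> z)) ` \<Omega>) \<Longrightarrow> \<tau> = b"
begin

lemma local_form:
  assumes X: "conformal_parametrization \<Omega> \<phi> X" and bv: "boundary_value_at X w0 (G (of_real s0))"
  obtains \<kappa> E \<delta> where "0 < \<delta>" "\<kappa> holomorphic_on ball (of_real w0) \<delta>"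
    "\<And>w. w \<in> ball (of_real w0) \<delta> \<Longrightarrow> \<kappa> (cnj w) = cnj (\<kappa> w)"
    "\<And>w. w \<in> ball (of_real w0) \<delta> \<Longrightarrow> \<kappa> w \<in> ball (of_real s0) \<rho>"
    "\<kappa> (of_real w0) = of_real s0"
    "E holomorphic_on ball (of_real w0) \<delta>"
    "\<And>w. w \<in> ball (of_real w0) \<delta> \<Longrightarrow> E (cnj w) = cnj (E w)"
    "\<And>w. w \<in> half_ball w0 \<delta> \<Longrightarrow>
      X w = (G (\<kappa> w), b + (a - b) / pi * upper_arg (w - of_real w0) + Im (E w))"
proof -
  have h: "biholomorphic_between (fst \<circ> X) upper_half_plane \<Omega>"
    and snd: "\<And>w. w \<in> upper_half_plane \<Longrightarrow> snd (X w) = \<phi> (fst (X w))"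
    using X by (auto simp: conformal_parametrization_def)
  have bv': "((fst \<circ> X) \<longlongrightarrow> G (of_real s0)) (at (of_real w0) within upper_half_plane)"
    using bv by (simp add: boundary_value_at_def)
  obtain \<kappa> E \<delta> where \<delta>: "0 < \<delta>" "\<kappa> holomorphic_on ball (of_real w0) \<delta>"
    "\<And>w. w \<in> ball (of_real w0) \<delta> \<Longrightarrow> \<kappa> (cnj w) = cnj (\<kappa> w)"
    "\<And>w. w \<in> ball (of_real w0) \<delta> \<Longrightarrow> \<kappa> w \<in> ball (of_real s0) \<rho>"
    "\<kappa> (of_real w0) = of_real s0"
    "E holomorphic_on ball (of_real w0) \<delta>"
    "\<And>w. w \<in> ball (of_real w0) \<delta> \<Longrightarrow> E (cnj w) = cnj (E w)"
    and h1: "\<And>w. w \<in> half_ball w0 \<delta> \<Longrightarrow> (fst \<circ> X) w = G (\<kappa> w)"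
    and h2: "\<And>w. w \<in> half_ball w0 \<delta> \<Longrightarrow>
      \<phi> ((fst \<circ> X) w) = b + (a - b) / pi * upper_arg (w - of_real w0) + Im (E w)"
    by (rule height_extends [OF h bv' P bounded_height left_height right_height])
      (assumption | rule that)+
  show thesis
  proof (rule that [OF \<delta>])
    show "X w = (G (\<kappa> w), b + (a - b) / pi * upper_arg (w - of_real w0) + Im (E w))"
      if w: "w \<in> half_ball w0 \<delta>" for w
      using h1 [OF w] h2 [OF w] snd [of w] w half_ball_subset_upper [of w0 \<delta>]
      by (auto simp: prod_eq_iff)
  qed
qed

text \<open>In the local form every term except the argument has a limit at \<open>w0\<close>: the
  horizontal part tends to G(s0) and Im E to 0. What remains is the closed range of b + (a - b)
  \<theta> / pi, and each value is realized by approaching \<open>w0\<close> at suitable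
  angles.\<close>

lemma cluster_set_eq_segment:
  assumes X: "conformal_parametrization \<Omega> \<phi> X" and bv: "boundary_value_at X w0 (G (of_real s0))"
  shows "cluster_set X w0 = isotropic_segment (G (of_real s0)) a b"
proof -
  obtain \<kappa> E \<delta> where \<delta>: "0 < \<delta>" and \<kappa>: "\<kappa> holomorphic_on ball (of_real w0) \<delta>"
    "\<And>w. w \<in> ball (of_real w0) \<delta> \<Longrightarrow> \<kappa> (cnj w) = cnj (\<kappa> w)"
    "\<And>w. w \<in> ball (of_real w0) \<delta> \<Longrightarrow> \<kappa> w \<in> ball (of_real s0) \<rho>"
    and \<kappa>0: "\<kappa> (of_real w0) = of_real s0"
    and E: "E holomorphic_on ball (of_real w0) \<delta>"
    "\<And>w. w \<in> ball (of_real w0) \<delta> \<Longrightarrow> E (cnj w) = cnj (E w)"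
    and Xw: "\<And>w. w \<in> half_ball w0 \<delta> \<Longrightarrow>
      X w = (G (\<kappa> w), b + (a - b) / pi * upper_arg (w - of_real w0) + Im (E w))"
    by (rule local_form [OF X bv]) (rule that)
  have "isCont E (of_real w0)"
    using holomorphic_on_imp_continuous_on [OF E(1)] \<delta> by (simp add: continuous_on_eq_continuous_at)
  moreover have "Im (E (of_real w0)) = 0"
    using E(2) [of "of_real w0"] \<delta> by (simp add: complex_eq_iff)
  ultimately have Elim: "(\<lambda>n. Im (E (w n))) \<longlonglongrightarrow> 0" if "w \<longlonglongrightarrow> of_real w0" for w
    using tendsto_Im [OF isCont_tendsto_compose [OF _ that]] by metis
  have \<kappa>c: "isCont \<kappa> (of_real w0)"
    using holomorphic_on_imp_continuous_on [OF \<kappa>(1)] \<delta> by (simp add: continuous_on_eq_continuous_at)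
  have Gc: "isCont G (\<kappa> (of_real w0))"
    using holomorphic_on_imp_continuous_on [OF chart_hol] radius \<kappa>0 by (simp add: continuous_on_eq_continuous_at)
  have Glim: "(\<lambda>n. G (\<kappa> (w n))) \<longlonglongrightarrow> G (of_real s0)" if "w \<longlonglongrightarrow> of_real w0" for w
    using isCont_tendsto_compose [OF Gc isCont_tendsto_compose [OF \<kappa>c that]] by (simp add: \<kappa>0)
  have ev: "\<forall>\<^sub>F n in sequentially. w n \<in> half_ball w0 \<delta>"
    if "w \<longlonglongrightarrow> of_real w0" "\<And>n. w n \<in> upper_half_plane" for w
  proof -
    have "\<forall>\<^sub>F n in sequentially. dist (w n) (of_real w0) < \<delta>" using that(1) \<delta> by (rule tendstoD)
    then show ?thesis
      by eventually_elim (use that(2) in \<open>auto simp: half_ball_iff upper_half_plane_def dist_norm\<close>)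
  qed
  show ?thesis
  proof (intro equalityI subsetI)
    fix p assume "p \<in> cluster_set X w0"
    then obtain w where w: "\<And>n. w n \<in> upper_half_plane" "w \<longlonglongrightarrow> of_real w0" "(\<lambda>n. X (w n)) \<longlonglongrightarrow> p"
      by (auto simp: cluster_set_def)
    note ev = ev [OF w(2,1)]
    have "(\<lambda>n. fst (X (w n))) \<longlonglongrightarrow> fst p" using w(3) by (rule tendsto_fst)
    moreover have "\<forall>\<^sub>F n in sequentially. fst (X (w n)) = G (\<kappa> (w n))"
      using ev by eventually_elim (simp add: Xw)
    ultimately have "(\<lambda>n. G (\<kappa> (w n))) \<longlonglongrightarrow> fst p" by (rule Lim_transform_eventually)
    then have 1: "fst p = G (of_real s0)" using Glim [OF w(2)] LIMSEQ_unique by blast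
    have "(\<lambda>n. snd (X (w n)) - Im (E (w n))) \<longlonglongrightarrow> snd p - 0"
      by (intro tendsto_diff tendsto_snd w(3) Elim w(2))
    moreover have "\<forall>\<^sub>F n in sequentially. snd (X (w n)) - Im (E (w n)) \<in> {min a b..max a b}"
      using ev
    proof eventually_elim
      case (elim n)
      then have "0 < Im (w n - of_real w0)" by (simp add: half_ball_iff)
      then have "upper_arg (w n - of_real w0) \<in> {0..pi}"
        using upper_arg_bounds [of "w n - of_real w0"] by auto
      then show ?case unfolding affine_heights(1) [OF jump, symmetric] using Xw [OF elim] by auto
    qed
    ultimately have "snd p - 0 \<in> {min a b..max a b}"
      by (rule Lim_in_closed_set [OF closed_atLeastAtMost _ sequentially_bot, rotated])
    then show "p \<in> isotropic_segment (G (of_real s0)) a b"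
      using 1 by (auto simp: isotropic_segment_def mem_Times_iff)
  next
    fix p assume "p \<in> isotropic_segment (G (of_real s0)) a b"
    then obtain \<theta> where \<theta>: "0 \<le> \<theta>" "\<theta> \<le> pi" and p: "p = (G (of_real s0), b + (a - b) / pi * \<theta>)"
      unfolding isotropic_segment_eq [OF jump] by auto
    define e where "e = (\<lambda>n. inverse (real (Suc n)))"
    have e: "0 < e n" "e n \<le> 1" for n by (auto simp: e_def inverse_le_1_iff)
    have e0: "e \<longlonglongrightarrow> 0" unfolding e_def by (rule LIMSEQ_inverse_real_of_nat)
    \<comment> \<open>Moving \<theta> slightly towards pi/2 keeps the angle strictly inside (0, pi),
      so that the points approaching \<open>w0\<close> lie in the open half-plane also for \<theta>
      = 0 and \<theta> = pi, the endpoints of the segment.\<close>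
    define \<Theta> where "\<Theta> = (\<lambda>n. (1 - e n) * \<theta> + e n * (pi / 2))"
    have \<Theta>: "0 < \<Theta> n" "\<Theta> n < pi" for n
    proof -
      have "0 \<le> (1 - e n) * \<theta>" "(1 - e n) * \<theta> \<le> (1 - e n) * pi" "0 < e n * (pi / 2)" "0 < e n * pi"
        using e [of n] \<theta> by (auto intro: mult_left_mono)
      then show "0 < \<Theta> n" "\<Theta> n < pi" by (auto simp: \<Theta>_def algebra_simps)
    qed
    have \<Theta>lim: "\<Theta> \<longlonglongrightarrow> \<theta>"
    proof -
      have "\<Theta> \<longlonglongrightarrow> (1 - 0) * \<theta> + 0 * (pi / 2)" unfolding \<Theta>_def by (intro tendsto_intros e0)
      then show ?thesis by simp
    qed
    define w where "w = (\<lambda>n. of_real w0 + rcis (e n) (\<Theta> n))"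
    have wH: "w n \<in> upper_half_plane" for n
      using e(1) [of n] \<Theta> [of n] by (simp add: w_def upper_half_plane_def sin_gt_zero)
    have "(\<lambda>n. rcis (e n) (\<Theta> n)) \<longlonglongrightarrow> 0"
      by (rule tendsto_norm_zero_cancel) (use e(1) e0 in \<open>simp add: abs_of_pos\<close>)
    then have "w \<longlonglongrightarrow> of_real w0 + 0" unfolding w_def by (intro tendsto_add tendsto_const)
    then have w0: "w \<longlonglongrightarrow> of_real w0" by simp
    have "(\<lambda>n. (G (\<kappa> (w n)), b + (a - b) / pi * \<Theta> n + Im (E (w n)))) \<longlonglongrightarrow>
        (G (of_real s0), b + (a - b) / pi * \<theta> + 0)"
      by (intro tendsto_intros Glim Elim w0 \<Theta>lim) simp
    moreover have "\<forall>\<^sub>F n in sequentially. (G (\<kappa> (w n)), b + (a - b) / pi * \<Theta> n + Im (E (w n))) = X (w n)"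
      using ev [OF w0 wH]
    proof eventually_elim
      case (elim n)
      have "upper_arg (w n - of_real w0) = \<Theta> n"
        using upper_arg_rcis [of "e n" "\<Theta> n"] e(1) [of n] \<Theta> [of n] by (simp add: w_def)
      then show ?case using Xw [OF elim] by simp
    qed
    ultimately have "(\<lambda>n. X (w n)) \<longlonglongrightarrow> p"
      unfolding p by (auto intro: Lim_transform_eventually)
    then show "p \<in> cluster_set X w0" unfolding cluster_set_def using wH w0 by blast
  qed
qed

text \<open>After substitution of polar coordinates the argument is \<theta>, so the local form is
  analytic in (r, \<theta>) for both signs of r and reduces at r = 0 to the open segment. The flip
  conjugates the complex point, which \<kappa> and E respect, and R undoes conjugation in the chart;
  in the height Im E changes sign and \<theta> becomes pi - \<theta>.\<close>

lemma analytic_extension: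
  assumes X: "conformal_parametrization \<Omega> \<phi> X" and bv: "boundary_value_at X 0 (G (of_real s0))"
    and R: "\<And>w. w \<in> ball (of_real s0) \<rho> \<Longrightarrow> G w \<in> N \<and> R (G w) = G (cnj w)"
  shows "\<exists>V Y. open V \<and> V \<subseteq> UNIV \<times> {0<..<pi} \<and> {0} \<times> {0<..<pi} \<subseteq> V \<and>
        polar_flip ` V = V \<and> real_analytic_map_on Y V \<and>
        (\<forall>(r, \<theta>)\<in>V. r > 0 \<longrightarrow> Y (r, \<theta>) = X (rcis r \<theta>)) \<and>
        Y ` ({0} \<times> {0<..<pi}) = isotropic_segment (G (of_real s0)) a b - {(G (of_real s0), a), (G (of_real s0), b)} \<and>
        Y ` V \<subseteq> N \<times> UNIV \<and>
        (\<forall>p\<in>V. Y (polar_flip p) = segment_reflection R ((a + b) / 2) (Y p))"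
proof -
  obtain \<kappa> E \<delta> where \<delta>: "0 < \<delta>" and \<kappa>: "\<kappa> holomorphic_on ball 0 \<delta>"
    "\<And>w. w \<in> ball 0 \<delta> \<Longrightarrow> \<kappa> (cnj w) = cnj (\<kappa> w)"
    "\<And>w. w \<in> ball 0 \<delta> \<Longrightarrow> \<kappa> w \<in> ball (of_real s0) \<rho>"
    and \<kappa>0: "\<kappa> 0 = of_real s0"
    and E: "E holomorphic_on ball 0 \<delta>" "\<And>w. w \<in> ball 0 \<delta> \<Longrightarrow> E (cnj w) = cnj (E w)"
    and Xw: "\<And>w. w \<in> half_ball 0 \<delta> \<Longrightarrow> X w = (G (\<kappa> w), b + (a - b) / pi * upper_arg w + Im (E w))"
    by (rule local_form [OF X bv, unfolded of_real_0 diff_zero]) (rule that)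
  define V where "V = {- \<delta><..<\<delta>} \<times> {0<..<pi}"
  define Y where "Y = (\<lambda>(r, \<theta>). (G (\<kappa> (rcis r \<theta>)), b + (a - b) / pi * \<theta> + Im (E (rcis r \<theta>))))"
  have inb: "rcis r \<theta> \<in> ball 0 \<delta>" if "(r, \<theta>) \<in> V" for r \<theta>
    using that by (auto simp: V_def)
  have "Im (E 0) = 0" using E(2) [of 0] \<delta> by (simp add: complex_eq_iff)
  show ?thesis
  proof (intro exI [of _ V] exI [of _ Y] conjI)
    show "open V" unfolding V_def by (intro open_Times) auto
    show "V \<subseteq> UNIV \<times> {0<..<pi}" "{0} \<times> {0<..<pi} \<subseteq> V" using \<delta> by (auto simp: V_def)
    have "polar_flip p \<in> V" if "p \<in> V" for p using that by (auto simp: V_def polar_flip_def)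
    moreover have "polar_flip (polar_flip p) = p" for p by (simp add: polar_flip_def split: prod.split)
    ultimately show "polar_flip ` V = V" by (metis image_eqI image_subsetI subsetI subset_antisym)
    have G\<kappa>: "G \<circ> \<kappa> holomorphic_on ball 0 \<delta>"
      by (rule holomorphic_on_compose_gen [OF \<kappa>(1) chart_hol]) (use \<kappa>(3) in blast)
    have "real_analytic_map_on (\<lambda>p. (case p of (r, \<theta>) \<Rightarrow> (G \<circ> \<kappa>) (rcis r \<theta>),
        (case p of (r, \<theta>) \<Rightarrow> b + (a - b) / pi * \<theta>) + Im (case p of (r, \<theta>) \<Rightarrow> E (rcis r \<theta>)))) V"
      unfolding V_def
      by (intro real_analytic_map_on_Pair real_analytic_map_on_add real_analytic_map_on_affine_snd
          real_analytic_map_on_bounded_linear [OF bounded_linear_Im]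
          real_analytic_map_on_subset [OF real_analytic_polar [OF G\<kappa>]]
          real_analytic_map_on_subset [OF real_analytic_polar [OF E(1)]]) auto
    moreover have "(\<lambda>p. (case p of (r, \<theta>) \<Rightarrow> (G \<circ> \<kappa>) (rcis r \<theta>),
        (case p of (r, \<theta>) \<Rightarrow> b + (a - b) / pi * \<theta>) + Im (case p of (r, \<theta>) \<Rightarrow> E (rcis r \<theta>)))) = Y"
      by (auto simp: Y_def fun_eq_iff)
    ultimately show "real_analytic_map_on Y V" by simp
    show "\<forall>(r, \<theta>)\<in>V. r > 0 \<longrightarrow> Y (r, \<theta>) = X (rcis r \<theta>)"
    proof clarify
      fix r \<theta> assume r: "(r, \<theta>) \<in> V" "0 < r"
      then have "rcis r \<theta> \<in> half_ball 0 \<delta>" by (auto simp: half_ball_iff V_def sin_gt_zero)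
      from Xw [OF this] show "Y (r, \<theta>) = X (rcis r \<theta>)"
        using r upper_arg_rcis [of r \<theta>] by (simp add: Y_def V_def)
    qed
    show "Y ` ({0} \<times> {0<..<pi}) = isotropic_segment (G (of_real s0)) a b - {(G (of_real s0), a), (G (of_real s0), b)}"
      unfolding open_isotropic_segment_eq [OF jump]
      using \<open>Im (E 0) = 0\<close> by (force simp: Y_def \<kappa>0)
    show "Y ` V \<subseteq> N \<times> UNIV"
      using R \<kappa>(3) inb by (auto simp: Y_def)
    show "\<forall>p\<in>V. Y (polar_flip p) = segment_reflection R ((a + b) / 2) (Y p)"
    proof clarify
      fix r \<theta> assume p: "(r, \<theta>) \<in> V"
      note w = inb [OF p]
      have "R (G (\<kappa> (rcis r \<theta>))) = G (\<kappa> (cnj (rcis r \<theta>)))"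
        using R [OF \<kappa>(3) [OF w]] \<kappa>(2) [OF w] by simp
      moreover have "b + (a - b) / pi * (pi - \<theta>) = a + b - (b + (a - b) / pi * \<theta>)"
        by (simp add: right_diff_distrib)
      ultimately show "Y (polar_flip (r, \<theta>)) = segment_reflection R ((a + b) / 2) (Y (r, \<theta>))"
        using E(2) [OF w]
        by (simp add: Y_def polar_flip_def segment_reflection_def rcis_polar_flip add_divide_distrib)
    qed
  qed
qed

end

section \<open>Existence of a conformal parametrization\<close>

lemma biholomorphic_betweenI:
  assumes "open A" "bij_betw h A B" "h holomorphic_on A"
  shows "biholomorphic_between h A B"
proof -
  have inj: "inj_on h A" and B: "h ` A = B" using assms(2) by (auto simp: bij_betw_def)
  obtain j where j: "j holomorphic_on h ` A" "\<And>z. z \<in> A \<Longrightarrow> j (h z) = z"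
    using holomorphic_has_inverse [OF assms(3,1) inj] by metis
  have "inv_into A h holomorphic_on B"
    using j inj by (auto simp flip: B intro: holomorphic_transform [OF j(1)])
  then show ?thesis using assms by (simp add: biholomorphic_between_def)
qed

text \<open>A Cayley transform rotated so that 0 is sent to \<omega>; it moves a prescribed boundary
  point of the disc to the origin of the real axis.\<close>

lemma Cayley_bij_betw:
  assumes "cmod \<omega> = 1"
  shows "bij_betw (\<lambda>w. \<omega> * (\<i> - w) / (\<i> + w)) upper_half_plane (ball 0 1)"
proof (rule bij_betw_byWitness [where f' = "\<lambda>v. \<i> * (\<omega> - v) / (\<omega> + v)"])
  have \<omega>: "\<omega> \<noteq> 0" using assms by auto
  have ne: "\<i> + w \<noteq> 0" if "w \<in> upper_half_plane" for w
    using that by (auto simp: upper_half_plane_def complex_eq_iff)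
  have ne': "\<omega> + v \<noteq> 0" if "v \<in> ball 0 1" for v
  proof
    assume "\<omega> + v = 0"
    then have "v = - \<omega>" by (simp add: add_eq_0_iff)
    then show False using that assms by simp
  qed
  show "\<forall>w\<in>upper_half_plane. \<i> * (\<omega> - \<omega> * (\<i> - w) / (\<i> + w)) / (\<omega> + \<omega> * (\<i> - w) / (\<i> + w)) = w"
  proof
    fix w assume "w \<in> upper_half_plane"
    note ne = ne [OF this]
    have 1: "\<omega> - \<omega> * (\<i> - w) / (\<i> + w) = \<omega> * (2 * w) / (\<i> + w)"
      and 2: "\<omega> + \<omega> * (\<i> - w) / (\<i> + w) = \<omega> * (2 * \<i>) / (\<i> + w)"
      using ne by (simp_all add: divide_simps algebra_simps)
    show "\<i> * (\<omega> - \<omega> * (\<i> - w) / (\<i> + w)) / (\<omega> + \<omega> * (\<i> - w) / (\<i> + w)) = w"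
      unfolding 1 2 using ne \<omega> by simp
  qed
  show "\<forall>v\<in>ball 0 1. \<omega> * (\<i> - \<i> * (\<omega> - v) / (\<omega> + v)) / (\<i> + \<i> * (\<omega> - v) / (\<omega> + v)) = v"
  proof
    fix v :: complex assume "v \<in> ball 0 1"
    note ne = ne' [OF this]
    have 1: "\<i> - \<i> * (\<omega> - v) / (\<omega> + v) = \<i> * (2 * v) / (\<omega> + v)"
      and 2: "\<i> + \<i> * (\<omega> - v) / (\<omega> + v) = \<i> * (2 * \<omega>) / (\<omega> + v)"
      using ne by (simp_all add: divide_simps algebra_simps)
    show "\<omega> * (\<i> - \<i> * (\<omega> - v) / (\<omega> + v)) / (\<i> + \<i> * (\<omega> - v) / (\<omega> + v)) = v"
      unfolding 1 2 using ne \<omega> by simp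
  qed
  show "(\<lambda>w. \<omega> * (\<i> - w) / (\<i> + w)) ` upper_half_plane \<subseteq> ball 0 1"
  proof clarify
    fix w assume w: "w \<in> upper_half_plane"
    have "(cmod (\<i> - w))\<^sup>2 < (cmod (\<i> + w))\<^sup>2"
      unfolding cmod_power2 using w by (simp add: upper_half_plane_def power2_eq_square algebra_simps)
    then have "cmod (\<i> - w) < cmod (\<i> + w)" by (rule power2_less_imp_less) simp
    then show "\<omega> * (\<i> - w) / (\<i> + w) \<in> ball 0 1"
      using assms by (simp add: norm_mult norm_divide divide_less_eq)
  qed
  show "(\<lambda>v. \<i> * (\<omega> - v) / (\<omega> + v)) ` ball 0 1 \<subseteq> upper_half_plane"
  proof clarify
    fix v :: complex assume v: "v \<in> ball 0 1"
    have "\<i> * (\<omega> - v) / (\<omega> + v) = \<i> * ((\<omega> - v) * cnj (\<omega> + v)) / of_real ((cmod (\<omega> + v))\<^sup>2)"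
      unfolding complex_norm_square
      using ne' [OF v] complex_cnj_zero_iff [of "\<omega> + v"] by (simp add: divide_simps)
    moreover have "Re ((\<omega> - v) * cnj (\<omega> + v)) = (cmod \<omega>)\<^sup>2 - (cmod v)\<^sup>2"
      unfolding cmod_power2 by (simp add: power2_eq_square algebra_simps)
    moreover have "(cmod v)\<^sup>2 < 1" using v by (simp add: power_less_one_iff abs_square_less_1)
    ultimately have "Im (\<i> * (\<omega> - v) / (\<omega> + v)) = (1 - (cmod v)\<^sup>2) / (cmod (\<omega> + v))\<^sup>2"
      using assms by (simp del: of_real_power)
    then have "0 < Im (\<i> * (\<omega> - v) / (\<omega> + v))"
      using \<open>(cmod v)\<^sup>2 < 1\<close> ne' [OF v] by simp
    then show "\<i> * (\<omega> - v) / (\<omega> + v) \<in> upper_half_plane" by (simp add: upper_half_plane_def)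
  qed
qed

text \<open>The issue is the boundary value at 0. A Riemann map f read in the chart, k = f o G, has
  modulus tending to 1 at the diameter, so -i log k has imaginary part tending to 0 and extends by
  reflection. The extension of k is open, and this converts its behaviour at s0 into a limit of the
  inverse Riemann map g at \<omega> = \<open>k'\<close> s0. A Cayley transform sending 0 to \<omega>
  finishes.\<close>

lemma (in boundary_chart) exists_parametrization:
  assumes sc: "simply_connected \<Omega>" and ne: "\<Omega> \<noteq> UNIV"
  obtains h where "biholomorphic_between h upper_half_plane \<Omega>"
    "(h \<longlongrightarrow> G (of_real s0)) (at 0 within upper_half_plane)"
proof -
  have s0B: "complex_of_real s0 \<in> ball (of_real s0) \<rho>" using radius by simp
  have Gc: "isCont G w" if "w \<in> ball (of_real s0) \<rho>" for w
    using that holomorphic_on_imp_continuous_on [OF chart_hol] by (simp add: continuous_on_eq_continuous_at)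
  have G\<Omega>: "G w \<in> \<Omega>" if "w \<in> half_ball s0 \<rho>" for w
    using that chart_mem by (auto simp: half_ball_def)
  have upB: "of_real s0 + of_real (r/2) * \<i> \<in> half_ball s0 r" if "0 < r" for r
    using that by (simp add: half_ball_iff norm_mult)
  have "\<Omega> \<noteq> {}" using G\<Omega> [OF upB [OF radius]] by blast
  then obtain f g where f: "f holomorphic_on \<Omega>" and g: "g holomorphic_on ball 0 1"
    and fg: "\<And>z. z \<in> \<Omega> \<Longrightarrow> f z \<in> ball 0 1 \<and> g (f z) = z"
    and gf: "\<And>z. z \<in> ball 0 1 \<Longrightarrow> g z \<in> \<Omega> \<and> f (g z) = z"
    using sc ne simply_connected_eq_biholomorphic_to_disc [OF open_domain] by metis
  define k where "k = f \<circ> G"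
  have khol: "k holomorphic_on half_ball s0 \<rho>"
    unfolding k_def using G\<Omega>
    by (intro holomorphic_on_compose_gen [OF _ f] holomorphic_on_subset [OF chart_hol]) (auto simp: half_ball_def)
  have k1: "cmod (k w) < 1" if "w \<in> half_ball s0 \<rho>" for w
    using fg [OF G\<Omega> [OF that]] by (simp add: k_def)
  \<comment> \<open>Points with |k| \<le> c come from the compact set g(cball 0 c) inside the
    domain, which G(x) avoids because it lies outside the domain.\<close>
  have klim: "((\<lambda>w. cmod (k w)) \<longlongrightarrow> 1) (at (of_real x) within half_ball s0 \<rho>)" if x: "\<bar>x - s0\<bar> < \<rho>" for x
  proof (rule order_tendstoI)
    fix c :: real assume "c < 1"
    define K where "K = g ` cball 0 c"
    have sub: "cball 0 c \<subseteq> ball (0::complex) 1" using \<open>c < 1\<close> by auto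
    have "compact K" unfolding K_def
      by (intro compact_continuous_image compact_cball continuous_on_subset [OF holomorphic_on_imp_continuous_on [OF g] sub])
    moreover have xB: "of_real x \<in> ball (complex_of_real s0) \<rho>"
      using x by (simp add: dist_real_def abs_minus_commute flip: of_real_diff)
    moreover have "G (of_real x) \<notin> K"
      using chart_mem [OF xB] gf sub by (auto simp: K_def)
    ultimately have "\<forall>\<^sub>F w in at (of_real x) within half_ball s0 \<rho>. G w \<in> - K"
      using Gc [OF xB]
      by (intro topological_tendstoD [of G "G (of_real x)"])
        (auto simp: isCont_def compact_imp_closed open_Compl intro: tendsto_within_subset)
    moreover have "\<forall>\<^sub>F w in at (of_real x) within half_ball s0 \<rho>. w \<in> half_ball s0 \<rho>"
      by (simp add: eventually_at_filter)
    ultimately show "\<forall>\<^sub>F w in at (of_real x) within half_ball s0 \<rho>. c < cmod (k w)"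
    proof eventually_elim
      case (elim w)
      show ?case
      proof (rule ccontr)
        assume "\<not> c < cmod (k w)"
        then have "g (k w) \<in> K" by (simp add: K_def)
        then show False using elim fg [OF G\<Omega>] by (simp add: k_def)
      qed
    qed
  next
    fix c :: real assume "1 < c"
    have "\<forall>\<^sub>F w in at (of_real x) within half_ball s0 \<rho>. w \<in> half_ball s0 \<rho>"
      by (simp add: eventually_at_filter)
    then show "\<forall>\<^sub>F w in at (of_real x) within half_ball s0 \<rho>. cmod (k w) < c"
      by eventually_elim (use k1 \<open>1 < c\<close> in fastforce)
  qed
  \<comment> \<open>Staying above 1/2 keeps k away from 0, so that it has a logarithm, and bounds
    the real part of that logarithm by ln 2 in absolute value.\<close>
  obtain r where r: "0 < r" "r \<le> \<rho>" "\<And>w. w \<in> half_ball s0 r \<Longrightarrow> 1/2 < cmod (k w)"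
  proof -
    have "\<forall>\<^sub>F w in at (of_real s0) within half_ball s0 \<rho>. 1/2 < cmod (k w)"
      using radius by (intro order_tendstoD [OF klim]) auto
    then obtain d where d: "0 < d" "\<And>w. w \<in> half_ball s0 \<rho> \<Longrightarrow> w \<noteq> of_real s0 \<Longrightarrow> dist w (of_real s0) < d \<Longrightarrow> 1/2 < cmod (k w)"
      unfolding eventually_at by blast
    show thesis
    proof (rule that [of "min d \<rho>"])
      fix w assume "w \<in> half_ball s0 (min d \<rho>)"
      then show "1/2 < cmod (k w)" by (intro d(2)) (auto simp: half_ball_iff dist_norm)
    qed (use d radius in auto)
  qed
  have sub: "half_ball s0 r \<subseteq> half_ball s0 \<rho>" by (rule half_ball_mono [OF r(2)])
  have kr: "k holomorphic_on half_ball s0 r" by (rule holomorphic_on_subset [OF khol sub])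
  have kne: "\<forall>w\<in>half_ball s0 r. k w \<noteq> 0" using r(3) by fastforce
  have "simply_connected (half_ball s0 r)" by (simp add: convex_imp_simply_connected)
  then obtain l where l: "l holomorphic_on half_ball s0 r" "\<And>w. w \<in> half_ball s0 r \<Longrightarrow> k w = exp (l w)"
    using simply_connected_eq_holomorphic_log [OF open_half_ball] kr kne by blast
  have Rel: "Re (l w) = ln (cmod (k w))" if "w \<in> half_ball s0 r" for w
    using l(2) [OF that] by (simp add: norm_exp_eq_Re)
  have Rel_bd: "- ln 2 \<le> Re (l w)" "Re (l w) < 0" if "w \<in> half_ball s0 r" for w
  proof -
    have "ln (1/2) \<le> ln (cmod (k w))" using r(3) [OF that] by (subst ln_le_cancel_iff) auto
    moreover have "ln (cmod (k w)) < 0" using r(3) [OF that] k1 [OF subsetD [OF sub that]] by (intro ln_less_zero) auto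
    ultimately show "- ln 2 \<le> Re (l w)" "Re (l w) < 0" by (auto simp: Rel [OF that] ln_div)
  qed
  define F0 where "F0 = (\<lambda>w. - \<i> * l w)"
  have "F0 holomorphic_on half_ball s0 r" unfolding F0_def by (intro holomorphic_intros l(1))
  moreover have "\<bar>Im (F0 w)\<bar> \<le> ln 2" if "w \<in> half_ball s0 r" for w
    using Rel_bd [OF that] by (simp add: F0_def)
  moreover have "((\<lambda>w. Im (F0 w)) \<longlongrightarrow> 0) (at (of_real x) within half_ball s0 r)" if x: "\<bar>x - s0\<bar> < r" for x
  proof -
    have "((\<lambda>w. cmod (k w)) \<longlongrightarrow> 1) (at (of_real x) within half_ball s0 r)"
      by (rule tendsto_within_subset [OF klim sub]) (use x r(2) in auto)
    then have "((\<lambda>w. - ln (cmod (k w))) \<longlongrightarrow> - ln 1) (at (of_real x) within half_ball s0 r)"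
      by (intro tendsto_intros) auto
    then have "((\<lambda>w. - ln (cmod (k w))) \<longlongrightarrow> 0) (at (of_real x) within half_ball s0 r)" by simp
    then show ?thesis
      by (rule Lim_transform_within [where d = 1]) (auto simp: F0_def Rel)
  qed
  ultimately obtain F r1 where r1: "0 < r1" "r1 \<le> r" and F: "F holomorphic_on ball (of_real s0) r1"
    and sym: "\<And>w. w \<in> ball (of_real s0) r1 \<Longrightarrow> F (cnj w) = cnj (F w)"
    and FF0: "\<And>w. w \<in> half_ball s0 r1 \<Longrightarrow> F w = F0 w"
    by (rule reflection_of_bounded_Im [OF _ r(1)]) (assumption | rule that)+
  define k' where "k' = (\<lambda>w. exp (\<i> * F w))"
  have k'hol: "k' holomorphic_on ball (of_real s0) r1" unfolding k'_def by (intro holomorphic_intros F)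
  have k'k: "k' w = k w" if w: "w \<in> half_ball s0 r1" for w
    using FF0 [OF w] l(2) [OF subsetD [OF half_ball_mono [OF r1(2)] w]] by (simp add: k'_def F0_def)
  have k'norm: "cmod (k' w) = exp (- Im (F w))" for w by (simp add: k'_def norm_exp_eq_Re)
  have cn: "cnj w \<in> ball (of_real s0) r1" if "w \<in> ball (of_real s0) r1" for w
    using that by (metis complex_cnj_complex_of_real complex_cnj_diff complex_mod_cnj dist_norm mem_ball)
  \<comment> \<open>By symmetry Im F vanishes on the diameter and is negative below it, so there
    |\<open>k'\<close>| \<ge> 1: only points of the upper half disc are sent into the unit
    disc.\<close>
  have inside: "w \<in> half_ball s0 r1" if w: "w \<in> ball (of_real s0) r1" "cmod (k' w) < 1" for w
  proof (rule ccontr)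
    assume "w \<notin> half_ball s0 r1"
    then have "Im w = 0 \<or> Im w < 0" using w(1) by (auto simp: half_ball_def)
    then have "Im (F w) \<le> 0"
    proof
      assume "Im w = 0"
      then have "cnj w = w" by (simp add: complex_eq_iff)
      then have "Im (F w) = Im (cnj (F w))" using sym [OF w(1)] by metis
      then show "Im (F w) \<le> 0" by simp
    next
      assume "Im w < 0"
      then have c: "cnj w \<in> half_ball s0 r1" using cn [OF w(1)] by (simp add: half_ball_def)
      then have "0 < Im (F (cnj w))"
        using FF0 [OF c] Rel_bd(2) [of "cnj w"] half_ball_mono [OF r1(2), of s0] by (auto simp: F0_def)
      then show "Im (F w) \<le> 0" using sym [OF w(1)] by simp
    qed
    then show False using w(2) by (simp add: k'norm)
  qed
  define \<omega> where "\<omega> = k' (of_real s0)"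
  have s0r1: "complex_of_real s0 \<in> ball (of_real s0) r1" using r1 by simp
  have \<omega>: "cmod \<omega> = 1"
    using sym [OF s0r1] by (simp add: \<omega>_def k'norm complex_eq_iff)
  have nconst: "\<not> k' constant_on ball (of_real s0) r1"
  proof
    assume "k' constant_on ball (of_real s0) r1"
    then have "k' (of_real s0 + of_real (r1/2) * \<i>) = \<omega>"
      using upB [OF r1(1)] s0r1 unfolding constant_on_def \<omega>_def half_ball_def by (metis IntD1)
    moreover have "cmod (k' (of_real s0 + of_real (r1/2) * \<i>)) < 1"
      using k'k [OF upB [OF r1(1)]] k1 upB [OF r1(1)] half_ball_mono [of r1 \<rho> s0] r1(2) r(2) by auto
    ultimately show False using \<omega> by simp
  qed
  \<comment> \<open>Near \<omega> every point of the unit disc is \<open>k'\<close> w for some w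
    close to s0, and w lies in the upper half disc by \<open>inside\<close>. There \<open>k'\<close>
    = f o G, so g returns G w, which is close to G(s0).\<close>
  have glim: "(g \<longlongrightarrow> G (of_real s0)) (at \<omega> within ball 0 1)"
  proof (rule topological_tendstoI)
    fix A assume A: "open A" "G (of_real s0) \<in> A"
    then have "\<forall>\<^sub>F w in at (of_real s0). G w \<in> A"
      using Gc [OF s0B] by (auto simp: isCont_def dest: topological_tendstoD)
    then obtain d where d: "0 < d" "\<And>w. dist w (of_real s0) < d \<Longrightarrow> G w \<in> A"
      using A(2) unfolding eventually_at by (metis UNIV_I)
    define e where "e = min d r1"
    have e: "0 < e" "e \<le> d" "e \<le> r1" using d r1 by (auto simp: e_def)
    have "open (k' ` ball (of_real s0) e)"
      by (rule open_mapping_thm [OF k'hol _ _ _ _ nconst]) (use e in auto)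
    moreover have "\<omega> \<in> k' ` ball (of_real s0) e" using e by (simp add: \<omega>_def)
    ultimately have "\<forall>\<^sub>F v in at \<omega> within ball 0 1. v \<in> k' ` ball (of_real s0) e"
      using eventually_at_topological by blast
    moreover have "\<forall>\<^sub>F v in at \<omega> within ball 0 1. v \<in> ball 0 1" by (simp add: eventually_at_filter)
    ultimately show "\<forall>\<^sub>F v in at \<omega> within ball 0 1. g v \<in> A"
    proof eventually_elim
      case (elim v)
      then obtain w where w: "w \<in> ball (of_real s0) e" "v = k' w" by blast
      have w': "w \<in> half_ball s0 r1" using inside [of w] w elim e by auto
      then have "w \<in> half_ball s0 \<rho>" using half_ball_mono [of r1 \<rho> s0] r1(2) r(2) by auto
      then have "g v = G w" using k'k [OF w'] fg [OF G\<Omega>] w(2) by (simp add: k_def)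
      then show ?case using d(2) [of w] w(1) e by (simp add: dist_commute)
    qed
  qed
  define m where "m = (\<lambda>w. \<omega> * (\<i> - w) / (\<i> + w))"
  have mbij: "bij_betw m upper_half_plane (ball 0 1)"
    unfolding m_def by (rule Cayley_bij_betw [OF \<omega>])
  have mhol: "m holomorphic_on upper_half_plane"
    unfolding m_def by (intro holomorphic_intros) (auto simp: upper_half_plane_def complex_eq_iff)
  have gbij: "bij_betw g (ball 0 1) \<Omega>"
    by (rule bij_betw_byWitness [where f' = f]) (use fg gf in auto)
  show thesis
  proof (rule that [of "g \<circ> m"])
    show "biholomorphic_between (g \<circ> m) upper_half_plane \<Omega>"
    proof (rule biholomorphic_betweenI)
      show "open upper_half_plane" by (simp add: upper_half_plane_def open_halfspace_Im_gt)
      show "bij_betw (g \<circ> m) upper_half_plane \<Omega>" by (rule bij_betw_trans [OF mbij gbij])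
      show "g \<circ> m holomorphic_on upper_half_plane"
        by (rule holomorphic_on_compose_gen [OF mhol g]) (use mbij in \<open>auto simp: bij_betw_def\<close>)
    qed
    have "(m \<longlongrightarrow> m 0) (at 0 within upper_half_plane)"
      unfolding m_def by (intro tendsto_intros) auto
    moreover have "m 0 = \<omega>"
      by (simp only: m_def diff_zero add_0_right nonzero_mult_div_cancel_right [OF complex_i_not_zero])
    ultimately have "(m \<longlongrightarrow> \<omega>) (at 0 within upper_half_plane)" by metis
    moreover have "\<forall>\<^sub>F w in at 0 within upper_half_plane. m w \<in> ball 0 1 \<and> m w \<noteq> \<omega>"
    proof -
      have "m w \<in> ball 0 1 \<and> m w \<noteq> \<omega>" if "w \<in> upper_half_plane" for w
      proof -
        have "m w \<in> ball 0 1" using mbij that by (rule bij_betw_apply)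
        then show ?thesis using \<omega> by auto
      qed
      then show ?thesis by (auto simp: eventually_at_filter)
    qed
    ultimately have "filterlim m (at \<omega> within ball 0 1) (at 0 within upper_half_plane)"
      by (simp add: filterlim_at)
    from filterlim_compose [OF glim this]
    show "((g \<circ> m) \<longlongrightarrow> G (of_real s0)) (at 0 within upper_half_plane)" by (simp add: o_def)
  qed
qed

section \<open>Reflection in an analytic arc\<close>

text \<open>Composing with a homeomorphism onto the circle and an argument function reduces this to
  invariance of domain on the real line.\<close>

lemma curve_in_Jordan_curve_embedding:
  fixes \<gamma> :: "real \<Rightarrow> complex"
  assumes c: "simple_path c" "pathfinish c = pathstart c"
    and I: "open I" and cont: "continuous_on I \<gamma>" and inj: "inj_on \<gamma> I"
    and sub: "\<gamma> ` I \<subseteq> path_image c" and s: "s \<in> I" and r: "0 < r"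
  obtains \<eta> where "0 < \<eta>" "\<And>t. t \<in> I \<Longrightarrow> dist (\<gamma> t) (\<gamma> s) < \<eta> \<Longrightarrow> \<bar>t - s\<bar> < r"
proof -
  obtain d where d: "0 < d" "ball s d \<subseteq> I" using I s openE by blast
  define u where "u = min d r / 2"
  have u: "0 < u" "u < d" "u < r" using d r by (auto simp: u_def)
  \<comment> \<open>A point of the curve just beyond the interval T. Removing it opens the circle to
    an arc on which an angle can be defined.\<close>
  define p where "p = \<gamma> (s + u)"
  have suI: "s + u \<in> I" using d u by (intro subsetD [OF d(2)]) (simp add: dist_real_def)
  define T where "T = {s - u<..<s + u}"
  have TI: "T \<subseteq> I"
    using u by (intro subset_trans [OF _ d(2)]) (auto simp: T_def dist_real_def)
  have Tp: "p \<notin> \<gamma> ` T"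
  proof
    assume "p \<in> \<gamma> ` T"
    then obtain t where t: "t \<in> T" "\<gamma> (s + u) = \<gamma> t" by (auto simp: p_def)
    then have "s + u = t" using inj_onD [OF inj t(2) suI] TI by blast
    then show False using t(1) by (simp add: T_def)
  qed
  obtain e e' where e: "homeomorphism (path_image c) (sphere (0::complex) 1) e e'"
    using homeomorphic_simple_path_image_circle [OF c, of 1 0] by (auto simp: homeomorphic_def)
  have em: "cmod (e z) = 1" if "z \<in> path_image c" for z
    using homeomorphism_image1 [OF e] that by auto
  have e_inj: "e z = e z' \<Longrightarrow> z = z'" if "z \<in> path_image c" "z' \<in> path_image c" for z z'
    using homeomorphism_apply1 [OF e] that by metis
  have pJ: "p \<in> path_image c" using sub suI by (auto simp: p_def)
  \<comment> \<open>The rotation places p at -1, on the cut of the logarithm. On the rest of the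
    Jordan curve the angle \<psi> is then continuous and injective.\<close>
  define q where "q = (\<lambda>z. - (e z / e p))"
  have q1: "cmod (q z) = 1" if "z \<in> path_image c" for z
    using em [OF that] em [OF pJ] by (simp add: q_def norm_divide)
  have qn: "q z \<notin> \<real>\<^sub>\<le>\<^sub>0" if z: "z \<in> path_image c - {p}" for z
  proof
    assume "q z \<in> \<real>\<^sub>\<le>\<^sub>0"
    then obtain x where x: "q z = of_real x" "x \<le> 0" by (auto simp: nonpos_Reals_def)
    then have "q z = -1" using q1 [of z] z by (simp add: abs_if split: if_splits)
    moreover have "e p \<noteq> 0" using em [OF pJ] by auto
    ultimately have "e z = e p" by (simp add: q_def divide_simps)
    then show False using e_inj [of z p] z pJ by auto
  qed
  define \<psi> where "\<psi> = (\<lambda>z. Im (Ln (q z)))"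
  have \<psi>c: "continuous_on (path_image c - {p}) \<psi>"
    unfolding \<psi>_def q_def using homeomorphism_cont1 [OF e] em [OF pJ] qn
    by (intro continuous_intros continuous_on_subset [OF homeomorphism_cont1 [OF e]]) (auto simp: q_def)
  have \<psi>i: "inj_on \<psi> (path_image c - {p})"
  proof (rule inj_onI)
    fix z z' assume z: "z \<in> path_image c - {p}" "z' \<in> path_image c - {p}" "\<psi> z = \<psi> z'"
    have ne: "q z \<noteq> 0" "q z' \<noteq> 0" using q1 z by force+
    have "Re (Ln (q z)) = Re (Ln (q z'))" using ne q1 z by simp
    then have "Ln (q z) = Ln (q z')" using z(3) by (simp add: \<psi>_def complex_eq_iff)
    then have "q z = q z'" using ne by (metis exp_Ln)
    moreover have "e p \<noteq> 0" using em [OF pJ] by auto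
    ultimately have "e z = e z'" by (simp add: q_def)
    then show "z = z'" using e_inj z by blast
  qed
  have \<gamma>T: "\<gamma> ` T \<subseteq> path_image c - {p}" using sub TI Tp by blast
  \<comment> \<open>By invariance of domain the angles taken on T form an open set. Every point of
    the Jordan curve near \<gamma> s has its angle in this set and therefore, \<psi> being
    injective, is \<gamma> of a parameter in T.\<close>
  have img: "open ((\<psi> \<circ> \<gamma>) ` T)"
  proof (rule injective_into_1d_imp_open_map_UNIV [where S = T])
    show "continuous_on T (\<psi> \<circ> \<gamma>)"
      by (intro continuous_on_compose continuous_on_subset [OF cont TI] continuous_on_subset [OF \<psi>c \<gamma>T])
    show "inj_on (\<psi> \<circ> \<gamma>) T"
      by (intro comp_inj_on inj_on_subset [OF inj TI] inj_on_subset [OF \<psi>i \<gamma>T])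
  qed (simp_all add: T_def)
  have sT: "s \<in> T" using u by (simp add: T_def)
  then have "\<gamma> s \<in> path_image c - {p}" "\<psi> (\<gamma> s) \<in> (\<psi> \<circ> \<gamma>) ` T" using \<gamma>T by auto
  then obtain A where A: "open A" "\<gamma> s \<in> A"
      "\<And>z. z \<in> A \<Longrightarrow> z \<in> path_image c - {p} \<Longrightarrow> \<psi> z \<in> (\<psi> \<circ> \<gamma>) ` T"
    using \<psi>c [unfolded continuous_on_topological, rule_format, OF _ img, of "\<gamma> s"] by blast
  obtain \<eta> where \<eta>: "0 < \<eta>" "ball (\<gamma> s) \<eta> \<subseteq> A" using A openE by blast
  have ps: "p \<noteq> \<gamma> s" using Tp sT by blast
  show thesis
  \<comment> \<open>The distance to p is included because \<psi> says nothing about p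
    itself.\<close>
  proof (rule that [of "min \<eta> (dist p (\<gamma> s))"])
    show "0 < min \<eta> (dist p (\<gamma> s))" using \<eta>(1) ps by simp
    fix t assume t: "t \<in> I" "dist (\<gamma> t) (\<gamma> s) < min \<eta> (dist p (\<gamma> s))"
    have tJ: "\<gamma> t \<in> path_image c - {p}" using sub t by auto
    have "\<gamma> t \<in> A" using t(2) \<eta>(2) by (auto simp: dist_commute)
    from A(3) [OF this tJ] obtain v where v: "v \<in> T" "\<psi> (\<gamma> t) = \<psi> (\<gamma> v)" by auto
    then have "\<gamma> t = \<gamma> v" using inj_onD [OF \<psi>i v(2) tJ] \<gamma>T by blast
    then have "t = v" using inj_onD [OF inj] t(1) v(1) TI by blast
    then show "\<bar>t - s\<bar> < r" using v(1) u by (auto simp: T_def)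
  qed
qed

section \<open>Holomorphic continuation of analytic arcs and existence of the reflection\<close>

lemma real_analytic_curve_local_extension:
  fixes \<gamma> :: "real \<Rightarrow> complex"
  assumes "real_analytic_curve_on \<gamma> I" "s \<in> I"
  shows "\<exists>\<epsilon>>0. \<exists>F. F holomorphic_on ball (of_real s) \<epsilon> \<and> (\<forall>t. \<bar>t - s\<bar> < \<epsilon> \<longrightarrow> F (of_real t) = \<gamma> t)"
proof -
  obtain c \<epsilon> where \<epsilon>: "0 < \<epsilon>" and c: "\<And>t. \<bar>t - s\<bar> < \<epsilon> \<Longrightarrow> (\<lambda>n. (t - s) ^ n *\<^sub>R c n) sums \<gamma> t"
    using assms unfolding real_analytic_curve_on_def by blast
  define F where "F = (\<lambda>w. \<Sum>n. c n * (w - of_real s) ^ n)"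
  have real: "(\<lambda>n. c n * (of_real t - of_real s) ^ n) sums \<gamma> t" if "\<bar>t - s\<bar> < \<epsilon>" for t
    using c [OF that] by (simp add: scaleR_conv_of_real mult.commute)
  have sums: "(\<lambda>n. c n * (w - of_real s) ^ n) sums F w" if w: "w \<in> ball (of_real s) \<epsilon>" for w
  proof -
    define t where "t = s + (cmod (w - of_real s) + \<epsilon>) / 2"
    have n: "cmod (w - of_real s) < \<epsilon>" using w by (simp add: dist_norm norm_minus_commute)
    then have t: "0 < t - s" "cmod (w - of_real s) < t - s" "t - s < \<epsilon>"
      by (auto simp: t_def intro!: add_nonneg_pos \<epsilon>)
    have "summable (\<lambda>n. c n * (of_real (t - s)) ^ n)"
      using real [of t] t by (auto simp: summable_def)
    moreover have "cmod (w - of_real s) < cmod (of_real (t - s))"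
      using t unfolding norm_of_real by simp
    ultimately have "summable (\<lambda>n. c n * (w - of_real s) ^ n)" by (rule powser_inside)
    then show ?thesis unfolding F_def by (rule summable_sums)
  qed
  have "F holomorphic_on ball (of_real s) \<epsilon>" using power_series_holomorphic sums by blast
  moreover have "F (of_real t) = \<gamma> t" if "\<bar>t - s\<bar> < \<epsilon>" for t
    using real [OF that] unfolding F_def by (rule sums_unique [symmetric])
  ultimately show ?thesis using \<epsilon> by blast
qed

lemma holomorphic_eq_on_real_imp_eq:
  assumes f: "f holomorphic_on S" and g: "g holomorphic_on S" and S: "open S" "connected S"
    and x: "of_real x \<in> S" and eq: "\<And>t. of_real t \<in> S \<Longrightarrow> f (of_real t) = g (of_real t)" and w: "w \<in> S"
  shows "f w = g w"
proof -
  obtain d where d: "0 < d" "ball (of_real x) d \<subseteq> S" using S(1) x openE by blast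
  have lim: "of_real x islimpt (S \<inter> \<real>)"
    unfolding islimpt_approachable
  proof (intro allI impI)
    fix e :: real assume e: "0 < e"
    have D: "dist (complex_of_real (x + min d e / 2)) (of_real x) = min d e / 2"
      using d e by (simp add: dist_norm del: of_real_divide)
    moreover have "complex_of_real (x + min d e / 2) \<in> S"
      using D d e by (intro subsetD [OF d(2)]) (simp add: dist_commute del: of_real_add of_real_divide)
    moreover have "min d e / 2 < e" "0 < min d e / 2" using d e by auto
    ultimately show "\<exists>x'\<in>S \<inter> \<real>. x' \<noteq> of_real x \<and> dist x' (of_real x) < e"
      by (intro bexI [of _ "complex_of_real (x + min d e / 2)"]) auto
  qed
  have "f w - g w = 0"
    by (rule analytic_continuation [of "\<lambda>w. f w - g w", OF holomorphic_on_diff [OF f g] S _ x lim])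
      (use eq w in \<open>auto elim: Reals_cases\<close>)
  then show ?thesis by simp
qed

text \<open>The local power series are glued. Discs centred on the real axis that meet have a convex
  intersection containing the real part of each of its points, and on the real points both series
  equal \<gamma>; the identity theorem makes them agree on the whole intersection.\<close>

lemma real_analytic_curve_extension:
  fixes \<gamma> :: "real \<Rightarrow> complex"
  assumes an: "real_analytic_curve_on \<gamma> I"
  obtains G D where "open D" "of_real ` I \<subseteq> D" "G holomorphic_on D" "\<And>s. s \<in> I \<Longrightarrow> G (of_real s) = \<gamma> s"
proof -
  have "\<forall>s\<in>I. \<exists>\<epsilon> F. 0 < \<epsilon> \<and> F holomorphic_on ball (of_real s) \<epsilon> \<and> (\<forall>t. \<bar>t - s\<bar> < \<epsilon> \<longrightarrow> F (of_real t) = \<gamma> t)"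
    using real_analytic_curve_local_extension [OF an] by blast
  then obtain \<epsilon> F where \<epsilon>: "\<And>s. s \<in> I \<Longrightarrow> 0 < \<epsilon> s"
    and F: "\<And>s. s \<in> I \<Longrightarrow> F s holomorphic_on ball (of_real s) (\<epsilon> s)"
    and Fr: "\<And>s t. s \<in> I \<Longrightarrow> \<bar>t - s\<bar> < \<epsilon> s \<Longrightarrow> F s (of_real t) = \<gamma> t"
    by metis
  let ?B = "\<lambda>s. ball (complex_of_real s) (\<epsilon> s)"
  have reB: "complex_of_real t \<in> ?B s \<longleftrightarrow> \<bar>t - s\<bar> < \<epsilon> s" for s t
    by (simp add: dist_real_def abs_minus_commute flip: of_real_diff)
  have agree: "F s w = F s' w" if s: "s \<in> I" "s' \<in> I" and w: "w \<in> ?B s" "w \<in> ?B s'" for s s' w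
  proof (rule holomorphic_eq_on_real_imp_eq [of "F s" "?B s \<inter> ?B s'" "F s'"])
    have Re: "\<bar>Re w - s\<bar> \<le> dist (of_real s) w" for s
      using abs_Re_le_cmod [of "w - of_real s"] by (simp add: dist_norm norm_minus_commute)
    have "\<bar>Re w - s\<bar> < \<epsilon> s" "\<bar>Re w - s'\<bar> < \<epsilon> s'"
      using w Re [of s] Re [of s'] by auto
    then show "of_real (Re w) \<in> ?B s \<inter> ?B s'" by (simp only: Int_iff reB simp_thms)
    show "F s holomorphic_on ?B s \<inter> ?B s'" "F s' holomorphic_on ?B s \<inter> ?B s'"
      using F s by (blast intro: holomorphic_on_subset)+
    show "connected (?B s \<inter> ?B s')" by (intro convex_connected convex_Int convex_ball)
    show "F s (of_real t) = F s' (of_real t)" if "of_real t \<in> ?B s \<inter> ?B s'" for t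
      using that Fr s by (simp only: Int_iff reB)
  qed (use w in auto)
  define G where "G = (\<lambda>w. F (SOME s. s \<in> I \<and> w \<in> ?B s) w)"
  have G: "G w = F s w" if s: "s \<in> I" "w \<in> ?B s" for s w
  proof -
    have "(SOME s. s \<in> I \<and> w \<in> ?B s) \<in> I \<and> w \<in> ?B (SOME s. s \<in> I \<and> w \<in> ?B s)"
      by (rule someI [of _ s]) (use s in simp)
    then show ?thesis unfolding G_def using agree s by blast
  qed
  show thesis
  proof
    show "open (\<Union>s\<in>I. ?B s)" by blast
    show "of_real ` I \<subseteq> (\<Union>s\<in>I. ?B s)" using \<epsilon> by auto
    have "G holomorphic_on ?B s" if "s \<in> I" for s
      using holomorphic_transform [OF F [OF that], of G] G [OF that] by simp
    then show "G holomorphic_on (\<Union>s\<in>I. ?B s)" by (intro holomorphic_on_UN_open) auto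
    show "G (of_real s) = \<gamma> s" if "s \<in> I" for s
      using G [OF that, of "of_real s"] \<epsilon> [OF that] Fr [OF that, of s] by simp
  qed
qed

lemma real_analytic_curve_on_continuous:
  fixes \<gamma> :: "real \<Rightarrow> complex"
  assumes "real_analytic_curve_on \<gamma> I" shows "continuous_on I \<gamma>"
proof -
  obtain G D where G: "of_real ` I \<subseteq> D" "G holomorphic_on D" "\<And>s. s \<in> I \<Longrightarrow> G (of_real s) = \<gamma> s"
    using real_analytic_curve_extension [OF assms] by metis
  have "continuous_on I (G \<circ> of_real)"
    by (intro continuous_on_compose continuous_intros continuous_on_subset [OF holomorphic_on_imp_continuous_on [OF G(2)] G(1)])
  then show ?thesis using G(3) by (simp cong: continuous_on_cong)
qed

text \<open>A nonvanishing derivative makes G injective only locally, and an injective regular arc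
  could come back arbitrarily close to one of its own points. Inside a Jordan curve this is
  impossible, which permits a neighbourhood of all of I on which G is injective.\<close>

proposition arc_reflection_exists:
  assumes c: "simple_path c" "pathfinish c = pathstart c" and sub: "\<Gamma> \<subseteq> path_image c"
    and reg: "regular_analytic_parametrization \<gamma> I \<Gamma>"
  shows "\<exists>N R. arc_reflection \<Gamma> N R"
proof -
  have I: "open I" and inj: "inj_on \<gamma> I" and an: "real_analytic_curve_on \<gamma> I"
    and vd: "\<And>s. s \<in> I \<Longrightarrow> vector_derivative \<gamma> (at s) \<noteq> 0" and \<Gamma>: "\<Gamma> = \<gamma> ` I"
    using reg by (auto simp: regular_analytic_parametrization_def)
  obtain G D0 where D0: "open D0" "of_real ` I \<subseteq> D0" and G: "G holomorphic_on D0"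
    and G\<gamma>: "\<And>s. s \<in> I \<Longrightarrow> G (of_real s) = \<gamma> s"
    using real_analytic_curve_extension [OF an] by metis
  have dG: "deriv G (of_real s) \<noteq> 0" if s: "s \<in> I" for s
  proof -
    have "(G has_field_derivative deriv G (of_real s)) (at (of_real s))"
      using D0 s by (intro holomorphic_derivI [OF G]) auto
    then have "((\<lambda>x. G (of_real x)) has_vector_derivative deriv G (of_real s)) (at s)"
      by (rule has_vector_derivative_real_field)
    then have "(\<gamma> has_vector_derivative deriv G (of_real s)) (at s)"
      by (rule has_vector_derivative_transform_within_open [OF _ I s G\<gamma>])
    then show ?thesis using vd [OF s] vector_derivative_at by metis
  qed
  \<comment> \<open>r is a radius of injectivity, \<eta> controls returns of the arc, and \<epsilon>
    keeps G within \<eta>/2 of the arc point. If G w1 = G w2, the arc points at s1 and s2 are closer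
    than the larger \<eta>, so |s1 - s2| is below a quarter of the larger r. As \<epsilon> \<le>
    r/4, w1 and w2 both lie in the disc with the larger r, where G is injective.\<close>
  define Q where "Q = (\<lambda>s r \<eta> \<epsilon>. 0 < r \<and> ball (complex_of_real s) r \<subseteq> D0 \<and> inj_on G (ball (of_real s) r) \<and>
      (\<forall>t\<in>I. dist (\<gamma> t) (\<gamma> s) < \<eta> \<longrightarrow> \<bar>t - s\<bar> < r/4) \<and>
      0 < \<epsilon> \<and> \<epsilon> \<le> r/4 \<and> (\<forall>w\<in>ball (of_real s) \<epsilon>. dist (G w) (\<gamma> s) < \<eta>/2))"
  have "\<exists>r \<eta> \<epsilon>. Q s r \<eta> \<epsilon>" if s: "s \<in> I" for s
  proof -
    obtain r where r: "0 < r" "ball (of_real s) r \<subseteq> D0" "inj_on G (ball (of_real s) r)"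
      using has_complex_derivative_locally_injective [OF G _ D0(1) dG [OF s]] D0(2) s by blast
    obtain \<eta> where \<eta>: "0 < \<eta>" "\<And>t. t \<in> I \<Longrightarrow> dist (\<gamma> t) (\<gamma> s) < \<eta> \<Longrightarrow> \<bar>t - s\<bar> < r/4"
      using curve_in_Jordan_curve_embedding [OF c I real_analytic_curve_on_continuous [OF an] inj _ s, of "r/4"]
        r sub \<Gamma> by auto
    have "isCont G (of_real s)"
      using holomorphic_on_imp_continuous_on [OF G] D0 s by (auto simp: continuous_on_eq_continuous_at)
    then obtain d where d: "0 < d" "\<And>w. dist w (of_real s) < d \<Longrightarrow> dist (G w) (G (of_real s)) < \<eta>/2"
      using \<eta>(1) unfolding continuous_at_eps_delta by (metis half_gt_zero)
    show ?thesis unfolding Q_def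
    proof (rule exI [of _ r], rule exI [of _ \<eta>], rule exI [of _ "min d (r/4)"], intro conjI)
      show "0 < min d (r/4)" using d r by simp
      show "\<forall>w\<in>ball (of_real s) (min d (r/4)). dist (G w) (\<gamma> s) < \<eta>/2"
        using d(2) G\<gamma> [OF s] by (auto simp: dist_commute)
    qed (use r \<eta> in auto)
  qed
  then obtain r \<eta> \<epsilon> where Q: "\<And>s. s \<in> I \<Longrightarrow> Q s (r s) (\<eta> s) (\<epsilon> s)" by metis
  have r: "0 < r s" "ball (of_real s) (r s) \<subseteq> D0" "inj_on G (ball (of_real s) (r s))"
    and \<epsilon>: "0 < \<epsilon> s" "\<epsilon> s \<le> r s / 4" "\<And>w. w \<in> ball (of_real s) (\<epsilon> s) \<Longrightarrow> dist (G w) (\<gamma> s) < \<eta> s / 2"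
    and \<eta>: "\<And>t. t \<in> I \<Longrightarrow> dist (\<gamma> t) (\<gamma> s) < \<eta> s \<Longrightarrow> \<bar>t - s\<bar> < r s / 4"
    if "s \<in> I" for s
    using Q [OF that] by (auto simp: Q_def)
  define D where "D = (\<Union>s\<in>I. ball (complex_of_real s) (\<epsilon> s))"
  have "inj_on G D"
  proof (rule inj_onI)
    fix w1 w2 assume "w1 \<in> D" "w2 \<in> D" and eq: "G w1 = G w2"
    then obtain s1 s2 where s: "s1 \<in> I" "s2 \<in> I"
      and w: "w1 \<in> ball (of_real s1) (\<epsilon> s1)" "w2 \<in> ball (of_real s2) (\<epsilon> s2)"
      by (auto simp: D_def)
    have close: "\<bar>s1 - s2\<bar> < max (r s1) (r s2) / 4"
    proof -
      have "dist (\<gamma> s1) (\<gamma> s2) \<le> dist (G w1) (\<gamma> s1) + dist (G w2) (\<gamma> s2)"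
        using eq dist_triangle3 [of "\<gamma> s1" "\<gamma> s2" "G w1"] by simp
      then have "dist (\<gamma> s1) (\<gamma> s2) < \<eta> s1 / 2 + \<eta> s2 / 2"
        using \<epsilon>(3) [OF s(1) w(1)] \<epsilon>(3) [OF s(2) w(2)] by linarith
      then have "dist (\<gamma> s2) (\<gamma> s1) < \<eta> s1 \<or> dist (\<gamma> s1) (\<gamma> s2) < \<eta> s2"
        by (simp add: dist_commute) linarith
      then show ?thesis using \<eta> [OF s] \<eta> [OF s(2,1)] by (auto simp: max_def abs_minus_commute)
    qed
    have both: "w1 \<in> ball (of_real s) (r s) \<and> w2 \<in> ball (of_real s) (r s)"
      if rs: "r s = max (r s1) (r s2)" "s = s1 \<or> s = s2" for s
    proof -
      have ds: "dist (complex_of_real s) (of_real s1) < r s / 4" "dist (complex_of_real s) (of_real s2) < r s / 4"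
        using rs close r(1) [OF s(1)] r(1) [OF s(2)]
        by (auto simp: dist_norm abs_minus_commute simp flip: of_real_diff)
      have "dist (of_real s1) w1 < r s / 4" "dist (of_real s2) w2 < r s / 4"
        using w \<epsilon>(2) [OF s(1)] \<epsilon>(2) [OF s(2)] rs(1) by auto
      then show ?thesis
        using ds dist_triangle [of "of_real s" w1 "of_real s1"] dist_triangle [of "of_real s" w2 "of_real s2"]
          r(1) [OF s(1)] rs(1) by auto
    qed
    obtain t where t: "t \<in> I" "r t = max (r s1) (r s2)" "t = s1 \<or> t = s2"
      using s by (metis max_def)
    show "w1 = w2" using inj_onD [OF r(3) [OF t(1)] eq] both [OF t(2,3)] by blast
  qed
  moreover have "open D" by (auto simp: D_def)
  moreover have "of_real ` I \<subseteq> D" using \<epsilon>(1) by (auto simp: D_def)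
  moreover have "cnj ` D = D"
  proof -
    have "cnj w \<in> D" if "w \<in> D" for w
    proof -
      have "dist (complex_of_real s) (cnj w) = dist (of_real s) w" for s
        by (metis complex_cnj_complex_of_real complex_cnj_diff complex_mod_cnj dist_norm)
      then show ?thesis using that by (simp add: D_def)
    qed
    then show ?thesis by (metis complex_cnj_cnj image_eqI image_subsetI subsetI subset_antisym)
  qed
  moreover have "G holomorphic_on D"
  proof (rule holomorphic_on_subset [OF G])
    show "D \<subseteq> D0" unfolding D_def
    proof (intro UN_least)
      fix s assume s: "s \<in> I"
      have "ball (complex_of_real s) (\<epsilon> s) \<subseteq> ball (of_real s) (r s)"
        using \<epsilon>(2) [OF s] r(1) [OF s] by (intro subset_ball) linarith
      then show "ball (complex_of_real s) (\<epsilon> s) \<subseteq> D0" using r(2) [OF s] by blast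
    qed
  qed
  ultimately have "arc_reflection \<Gamma> (G ` D) (\<lambda>z. G (cnj (inv_into D G z)))"
    unfolding arc_reflection_def using reg G\<gamma> by blast
  then show ?thesis by blast
qed

section \<open>Isotropic segments over Jordan domains\<close>

text \<open>The splitting of \<Gamma> and the reflection each bring a parametrization of their own.
  The change of parameter \<theta> is injective, and continuous because the inverse of \<gamma> is
  the restriction of the holomorphic inverse of G. On an interval it is therefore strictly monotone
  and either preserves or exchanges the sides of \<open>z0\<close>.\<close>

lemma arc_sides:
  assumes Ga: "inj_on G D" "G holomorphic_on D" "open D" "of_real ` I \<subseteq> D"
    and GI: "\<And>s. s \<in> I \<Longrightarrow> G (of_real s) = \<gamma> s" and \<Gamma>: "\<Gamma> = \<gamma> ` I" and s0: "s0 \<in> I" "\<gamma> s0 = z0"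
    and split: "analytic_arc_split_at \<Gamma> z0 \<Gamma>1 \<Gamma>2"
  shows "(\<forall>s\<in>I. (s < s0 \<longrightarrow> \<gamma> s \<in> \<Gamma>1) \<and> (s0 < s \<longrightarrow> \<gamma> s \<in> \<Gamma>2)) \<or>
    (\<forall>s\<in>I. (s < s0 \<longrightarrow> \<gamma> s \<in> \<Gamma>2) \<and> (s0 < s \<longrightarrow> \<gamma> s \<in> \<Gamma>1))"
proof -
  obtain \<beta> J t0 where \<beta>: "regular_analytic_parametrization \<beta> J \<Gamma>" "t0 \<in> J" "\<beta> t0 = z0"
    and \<Gamma>12: "\<Gamma>1 = \<beta> ` (J \<inter> {..<t0})" "\<Gamma>2 = \<beta> ` (J \<inter> {t0<..})"
    using split unfolding analytic_arc_split_at_def by blast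
  have J: "is_interval J" "inj_on \<beta> J" "continuous_on J \<beta>" "\<Gamma> = \<beta> ` J"
    using \<beta>(1) by (auto simp: regular_analytic_parametrization_def intro: real_analytic_curve_on_continuous)
  obtain K where K: "K holomorphic_on G ` D" "\<And>z. z \<in> D \<Longrightarrow> K (G z) = z"
    using holomorphic_has_inverse [OF Ga(2,3,1)] by metis
  have K\<gamma>: "K (\<gamma> s) = of_real s" if "s \<in> I" for s
    using K(2) [of "of_real s"] GI [OF that] Ga(4) that by auto
  define \<theta> where "\<theta> = (\<lambda>t. Re (K (\<beta> t)))"
  have \<theta>: "\<theta> t \<in> I \<and> \<gamma> (\<theta> t) = \<beta> t" if t: "t \<in> J" for t
  proof -
    obtain s where "s \<in> I" "\<beta> t = \<gamma> s" using t J(4) \<Gamma> by blast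
    then show ?thesis using K\<gamma> [of s] by (simp add: \<theta>_def)
  qed
  have \<theta>t0: "\<theta> t0 = s0" using K\<gamma> [OF s0(1)] by (simp add: \<theta>_def \<beta>(3) s0(2))
  have "\<beta> ` J \<subseteq> G ` D"
  proof (rule image_subsetI)
    fix t assume "t \<in> J"
    then have "\<theta> t \<in> I" "\<beta> t = G (of_real (\<theta> t))" using \<theta> [of t] GI [of "\<theta> t"] by auto
    then show "\<beta> t \<in> G ` D" using Ga(4) by blast
  qed
  then have "continuous_on J (\<lambda>t. Re (K (\<beta> t)))"
    by (intro continuous_intros continuous_on_compose2 [OF holomorphic_on_imp_continuous_on [OF K(1)] J(3)])
  then have "continuous_on J \<theta>" by (simp add: \<theta>_def)
  moreover have "inj_on \<theta> J"
    using \<theta> inj_onD [OF J(2)] by (intro inj_onI) metis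
  ultimately have mono: "strict_mono_on J \<theta> \<or> strict_antimono_on J \<theta>"
    using injective_eq_monotone_map [OF J(1)] by blast
  have ex: "\<exists>t\<in>J. \<beta> t = \<gamma> s \<and> \<theta> t = s" if "s \<in> I" for s
  proof -
    have "\<gamma> s \<in> \<beta> ` J" using that unfolding J(4) [symmetric] \<Gamma> by (rule imageI)
    then obtain t where t: "t \<in> J" "\<gamma> s = \<beta> t" by (rule imageE)
    then have "\<theta> t = s" using K\<gamma> [OF that] by (simp add: \<theta>_def)
    then show ?thesis using t by (intro bexI [of _ t]) simp_all
  qed
  from mono show ?thesis
  proof
    assume m: "strict_mono_on J \<theta>"
    have "s < s0 \<longleftrightarrow> t < t0" "s0 < s \<longleftrightarrow> t0 < t" if "t \<in> J" "\<theta> t = s" for s t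
      using strict_mono_on_less [OF m] that \<beta>(2) \<theta>t0 by auto
    then have "\<forall>s\<in>I. (s < s0 \<longrightarrow> \<gamma> s \<in> \<Gamma>1) \<and> (s0 < s \<longrightarrow> \<gamma> s \<in> \<Gamma>2)"
      unfolding \<Gamma>12 using ex by (metis IntI greaterThan_iff image_eqI lessThan_iff)
    then show ?thesis by blast
  next
    assume m: "strict_antimono_on J \<theta>"
    have "s < s0 \<longrightarrow> t0 < t" "s0 < s \<longrightarrow> t < t0" if "t \<in> J" "\<theta> t = s" for s t
      using monotone_onD [OF m, of t t0] monotone_onD [OF m, of t0 t] that \<beta>(2) \<theta>t0
      by (cases t t0 rule: linorder_cases; auto)+
    then have "\<forall>s\<in>I. (s < s0 \<longrightarrow> \<gamma> s \<in> \<Gamma>2) \<and> (s0 < s \<longrightarrow> \<gamma> s \<in> \<Gamma>1)"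
      unfolding \<Gamma>12 using ex by (metis IntI greaterThan_iff image_eqI lessThan_iff)
    then show ?thesis by blast
  qed
qed

text \<open>The two halves of the disc cannot lie on the same side, because both the domain and the
  exterior accumulate at every point of the Jordan curve.\<close>

lemma Jordan_domain_one_side:
  assumes \<Omega>: "jordan_domain \<Omega>" and G: "G holomorphic_on ball (of_real s0) \<rho>" "inj_on G (ball (of_real s0) \<rho>)"
    and \<rho>: "0 < \<rho>"
    and fr: "\<And>w. w \<in> ball (of_real s0) \<rho> \<Longrightarrow> G w \<in> frontier \<Omega> \<longleftrightarrow> Im w = 0"
  shows "(\<forall>w\<in>ball (of_real s0) \<rho>. G w \<in> \<Omega> \<longleftrightarrow> 0 < Im w) \<or> (\<forall>w\<in>ball (of_real s0) \<rho>. G w \<in> \<Omega> \<longleftrightarrow> Im w < 0)"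
proof -
  let ?B = "ball (complex_of_real s0) \<rho>"
  obtain c where c: "simple_path c" "pathfinish c = pathstart c" and \<Omega>c: "\<Omega> = inside (path_image c)"
    using \<Omega> by (auto simp: jordan_domain_def)
  define E where "E = outside (path_image c)"
  note J = Jordan_inside_outside [OF c]
  have op: "open \<Omega>" and fE: "frontier E = frontier \<Omega>" and disj: "\<Omega> \<inter> E = {}" and opE: "open E"
    using J by (auto simp: \<Omega>c E_def)
  \<comment> \<open>Off the real axis G avoids the frontier of the domain, so the connected image of
    a half disc lies entirely inside the domain or entirely outside it.\<close>
  have side: "G ` S \<subseteq> \<Omega> \<or> G ` S \<inter> \<Omega> = {}"
    if S: "S \<subseteq> ?B" "convex S" "\<And>w. w \<in> S \<Longrightarrow> Im w \<noteq> 0" for S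
  proof (rule ccontr)
    assume "\<not> ?thesis"
    moreover have "connected (G ` S)"
      by (intro connected_continuous_image convex_connected S
          continuous_on_subset [OF holomorphic_on_imp_continuous_on [OF G(1)]])
    ultimately have "G ` S \<inter> frontier \<Omega> \<noteq> {}" by (intro connected_Int_frontier) auto
    then show False using S(1,3) fr by blast
  qed
  have upper: "G ` (?B \<inter> {w. 0 < Im w}) \<subseteq> \<Omega> \<or> G ` (?B \<inter> {w. 0 < Im w}) \<inter> \<Omega> = {}"
    by (intro side convex_Int convex_ball convex_halfspace_Im_gt) auto
  have lower: "G ` (?B \<inter> {w. Im w < 0}) \<subseteq> \<Omega> \<or> G ` (?B \<inter> {w. Im w < 0}) \<inter> \<Omega> = {}"
    by (intro side convex_Int convex_ball convex_halfspace_Im_lt) auto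
  have opB: "open (G ` ?B)" by (rule open_mapping_thm3 [OF G(1) open_ball G(2)])
  have "G (of_real s0) \<in> frontier \<Omega>" using fr \<rho> by simp
  then have cl: "G (of_real s0) \<in> closure \<Omega>" "G (of_real s0) \<in> closure E"
    using fE by (auto simp: frontier_def)
  have s0B: "G (of_real s0) \<in> G ` ?B" using \<rho> by simp
  have "G ` ?B \<inter> closure \<Omega> \<noteq> {}" "G ` ?B \<inter> closure E \<noteq> {}" using cl s0B by blast+
  then have "G ` ?B \<inter> \<Omega> \<noteq> {}" "G ` ?B \<inter> E \<noteq> {}"
    by (simp_all add: open_Int_closure_eq_empty [OF opB])
  then obtain w1 w2 where w1: "w1 \<in> ?B" "G w1 \<in> \<Omega>" and w2: "w2 \<in> ?B" "G w2 \<in> E" by blast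
  have no_fr: "z \<notin> frontier \<Omega>" if "z \<in> \<Omega> \<or> z \<in> E" for z
    using that op opE fE by (auto simp: frontier_def interior_open)
  have n1: "Im w1 \<noteq> 0" and n2: "Im w2 \<noteq> 0" using fr w1 w2 no_fr by auto
  have n3: "G w2 \<notin> \<Omega>" using w2 disj by blast
  have real: "G w \<notin> \<Omega>" if "w \<in> ?B" "Im w = 0" for w using fr [OF that(1)] that(2) no_fr by blast
  have tri: "Im w = 0 \<or> 0 < Im w \<or> Im w < 0" for w by linarith
  show ?thesis
  proof (cases "0 < Im w1")
    case True
    then have U: "G ` (?B \<inter> {w. 0 < Im w}) \<subseteq> \<Omega>" using upper w1 by blast
    then have "Im w2 < 0" using w2 n2 n3 tri [of w2] by blast
    then have L: "G ` (?B \<inter> {w. Im w < 0}) \<inter> \<Omega> = {}" using lower w2 n3 by blast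
    have "G w \<in> \<Omega> \<longleftrightarrow> 0 < Im w" if "w \<in> ?B" for w
      using U L real [OF that] that tri [of w] by blast
    then show ?thesis by blast
  next
    case False
    then have "Im w1 < 0" using n1 by simp
    then have L: "G ` (?B \<inter> {w. Im w < 0}) \<subseteq> \<Omega>" using lower w1 by blast
    then have "0 < Im w2" using w2 n2 n3 tri [of w2] by blast
    then have U: "G ` (?B \<inter> {w. 0 < Im w}) \<inter> \<Omega> = {}" using upper w2 n3 by blast
    have "G w \<in> \<Omega> \<longleftrightarrow> Im w < 0" if "w \<in> ?B" for w
      using U L real [OF that] that tri [of w] by blast
    then show ?thesis by blast
  qed
qed

text \<open>The chart is the continuation G supplied by the reflection, or w \<mapsto> G(-w) if the
  domain lies below the axis. Both describe the same reflection, since negation commutes with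
  conjugation.\<close>

lemma jump_chart_exists:
  assumes \<Omega>: "jordan_domain \<Omega>"
    and P: "P holomorphic_on \<Omega>" "\<forall>z\<in>\<Omega>. \<phi> z = Re (P z)"
    and M: "\<forall>z\<in>\<Omega>. \<bar>\<phi> z\<bar> \<le> M"
    and S: "S = (\<lambda>z. (z, \<phi> z)) ` \<Omega>"
    and z0: "z0 \<in> frontier \<Omega>"
    and seg: "segment_connects_horizontal_curves \<Omega> S z0 U \<Gamma> a b"
    and NR: "arc_reflection \<Gamma> N R"
  obtains G s0 \<rho> a' b' where "jump_chart \<Omega> G s0 \<rho> \<phi> P M a' b'" "G (of_real s0) = z0"
    "(a', b') = (a, b) \<or> (a', b') = (b, a)"
    "\<And>w. w \<in> ball (of_real s0) \<rho> \<Longrightarrow> G w \<in> N \<and> R (G w) = G (cnj w)"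
proof -
  have U: "open U" "z0 \<in> U" and ab: "a \<noteq> b" and \<Gamma>U: "\<Gamma> = frontier \<Omega> \<inter> U"
    using seg by (auto simp: segment_connects_horizontal_curves_def)
  obtain \<Gamma>1 \<Gamma>2 where split: "analytic_arc_split_at \<Gamma> z0 \<Gamma>1 \<Gamma>2"
    and bdry: "surface_boundary S \<inter> (U \<times> UNIV) = \<Gamma>1 \<times> {a} \<union> isotropic_segment z0 a b \<union> \<Gamma>2 \<times> {b}"
    using seg unfolding segment_connects_horizontal_curves_def by blast
  have \<Gamma>12: "\<Gamma>1 \<inter> \<Gamma>2 = {}" "z0 \<notin> \<Gamma>1" "z0 \<notin> \<Gamma>2"
  proof -
    obtain \<beta> J t0 where reg: "regular_analytic_parametrization \<beta> J \<Gamma>" and t0: "t0 \<in> J" "\<beta> t0 = z0"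
      and eq: "\<Gamma>1 = \<beta> ` (J \<inter> {..<t0})" "\<Gamma>2 = \<beta> ` (J \<inter> {t0<..})"
      using split unfolding analytic_arc_split_at_def by blast
    then have \<beta>: "inj_on \<beta> J" "t0 \<in> J" "\<beta> t0 = z0"
      by (simp_all add: regular_analytic_parametrization_def)
    have "\<Gamma>1 \<inter> \<Gamma>2 = \<beta> ` ((J \<inter> {..<t0}) \<inter> (J \<inter> {t0<..}))"
      unfolding eq by (rule inj_on_image_Int [OF \<beta>(1), symmetric]) auto
    moreover have "(J \<inter> {..<t0}) \<inter> (J \<inter> {t0<..}) = {}" by auto
    ultimately show "\<Gamma>1 \<inter> \<Gamma>2 = {}" by simp
    show "z0 \<notin> \<Gamma>1" "z0 \<notin> \<Gamma>2"
      unfolding eq \<beta>(3) [symmetric] by (subst inj_on_image_mem_iff [OF \<beta>(1,2)]; simp)+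
  qed
  obtain \<gamma> I G D where reg: "regular_analytic_parametrization \<gamma> I \<Gamma>"
    and D: "open D" "complex_of_real ` I \<subseteq> D" "cnj ` D = D"
    and G12: "G holomorphic_on D" "inj_on G D" and G3: "\<forall>s\<in>I. G (complex_of_real s) = \<gamma> s"
    and N: "N = G ` D" and R: "\<forall>z\<in>N. R z = G (cnj (inv_into D G z))"
    using NR unfolding arc_reflection_def by (elim exE conjE) (rule that)
  note G = G12 G3 [rule_format]
  have I: "open I" and \<Gamma>I: "\<Gamma> = \<gamma> ` I" using reg by (auto simp: regular_analytic_parametrization_def)
  have op: "open \<Omega>"
    using \<Omega> Jordan_inside_outside by (auto simp: jordan_domain_def)
  have "z0 \<in> \<Gamma>" using z0 U \<Gamma>U by blast
  then obtain s0 where s0: "s0 \<in> I" "\<gamma> s0 = z0" using \<Gamma>I by auto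
  have Gs0: "G (of_real s0) = z0" using G(3) s0 by simp
  have RG: "R (G w) = G (cnj w)" if "w \<in> D" for w
    using that R G(2) by (simp add: N)
  obtain \<rho> where \<rho>: "0 < \<rho>" "ball (of_real s0) \<rho> \<subseteq> D" "G ` ball (of_real s0) \<rho> \<subseteq> U" "ball s0 \<rho> \<subseteq> I"
  proof -
    obtain r1 where r1: "0 < r1" "ball (of_real s0) r1 \<subseteq> D" using D(1,2) s0 openE by blast
    obtain r2 where r2: "0 < r2" "ball s0 r2 \<subseteq> I" using I s0 openE by blast
    have "isCont G (of_real s0)"
      using holomorphic_on_imp_continuous_on [OF G(1)] D s0 by (auto simp: continuous_on_eq_continuous_at)
    then have "\<forall>\<^sub>F w in at (of_real s0). G w \<in> U"
      using U Gs0 by (auto simp: isCont_def dest: topological_tendstoD)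
    then obtain r3 where r3: "0 < r3" "\<And>w. w \<noteq> of_real s0 \<Longrightarrow> dist w (of_real s0) < r3 \<Longrightarrow> G w \<in> U"
      unfolding eventually_at by blast
    have r3': "G w \<in> U" if "dist w (of_real s0) < r3" for w
      using r3(2) [OF _ that] Gs0 U(2) by (cases "w = of_real s0") auto
    show thesis
      by (rule that [of "min r1 (min r2 r3)"]) (use r1 r2 r3(1) r3' in \<open>auto simp: dist_commute subset_iff\<close>)
  qed
  let ?B = "ball (complex_of_real s0) \<rho>"
  have GB: "G holomorphic_on ?B" "inj_on G ?B"
    using holomorphic_on_subset [OF G(1) \<rho>(2)] inj_on_subset [OF G(2) \<rho>(2)] .
  have realB: "complex_of_real x \<in> ?B \<longleftrightarrow> \<bar>x - s0\<bar> < \<rho>" for x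
    by (simp add: dist_real_def abs_minus_commute flip: of_real_diff)
  have xI: "x \<in> I" if "\<bar>x - s0\<bar> < \<rho>" for x
    using that \<rho>(4) by (auto simp: dist_real_def abs_minus_commute subset_iff)
  have fr: "G w \<in> frontier \<Omega> \<longleftrightarrow> Im w = 0" if w: "w \<in> ?B" for w
  proof
    assume "G w \<in> frontier \<Omega>"
    then have "G w \<in> \<gamma> ` I" using w \<rho>(3) \<Gamma>U \<Gamma>I by blast
    then obtain s where "s \<in> I" "G w = G (of_real s)" using G(3) by auto
    then have "w = of_real s" using inj_onD [OF G(2)] w \<rho>(2) D(2) by blast
    then show "Im w = 0" by simp
  next
    assume "Im w = 0"
    then have wr: "w = of_real (Re w)" by (simp add: complex_eq_iff)
    then have "\<bar>Re w - s0\<bar> < \<rho>" using w realB by metis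
    from xI [OF this] have "G w \<in> \<gamma> ` I" using G(3) [of "Re w"] wr by auto
    then show "G w \<in> frontier \<Omega>" using \<Gamma>U \<Gamma>I by blast
  qed
  \<comment> \<open>A point of the closure of S over a frontier point of \<Omega> is not in S, so it
    belongs to the surface boundary. As the two subarcs and \<open>z0\<close> are pairwise disjoint,
    only one piece of that boundary lies over it.\<close>
  have height: "(\<gamma> x \<in> \<Gamma>1 \<longrightarrow> \<tau> = a) \<and> (\<gamma> x \<in> \<Gamma>2 \<longrightarrow> \<tau> = b)"
    if x: "\<bar>x - s0\<bar> < \<rho>" and cl: "(G (of_real x), \<tau>) \<in> closure S" for x \<tau>
  proof -
    have "G (of_real x) \<in> frontier \<Omega>" using fr [of "of_real x"] realB x by simp
    then have "G (of_real x) \<notin> \<Omega>" using op by (auto simp: frontier_def interior_open)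
    then have "(G (of_real x), \<tau>) \<in> surface_boundary S"
      using cl by (auto simp: surface_boundary_def S)
    moreover have "G (of_real x) \<in> U" using \<rho>(3) realB x by blast
    ultimately have "(\<gamma> x, \<tau>) \<in> \<Gamma>1 \<times> {a} \<union> isotropic_segment z0 a b \<union> \<Gamma>2 \<times> {b}"
      using bdry G(3) [OF xI [OF x]] by auto
    then show ?thesis using \<Gamma>12 by (auto simp: isotropic_segment_def)
  qed
  obtain a' b' where ab': "(a', b') = (a, b) \<or> (a', b') = (b, a)"
    and lh: "\<And>x \<tau>. \<bar>x - s0\<bar> < \<rho> \<Longrightarrow> x < s0 \<Longrightarrow> (G (of_real x), \<tau>) \<in> closure S \<Longrightarrow> \<tau> = a'"
    and rh: "\<And>x \<tau>. \<bar>x - s0\<bar> < \<rho> \<Longrightarrow> s0 < x \<Longrightarrow> (G (of_real x), \<tau>) \<in> closure S \<Longrightarrow> \<tau> = b'"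
  proof -
    from arc_sides [OF G(2,1) D(1,2) G(3) \<Gamma>I s0 split] show thesis
    proof
      assume "\<forall>s\<in>I. (s < s0 \<longrightarrow> \<gamma> s \<in> \<Gamma>1) \<and> (s0 < s \<longrightarrow> \<gamma> s \<in> \<Gamma>2)"
      then show thesis using that [of a b] height xI by blast
    next
      assume "\<forall>s\<in>I. (s < s0 \<longrightarrow> \<gamma> s \<in> \<Gamma>2) \<and> (s0 < s \<longrightarrow> \<gamma> s \<in> \<Gamma>1)"
      then show thesis using that [of b a] height xI by blast
    qed
  qed
  have ne: "a' \<noteq> b'" using ab' ab by auto
  from Jordan_domain_one_side [OF \<Omega> GB \<rho>(1) fr] show thesis
  proof
    assume up: "\<forall>w\<in>?B. G w \<in> \<Omega> \<longleftrightarrow> 0 < Im w"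
    show thesis
    proof (rule that [of G s0 \<rho> a' b'])
      show "jump_chart \<Omega> G s0 \<rho> \<phi> P M a' b'"
        by unfold_locales (use op \<rho>(1) GB up P M ne lh rh S in auto)
      show "G w \<in> N \<and> R (G w) = G (cnj w)" if "w \<in> ?B" for w
        using that \<rho>(2) RG N by blast
    qed (use Gs0 ab' in auto)
  next
    assume low: "\<forall>w\<in>?B. G w \<in> \<Omega> \<longleftrightarrow> Im w < 0"
    \<comment> \<open>Negation is holomorphic and exchanges the two half discs. It also reverses the
      real axis, hence the interchange of \<open>a'\<close> and \<open>b'\<close>.\<close>
    define G' where "G' = (\<lambda>w. G (- w))"
    have neg: "- w \<in> ?B" if "w \<in> ball (complex_of_real (- s0)) \<rho>" for w
      using that by (simp add: dist_norm add.commute norm_minus_commute)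
    show thesis
    proof (rule that [of G' "- s0" \<rho> b' a'])
      show "jump_chart \<Omega> G' (- s0) \<rho> \<phi> P M b' a'"
      proof unfold_locales
        have "G \<circ> uminus holomorphic_on ball (complex_of_real (- s0)) \<rho>"
          using neg by (intro holomorphic_on_compose_gen [OF _ GB(1)] holomorphic_intros) auto
        then show "G' holomorphic_on ball (complex_of_real (- s0)) \<rho>" by (simp add: G'_def o_def)
        show "inj_on G' (ball (complex_of_real (- s0)) \<rho>)"
          using inj_onD [OF GB(2)] neg by (intro inj_onI) (fastforce simp: G'_def)
        show "G' w \<in> \<Omega> \<longleftrightarrow> 0 < Im w" if "w \<in> ball (complex_of_real (- s0)) \<rho>" for w
          using low neg [OF that] by (simp add: G'_def)
        show "\<tau> = b'" if "\<bar>x - - s0\<bar> < \<rho>" "x < - s0" "(G' (of_real x), \<tau>) \<in> closure ((\<lambda>z. (z, \<phi> z)) ` \<Omega>)" for x \<tau>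
          using rh [of "- x" \<tau>] that by (simp add: G'_def S abs_minus_commute)
        show "\<tau> = a'" if "\<bar>x - - s0\<bar> < \<rho>" "- s0 < x" "(G' (of_real x), \<tau>) \<in> closure ((\<lambda>z. (z, \<phi> z)) ` \<Omega>)" for x \<tau>
          using lh [of "- x" \<tau>] that by (simp add: G'_def S abs_minus_commute)
      qed (use op \<rho>(1) P M ne in auto)
      show "G' w \<in> N \<and> R (G' w) = G' (cnj w)" if "w \<in> ball (complex_of_real (- s0)) \<rho>" for w
        using neg [OF that] \<rho>(2) RG N by (auto simp: G'_def)
    qed (use Gs0 ab' in \<open>auto simp: G'_def\<close>)
  qed
qed

lemma isotropic_segment_commute: "isotropic_segment z0 a b = isotropic_segment z0 b a"
  by (simp add: isotropic_segment_def min.commute max.commute)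

theorem theorem3p7:
  fixes \<Omega> U \<Gamma> :: "complex set" and \<phi> :: "complex \<Rightarrow> real"
    and S L :: "(complex \<times> real) set" and z0 :: complex and a b m :: real
  assumes "jordan_domain \<Omega>" and "simply_connected \<Omega>"
    and "zmc_graph \<Omega> \<phi> S" and "bounded S"
    and "z0 \<in> frontier \<Omega>"
    and "segment_connects_horizontal_curves \<Omega> S z0 U \<Gamma> a b"
    and "L = isotropic_segment z0 a b"
    and "m = (a + b) / 2"
  shows "((\<exists>N R. arc_reflection \<Gamma> N R) \<and>
      (\<forall>N R. arc_reflection \<Gamma> N R \<longrightarrow>
        extends_analytically_across \<Omega> \<phi> z0 a b (N \<times> UNIV) (segment_reflection R m))) \<and>
    (\<forall>X w0. conformal_parametrization \<Omega> \<phi> X \<and> boundary_value_at X w0 z0 \<longrightarrow>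
      L = cluster_set X w0)"
proof -
  have harm: "harmonic_on \<phi> \<Omega>" and S: "S = (\<lambda>z. (z, \<phi> z)) ` \<Omega>"
    using assms(3) by (auto simp: zmc_graph_def)
  obtain P where P: "P holomorphic_on \<Omega>" "\<forall>z\<in>\<Omega>. \<phi> z = Re (P z)"
    using harmonic_on_eq_Re_holomorphic [OF harm assms(2)] by metis
  obtain M where M: "\<forall>z\<in>\<Omega>. \<bar>\<phi> z\<bar> \<le> M"
  proof -
    obtain M where M: "\<And>p. p \<in> S \<Longrightarrow> norm p \<le> M" using assms(4) unfolding bounded_iff by blast
    have "\<bar>\<phi> z\<bar> \<le> M" if "z \<in> \<Omega>" for z
    proof -
      have "norm (z, \<phi> z) \<le> M" using that by (intro M) (simp add: S)
      then show ?thesis using norm_snd_le [of "\<phi> z" z] by simp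
    qed
    then show thesis using that by blast
  qed
  obtain c where c: "simple_path c" "pathfinish c = pathstart c" and \<Omega>c: "\<Omega> = inside (path_image c)"
    using assms(1) by (auto simp: jordan_domain_def)
  note J = Jordan_inside_outside [OF c]
  have fr: "frontier \<Omega> = path_image c" and proper: "\<Omega> \<noteq> UNIV"
    using J by (auto simp: \<Omega>c)
  obtain \<gamma> I where "regular_analytic_parametrization \<gamma> I \<Gamma>"
    using assms(6) unfolding segment_connects_horizontal_curves_def analytic_arc_split_at_def by blast
  moreover have "\<Gamma> \<subseteq> path_image c"
    using assms(6) fr by (auto simp: segment_connects_horizontal_curves_def)
  ultimately have ex: "\<exists>N R. arc_reflection \<Gamma> N R"
    using arc_reflection_exists [OF c] by blast
  have "extends_analytically_across \<Omega> \<phi> z0 a b (N \<times> UNIV) (segment_reflection R m)"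
    if NR: "arc_reflection \<Gamma> N R" for N R
  proof -
    obtain G s0 \<rho> a' b' where jc: "jump_chart \<Omega> G s0 \<rho> \<phi> P M a' b'" and z0: "G (of_real s0) = z0"
      and ab: "(a', b') = (a, b) \<or> (a', b') = (b, a)"
      and R: "\<And>w. w \<in> ball (of_real s0) \<rho> \<Longrightarrow> G w \<in> N \<and> R (G w) = G (cnj w)"
      by (rule jump_chart_exists [OF assms(1) P M S assms(5,6) NR]) (rule that)
    interpret jump_chart \<Omega> G s0 \<rho> \<phi> P M a' b' by (rule jc)
    obtain h where h: "biholomorphic_between h upper_half_plane \<Omega>"
      "(h \<longlongrightarrow> G (of_real s0)) (at 0 within upper_half_plane)"
      using exists_parametrization [OF assms(2) proper] by metis
    have "conformal_parametrization \<Omega> \<phi> (\<lambda>w. (h w, \<phi> (h w)))" "boundary_value_at (\<lambda>w. (h w, \<phi> (h w))) 0 z0"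
      using h z0 by (simp_all add: conformal_parametrization_def boundary_value_at_def o_def)
    then have ex_param: "\<exists>X. conformal_parametrization \<Omega> \<phi> X \<and> boundary_value_at X 0 z0" by blast
    \<comment> \<open>The open segment and its midpoint are symmetric in the two heights, so a
      possible swap made by the chart disappears here.\<close>
    have seg: "isotropic_segment z0 a' b' - {(z0, a'), (z0, b')} = isotropic_segment z0 a b - {(z0, a), (z0, b)}"
      and m: "(a' + b') / 2 = m"
      using ab assms(8) isotropic_segment_commute by (auto simp: add.commute)
    show ?thesis
      unfolding extends_analytically_across_def
    proof (intro conjI allI impI, goal_cases)
      case 1
      show ?case by (rule ex_param)
    next
      case (2 X)
      then have "conformal_parametrization \<Omega> \<phi> X" "boundary_value_at X 0 (G (of_real s0))"
        by (simp_all add: z0)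
      from analytic_extension [OF this R] show ?case unfolding z0 seg m .
    qed
  qed
  moreover have "L = cluster_set X w0"
    if "conformal_parametrization \<Omega> \<phi> X" "boundary_value_at X w0 z0" for X w0
  proof -
    \<comment> \<open>The cluster set does not involve a reflection; one is chosen because it
      supplies the conformal continuation from which the chart is built.\<close>
    obtain N R where NR: "arc_reflection \<Gamma> N R" using ex by blast
    obtain G s0 \<rho> a' b' where jc: "jump_chart \<Omega> G s0 \<rho> \<phi> P M a' b'" and z0: "G (of_real s0) = z0"
      and ab: "(a', b') = (a, b) \<or> (a', b') = (b, a)"
      by (rule jump_chart_exists [OF assms(1) P M S assms(5,6) NR]) (rule that)
    have "cluster_set X w0 = isotropic_segment z0 a' b'"
      using jump_chart.cluster_set_eq_segment [OF jc, unfolded z0] that by blast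
    then show ?thesis using ab assms(7) isotropic_segment_commute by auto
  qed
  ultimately show ?thesis using ex by blast
qed

end
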